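(* For every integer $n\ge 1$, the number of $n\times n$ monomer-dimer tatami tilings (with any number of monomers) is equal to the sum of the squares of all parts in all compositions of $n$, that is, to $$\sum_{(a_1,\dots,a_r)}\ \sum_{j=1}^{r} a_j^2,$$ where the outer sum ranges over all compositions $(a_1,\dots,a_r)$ of $n$.
   Context: The $n\times n$ grid is the square $[0,n]\times[0,n]$ divided into $n^2$ unit grid squares. A monomer is a single grid square ($1\times 1$ tile); a dimer is a tile consisting of two edge-adjacent grid squares, either horizontal ($2\times 1$) or vertical ($1\times 2$). A monomer-dimer tiling of the grid is a partition of all its grid squares into monomers and dimers. A monomer-dimer tatami tiling is a monomer-dimer tiling in which no four (distinct) tiles meet at any point. Tilings are counted as labelled configurations on the fixed grid, i.e. rotations and reflections of a tiling count as different tilings if they differ as partitions of the grid. A composition of $n$ is an ordered tuple $(a_1,\dots,a_r)$ of positive integers (its parts), of any length $r\ge 1$, with $a_1+\cdots+a_r=n$. *)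

theory Defs
  imports Complex_Main "HOL-Library.Disjoint_Sets"
begin

text \<open>The cell \<open>(i, j)\<close> stands for the closed unit square
  \<open>[i, i + 1] \<times> [j, j + 1]\<close>; a tile is a set of cells.\<close>

type_synonym cell = "nat \<times> nat"

definition grid :: "nat \<Rightarrow> cell set" where
  "grid n = {0..<n} \<times> {0..<n}"

definition monomer :: "cell set \<Rightarrow> bool" where
  "monomer t \<longleftrightarrow> (\<exists>i j. t = {(i, j)})"

definition horizontal_dimer :: "cell set \<Rightarrow> bool" where
  "horizontal_dimer t \<longleftrightarrow> (\<exists>i j. t = {(i, j), (i + 1, j)})"

definition vertical_dimer :: "cell set \<Rightarrow> bool" where
  "vertical_dimer t \<longleftrightarrow> (\<exists>i j. t = {(i, j), (i, j + 1)})"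

definition dimer :: "cell set \<Rightarrow> bool" where
  "dimer t \<longleftrightarrow> horizontal_dimer t \<or> vertical_dimer t"

definition monomer_dimer_tiling :: "nat \<Rightarrow> cell set set \<Rightarrow> bool" where
  "monomer_dimer_tiling n T \<longleftrightarrow>
     partition_on (grid n) T \<and> (\<forall>t\<in>T. monomer t \<or> dimer t)"

definition unit_square :: "cell \<Rightarrow> (real \<times> real) set" where
  "unit_square c = {real (fst c)..real (fst c) + 1} \<times> {real (snd c)..real (snd c) + 1}"

definition region :: "cell set \<Rightarrow> (real \<times> real) set" where
  "region t = (\<Union>c\<in>t. unit_square c)"

definition tatami :: "cell set set \<Rightarrow> bool" where
  "tatami T \<longleftrightarrow> \<not> (\<exists>p. \<exists>S\<subseteq>T. card S = 4 \<and> (\<forall>t\<in>S. p \<in> region t))"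

definition tatami_tilings :: "nat \<Rightarrow> cell set set set" where
  "tatami_tilings n = {T. monomer_dimer_tiling n T \<and> tatami T}"

definition compositions :: "nat \<Rightarrow> nat list set" where
  "compositions n = {as. as \<noteq> [] \<and> (\<forall>a\<in>set as. a > 0) \<and> sum_list as = n}"

text \<open>Both sets are finite, so \<open>card\<close> and \<open>sum\<close> over them have their usual meaning.\<close>

lemma finite_tatami_tilings: "finite (tatami_tilings n)"
proof (rule finite_subset)
  show "tatami_tilings n \<subseteq> Pow (Pow (grid n))"
    unfolding tatami_tilings_def monomer_dimer_tiling_def partition_on_def by blast
qed (simp add: grid_def)

lemma length_le_sum_list:
  fixes as :: "nat list"
  shows "\<forall>a\<in>set as. a > 0 \<Longrightarrow> length as \<le> sum_list as"
  by (induction as) auto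

lemma finite_compositions: "finite (compositions n)"
proof (rule finite_subset)
  show "compositions n \<subseteq> {as. set as \<subseteq> {..n} \<and> length as \<le> n}"
    unfolding compositions_def using length_le_sum_list member_le_sum_list by fastforce
  show "finite {as. set as \<subseteq> {..n} \<and> length as \<le> n}"
    by (rule finite_lists_length_le) simp
qed

end

theory Submission imports Defs
begin

text \<open>
  With \<open>N = n - 1\<close>, give the cell \<open>(i, j)\<close> the coordinates \<open>u = i + j - N\<close> and \<open>v = i - j\<close>. The
  grid becomes the diamond \<open>\<bar>u\<bar> + \<bar>v\<bar> \<le> N\<close> with \<open>u + v + N\<close> even, and the two cells of a dimer
  differ by \<open>\<plusminus>1\<close> in both coordinates. A tiling is therefore a field \<open>(p, r)\<close>: a cell moves to the
  other cell of its tile by a step \<open>(\<plusminus>1, \<plusminus>1)\<close>, or by \<open>(0, 0)\<close> if it is a monomer. Four tiles meet at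
  a point exactly if the four cells around it contain no dimer. A dimer among these cells contains
  exactly one of the two cells on each diagonal of the block, so the tatami condition says: of two
  consecutive cells of a row \<open>v = const\<close>, the first has \<open>p = 1\<close> or the second has \<open>p = -1\<close>. Hence
  \<open>p\<close> is \<open>1\<close> on an initial part of each row, \<open>-1\<close> on a final part, and at most one cell between them is
  a monomer. The same holds for \<open>r\<close> on each column \<open>u = const\<close>.

  A row either is pure, which means that its sign is constant up to a monomer at the end that it
  points to, or its sign changes inside (\<open>row_dichotomy\<close>). In the second case the change takes place
  at a center, which is a monomer inside the grid or the midpoint of two parallel dimers that form a
  square. Four rays of forced dimers run from a center to the boundary (\<open>row_ray\<close>, \<open>col_ray\<close>). The
  rays of two centers would have to cross, so there is at most one center (\<open>center_unique\<close>); this is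
  where it matters that the grid is a square.

  All rows and columns that avoid the center are pure, and their signs are all that remains to be
  chosen. Where the columns have their standard signs, every cell of a row moves to the same
  neighbouring row, so that rows form pairs of opposite sign and only the sign of a whole pair is
  free (\<open>pair_sign\<close>). It follows that every field arises by flipping pairs of rows and pairs of
  columns, either from one of four brick patterns (\<open>brick_data\<close>) or from a pinwheel around its center
  (\<open>center_data\<close>), and that all such flips are allowed as long as no cell lies in a flipped row and in
  a flipped column (\<open>flips\<close>).

  For bricks the pairs that may be flipped are numbered \<open>1, \<dots>, N - 1\<close> in both directions, and
  flipping the row pair \<open>i\<close> excludes flipping the column pair \<open>j\<close> exactly if \<open>i + j \<le> N\<close>. This leaves
  \<open>(N + 1) 2\<^sup>N\<close> fields, if \<open>N \<ge> 1\<close>. For a pinwheel the center \<open>(u, v)\<close> with \<open>\<bar>u\<bar> + \<bar>v\<bar> < N\<close> and the sense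
  of rotation are arbitrary, and there are \<open>max (\<bar>u\<bar> - 1) 0\<close> free row pairs and \<open>max (\<bar>v\<bar> - 1) 0\<close> free
  column pairs, all of them near the corners. This leaves \<open>2 ((N - 1) 2\<^sup>N + 1)\<close> fields. The total
  \<open>2\<^bsup>n - 1\<^esup> (3 n - 4) + 2\<close> is also the sum of the squares of all parts of the compositions of \<open>n\<close>,
  because a composition of \<open>n + 1\<close> is obtained from one of \<open>n\<close> either by putting a part \<open>1\<close> in front
  or by increasing the first part.
\<close>

section \<open>Tatami fields: moves in diagonal coordinates\<close>

text \<open>The cells of the \<open>n \<times> n\<close> grid in diagonal coordinates, for \<open>N = n - 1\<close>.\<close>

definition diamond :: "int \<Rightarrow> int \<Rightarrow> int \<Rightarrow> bool" where
  "diamond N u v \<longleftrightarrow> \<bar>u\<bar> + \<bar>v\<bar> \<le> N \<and> even (u + v + N)"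

definition psign :: "int \<Rightarrow> int" where "psign u = (if even u then 1 else -1)"

lemma psign_simps [simp]:
  "psign (- u) = psign u" "psign (u + 1) = - psign u" "psign (1 + u) = - psign u" "psign (u - 1) = - psign u" "psign (1 - u) = - psign u"
  "psign (u + 2) = psign u" "psign (u - 2) = psign u" "psign 0 = 1"
  by (auto simp: psign_def)

lemma psign_cases: "psign u = 1 \<or> psign u = -1" by (simp add: psign_def)

lemma psign_sq [simp]: "psign u * psign u = 1" by (simp add: psign_def)

lemma diamond_psign: "diamond N u v \<Longrightarrow> psign (N + v) = psign u"
  by (auto simp: diamond_def psign_def)

lemma diamond_swap: "diamond N v u \<longleftrightarrow> diamond N u v" by (auto simp: diamond_def algebra_simps)
lemma diamond_neg [simp]: "diamond N (- u) v \<longleftrightarrow> diamond N u v" by (auto simp: diamond_def)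

text \<open>The step from a cell to the other cell of its tile is \<open>(p u v, r u v)\<close>. Both \<open>row\<close> and \<open>col\<close> say
  that every block of four cells contains a dimer, seen from one or the other diagonal of the block.
  With both of them the notion is symmetric under exchange of the coordinates.\<close>

locale tatami_field =
  fixes N :: int and p r :: "int \<Rightarrow> int \<Rightarrow> int"
  assumes outside: "\<not> diamond N u v \<Longrightarrow> p u v = 0 \<and> r u v = 0"
    and move: "diamond N u v \<Longrightarrow> (p u v = 0 \<and> r u v = 0) \<or>
      (p u v = 1 \<or> p u v = -1) \<and> (r u v = 1 \<or> r u v = -1) \<and> diamond N (u + p u v) (v + r u v) \<and>
      p (u + p u v) (v + r u v) = - p u v \<and> r (u + p u v) (v + r u v) = - r u v"
    and row: "diamond N u v \<Longrightarrow> diamond N (u + 2) v \<Longrightarrow> p u v = 1 \<or> p (u + 2) v = -1"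
    and col: "diamond N u v \<Longrightarrow> diamond N u (v + 2) \<Longrightarrow> r u v = 1 \<or> r u (v + 2) = -1"
begin

text \<open>Exchanging \<open>u\<close> and \<open>v\<close> and negating \<open>u\<close> are reflections of the grid. They reduce statements about
  columns to statements about rows, and statements about the left to statements about the right.\<close>

lemma swap: "tatami_field N (\<lambda>u v. r v u) (\<lambda>u v. p v u)"
proof unfold_locales
  fix u v
  show "\<not> diamond N u v \<Longrightarrow> r v u = 0 \<and> p v u = 0" using outside[of v u] diamond_swap[of N] by blast
  show "diamond N u v \<Longrightarrow> diamond N (u + 2) v \<Longrightarrow> r v u = 1 \<or> r v (u + 2) = - 1" using col[of v u] diamond_swap[of N] by blast
  show "diamond N u v \<Longrightarrow> diamond N u (v + 2) \<Longrightarrow> p v u = 1 \<or> p (v + 2) u = - 1" using row[of v u] diamond_swap[of N] by blast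
  show "diamond N u v \<Longrightarrow> r v u = 0 \<and> p v u = 0 \<or>
           (r v u = 1 \<or> r v u = - 1) \<and> (p v u = 1 \<or> p v u = - 1) \<and>
           diamond N (u + r v u) (v + p v u) \<and> r (v + p v u) (u + r v u) = - r v u \<and> p (v + p v u) (u + r v u) = - p v u"
    using move[of v u] diamond_swap[of N] by blast
qed

lemma neg: "tatami_field N (\<lambda>u v. - p (- u) v) (\<lambda>u v. r (- u) v)"
proof unfold_locales
  fix u v
  show "\<not> diamond N u v \<Longrightarrow> - p (- u) v = 0 \<and> r (- u) v = 0" using outside[of "-u" v] by simp
  show "diamond N u v \<Longrightarrow> diamond N (u + 2) v \<Longrightarrow> - p (- u) v = 1 \<or> - p (- (u + 2)) v = - 1"
    using row[of "- (u + 2)" v] by (simp add: diamond_def) (smt (verit))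
  show "diamond N u v \<Longrightarrow> diamond N u (v + 2) \<Longrightarrow> r (- u) v = 1 \<or> r (- u) (v + 2) = - 1" using col[of "-u" v] by simp
  show "diamond N u v \<Longrightarrow> - p (- u) v = 0 \<and> r (- u) v = 0 \<or>
           (- p (- u) v = 1 \<or> - p (- u) v = - 1) \<and> (r (- u) v = 1 \<or> r (- u) v = - 1) \<and>
           diamond N (u + - p (- u) v) (v + r (- u) v) \<and>
           - p (- (u + - p (- u) v)) (v + r (- u) v) = - (- p (- u) v) \<and> r (- (u + - p (- u) v)) (v + r (- u) v) = - r (- u) v"
    using move[of "-u" v] diamond_neg[of N "u - p (-u) v" "v + r (-u) v"] by auto
qed

lemma p_cases: "p u v = 0 \<or> p u v = 1 \<or> p u v = -1" using move outside by blast
lemma r_cases: "r u v = 0 \<or> r u v = 1 \<or> r u v = -1" using move outside by blast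
lemma zero_iff: "p u v = 0 \<longleftrightarrow> r u v = 0" using move[of u v] outside[of u v] by (cases "diamond N u v") auto

lemma partner:
  assumes "p u v \<noteq> 0"
  shows "diamond N (u + p u v) (v + r u v)" "p (u + p u v) (v + r u v) = - p u v"
    "r (u + p u v) (v + r u v) = - r u v"
  using assms move[of u v] outside[of u v] by auto

text \<open>A cell with \<open>p \<noteq> 1\<close> forces \<open>p = -1\<close> at the next cell of its row, and this repeats.\<close>

lemma p_after:
  assumes "diamond N u v" "p u v \<noteq> 1" "diamond N u' v" "u < u'"
  shows "p u' v = -1"
proof -
  have "p (u + 2 * int k) v = -1" if "diamond N (u + 2 * int k) v" "k > 0" for k
    using that
  proof (induction k)
    case (Suc k)
    have "diamond N (u + 2 * int k) v"
      using Suc.prems(1) assms(1) by (auto simp: diamond_def)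
    moreover have "p (u + 2 * int k) v \<noteq> 1"
      using Suc.IH calculation assms(2) by (cases "k = 0") auto
    ultimately show ?case using row[of "u + 2 * int k" v] Suc.prems(1) by (auto simp: algebra_simps)
  qed simp
  moreover have "\<exists>k. u' = u + 2 * int k \<and> k > 0"
  proof -
    have "even (u' - u)" using assms(1,3) by (auto simp: diamond_def)
    then obtain d where "u' - u = 2 * d" by blast
    then show ?thesis using assms(4) by (intro exI[of _ "nat d"]) auto
  qed
  ultimately show ?thesis using assms(3) by blast
qed

lemma r_after: "diamond N u v \<Longrightarrow> r u v \<noteq> 1 \<Longrightarrow> diamond N u v' \<Longrightarrow> v < v' \<Longrightarrow> r u v' = -1"
  using tatami_field.p_after[OF swap, of v u v'] diamond_swap by metis

lemma r_before: "diamond N u v \<Longrightarrow> r u v \<noteq> -1 \<Longrightarrow> diamond N u v' \<Longrightarrow> v' < v \<Longrightarrow> r u v' = 1"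
  using r_after by blast

text \<open>The exception is the cell at the end that the row points to. Its partner may lie outside the
  diamond, and then it is a monomer.\<close>

definition pure_row :: "int \<Rightarrow> int \<Rightarrow> bool" where
  "pure_row v c \<longleftrightarrow> (c = 1 \<or> c = -1) \<and>
    (\<forall>u. diamond N u v \<longrightarrow> p u v = c \<or> p u v = 0 \<and> u = c * (N - \<bar>v\<bar>))"

definition pure_col :: "int \<Rightarrow> int \<Rightarrow> bool" where
  "pure_col u c \<longleftrightarrow> (c = 1 \<or> c = -1) \<and>
    (\<forall>v. diamond N u v \<longrightarrow> r u v = c \<or> r u v = 0 \<and> v = c * (N - \<bar>u\<bar>))"

text \<open>The row and the column of \<open>(u0, v0)\<close> point at \<open>(u0, v0)\<close> from both sides. If this point is a cell, it
  is a monomer that is not on the boundary; otherwise it is a vertex of the grid, and the common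
  midpoint of two parallel dimers.\<close>

definition center :: "int \<Rightarrow> int \<Rightarrow> bool" where
  "center u0 v0 \<longleftrightarrow> \<bar>u0\<bar> + \<bar>v0\<bar> < N \<and> (\<forall>u. diamond N u v0 \<longrightarrow> p u v0 = sgn (u0 - u)) \<and>
    (\<forall>v. diamond N u0 v \<longrightarrow> r u0 v = sgn (v0 - v))"

text \<open>Look at the first cell of the row with \<open>p \<noteq> 1\<close>. If it is a monomer away from the ends, then its
  column also points at it from both sides. If the sign jumps from \<open>1\<close> to \<open>-1\<close>, then the two cells at
  the jump can only move to the two cells between them, and these point at each other along
  their column.\<close>

lemma row_dichotomy:
  assumes v: "\<bar>v\<bar> \<le> N"
  shows "(\<exists>c. pure_row v c) \<or> (\<exists>u0. center u0 v)"
proof -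
  define M where "M = N - \<bar>v\<bar>"
  have M: "M \<ge> 0" using v by (simp add: M_def)
  have D: "diamond N u v \<longleftrightarrow> \<bar>u\<bar> \<le> M \<and> even (u + M)" for u
    by (auto simp: diamond_def M_def)
  show ?thesis
  proof (cases "\<forall>u. diamond N u v \<longrightarrow> p u v = 1")
    case True
    then show ?thesis by (auto simp: pure_row_def)
  next
    case False
    define B where "B = {u. diamond N u v \<and> p u v \<noteq> 1}"
    have fin: "finite B" by (rule finite_subset[of _ "{-M..M}"]) (auto simp: B_def D)
    have "B \<noteq> {}" using False by (auto simp: B_def)
    define c where "c = Min B"
    have cB: "c \<in> B" and cmin: "\<And>u. u \<in> B \<Longrightarrow> c \<le> u"
      using fin \<open>B \<noteq> {}\<close> by (auto simp: c_def)
    have c: "diamond N c v" "p c v \<noteq> 1" using cB by (auto simp: B_def)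
    have below: "p u v = 1" if "diamond N u v" "u < c" for u
      using that cmin[of u] by (auto simp: B_def)
    have above: "p u v = -1" if "diamond N u v" "u > c" for u
      using p_after[OF c that] .
    consider "c = M" "p c v = 0" | "c = -M" | "p c v = 0" "\<bar>c\<bar> < M" | "p c v = -1" "c > -M"
      using c p_cases[of c v] D[of c] by fastforce
    then show ?thesis
    proof cases
      case 1
      have "pure_row v 1" unfolding pure_row_def
        using below above 1 D M_def by (metis abs_le_iff linorder_neqE_linordered_idom mult_1 not_le)
      then show ?thesis by blast
    next
      case 2
      have "pure_row v (-1)" unfolding pure_row_def
      proof (intro conjI allI impI)
        fix u assume "diamond N u v"
        then have "u > c \<or> u = c" using 2 D[of u] by auto
        then show "p u v = - 1 \<or> p u v = 0 \<and> u = - 1 * (N - \<bar>v\<bar>)"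
          using above[of u] \<open>diamond N u v\<close> 2 c p_cases[of c v] by (auto simp: M_def)
      qed simp
      then show ?thesis by blast
    next
      case 3
      have r0: "r c v = 0" using 3 zero_iff by blast
      have "center c v" unfolding center_def
      proof (intro conjI allI impI)
        show "\<bar>c\<bar> + \<bar>v\<bar> < N" using 3 M_def by linarith
        fix u assume "diamond N u v"
        then show "p u v = sgn (c - u)" using below[of u] above[of u] 3 by (cases u c rule: linorder_cases) auto
      next
        fix w assume "diamond N c w"
        then show "r c w = sgn (v - w)" using r_before[OF c(1) _ \<open>diamond N c w\<close>] r_after[OF c(1) _ \<open>diamond N c w\<close>] r0
          by (cases w v rule: linorder_cases) auto
      qed
      then show ?thesis by blast
    next
      case 4
      \<comment> \<open>The sign jumps between \<open>c - 2\<close> and \<open>c\<close>; both cells move into column \<open>c - 1\<close>.\<close>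
      have cM: "even (c + M)" "\<bar>c\<bar> \<le> M" using c(1) D[of c] by auto
      moreover have cn: "c \<noteq> - M + 1" using \<open>even (c + M)\<close> by auto
      ultimately have c2: "diamond N (c - 2) v" using 4 D[of "c - 2"] by auto
      have pc2: "p (c - 2) v = 1" using below c2 by simp
      have a: "diamond N (c - 1) (v + r (c - 2) v)" "p (c - 1) (v + r (c - 2) v) = -1"
        "r (c - 1) (v + r (c - 2) v) = - r (c - 2) v"
        using partner[of "c - 2" v] pc2 by auto
      have b: "diamond N (c - 1) (v + r c v)" "p (c - 1) (v + r c v) = 1"
        "r (c - 1) (v + r c v) = - r c v"
        using partner[of c v] 4 by auto
      have "r c v = 1 \<or> r c v = -1" "r (c - 2) v = 1 \<or> r (c - 2) v = -1"
        using zero_iff[of c v] zero_iff[of "c - 2" v] r_cases 4 pc2 by auto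
      then have up: "diamond N (c - 1) (v + 1) \<and> r (c - 1) (v + 1) = -1" and dn: "diamond N (c - 1) (v - 1) \<and> r (c - 1) (v - 1) = 1"
        using a b by auto
      have "center (c - 1) v" unfolding center_def
      proof (intro conjI allI impI)
        show "\<bar>c - 1\<bar> + \<bar>v\<bar> < N" using 4(2) cM(2) cn M_def by linarith
        fix u assume u: "diamond N u v"
        then have "u \<noteq> c - 1" using c(1) by (auto simp: diamond_def)
        then show "p u v = sgn (c - 1 - u)" using below[of u] above[of u] 4 u by (cases u c rule: linorder_cases) auto
      next
        fix w assume w: "diamond N (c - 1) w"
        then have "w \<noteq> v" using c(1) by (auto simp: diamond_def)
        then consider "w < v - 1" | "w = v - 1" | "w = v + 1" | "w > v + 1" by linarith
        then show "r (c - 1) w = sgn (v - w)"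
          using r_before[of "c - 1" "v - 1" w] r_after[of "c - 1" "v + 1" w] up dn w by cases auto
      qed
      then show ?thesis by blast
    qed
  qed
qed

lemma swap_pure: "tatami_field.pure_row N (\<lambda>u v. r v u) u c \<longleftrightarrow> pure_col u c"
  unfolding pure_col_def tatami_field.pure_row_def[OF swap] using diamond_swap by blast

lemma swap_center: "tatami_field.center N (\<lambda>u v. r v u) (\<lambda>u v. p v u) v0 u0 \<longleftrightarrow> center u0 v0"
  unfolding center_def tatami_field.center_def[OF swap] using diamond_swap[of N] by (auto simp: add.commute)

lemma neg_center: "tatami_field.center N (\<lambda>u v. - p (- u) v) (\<lambda>u v. r (- u) v) (- u0) v0 \<longleftrightarrow> center u0 v0"
proof -
  have 1: "(\<forall>u. diamond N u v0 \<longrightarrow> - p (- u) v0 = sgn (- u0 - u)) \<longleftrightarrow> (\<forall>u. diamond N u v0 \<longrightarrow> p u v0 = sgn (u0 - u))"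
    (is "?L \<longleftrightarrow> ?R")
  proof
    assume L: ?L
    show ?R
    proof (intro allI impI)
      fix u assume "diamond N u v0"
      then show "p u v0 = sgn (u0 - u)" using L[rule_format, of "-u"] by (simp add: sgn_if split: if_splits)
    qed
  next
    assume R: ?R
    show ?L
    proof (intro allI impI)
      fix u assume "diamond N u v0"
      then show "- p (- u) v0 = sgn (- u0 - u)" using R[rule_format, of "-u"] by (simp add: sgn_if split: if_splits)
    qed
  qed
  show ?thesis unfolding center_def tatami_field.center_def[OF neg] using 1 by simp
qed

lemma col_dichotomy: "\<bar>u\<bar> \<le> N \<Longrightarrow> (\<exists>c. pure_col u c) \<or> (\<exists>v0. center u v0)"
  using tatami_field.row_dichotomy[OF swap, of u] swap_pure swap_center by blast

end

section \<open>Centers and their rays\<close>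

text \<open>The pinwheel around \<open>(u0, v0)\<close>. The row and the column of the center point at the center. Elsewhere the
  arrows of the cells with even \<open>u\<close> turn around the center in one sense, which is given by
  \<open>x = \<plusminus>1\<close>, and those with odd \<open>u\<close>, being the other halves of the dimers, in the opposite sense.\<close>

definition pinwheel_p :: "int \<Rightarrow> int \<Rightarrow> int \<Rightarrow> int \<Rightarrow> int \<Rightarrow> int" where
  "pinwheel_p x u0 v0 u v = (if v = v0 then sgn (u0 - u) else x * psign u * sgn (v - v0))"
definition pinwheel_r :: "int \<Rightarrow> int \<Rightarrow> int \<Rightarrow> int \<Rightarrow> int \<Rightarrow> int" where
  "pinwheel_r x u0 v0 u v = (if u = u0 then sgn (v0 - v) else - x * psign u * sgn (u - u0))"

lemma pinwheel_p_neg: "pinwheel_p (- x) (- u0) v0 (- u) v = - pinwheel_p x u0 v0 u v"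
  by (auto simp: pinwheel_p_def sgn_if)
lemma pinwheel_r_neg: "pinwheel_r (- x) (- u0) v0 (- u) v = pinwheel_r x u0 v0 u v"
  by (auto simp: pinwheel_r_def sgn_if)
lemma pinwheel_p_swap: "diamond N u v \<Longrightarrow> pinwheel_p (- x * psign N) v0 u0 v u = pinwheel_r x u0 v0 u v"
  by (auto simp: pinwheel_p_def pinwheel_r_def diamond_def psign_def)
lemma pinwheel_r_swap: "diamond N u v \<Longrightarrow> pinwheel_r (- x * psign N) v0 u0 v u = pinwheel_p x u0 v0 u v"
  by (auto simp: pinwheel_p_def pinwheel_r_def diamond_def psign_def)

text \<open>The coordinate sum of a cell determines the parity of its distance to the boundary.\<close>

lemma parity_gap:
  assumes "\<bar>u\<bar> + \<bar>v\<bar> < (N :: int)" "even (u + v + N)"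
  shows "\<bar>u\<bar> + \<bar>v\<bar> + 2 \<le> N"
proof -
  have "even (\<bar>u\<bar> + \<bar>v\<bar> + N)" using assms(2) by (auto simp: abs_if)
  then have "N \<noteq> \<bar>u\<bar> + \<bar>v\<bar> + 1" by auto
  then show ?thesis using assms(1) by linarith
qed

context tatami_field begin

definition spin :: "int \<Rightarrow> int \<Rightarrow> int \<Rightarrow> bool" where
  "spin x u0 v0 \<longleftrightarrow> (x = 1 \<or> x = -1) \<and> center u0 v0 \<and>
    (\<forall>u v. diamond N u v \<longrightarrow> \<bar>u - u0\<bar> + \<bar>v - v0\<bar> \<le> 2 \<longrightarrow> p u v = pinwheel_p x u0 v0 u v \<and> r u v = pinwheel_r x u0 v0 u v)"

lemma center_row: "center u0 v0 \<Longrightarrow> diamond N u v0 \<Longrightarrow> p u v0 = sgn (u0 - u)"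
  by (simp add: center_def)
lemma center_col: "center u0 v0 \<Longrightarrow> diamond N u0 v \<Longrightarrow> r u0 v = sgn (v0 - v)"
  by (simp add: center_def)

text \<open>Two cells never move to the same cell. So once one neighbour of the center has chosen between its
  two possible partners, the choices of the other neighbours are forced around the center.\<close>

lemma center_spin:
  assumes c: "center u0 v0"
  shows "\<exists>x. spin x u0 v0"
proof (cases "even (u0 + v0 + N)")
  case False
  have lt: "\<bar>u0\<bar> + \<bar>v0\<bar> < N" using c by (simp add: center_def)
  have D: "diamond N (u0 + 1) v0" "diamond N (u0 - 1) v0" "diamond N u0 (v0 + 1)" "diamond N u0 (v0 - 1)"
    using False lt by (auto simp: diamond_def)
  define q where "q = r (u0 + 1) v0"
  have pr: "p (u0 + 1) v0 = -1" "p (u0 - 1) v0 = 1" "r u0 (v0 + 1) = -1" "r u0 (v0 - 1) = 1"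
    using center_row[OF c D(1)] center_row[OF c D(2)] center_col[OF c D(3)] center_col[OF c D(4)] by auto
  have q: "q = 1 \<or> q = -1" using zero_iff[of "u0 + 1" v0] r_cases[of "u0 + 1" v0] pr by (auto simp: q_def)
  have q': "r (u0 - 1) v0 = 1 \<or> r (u0 - 1) v0 = -1" using zero_iff[of "u0 - 1" v0] r_cases[of "u0 - 1" v0] pr by auto
  have a: "p u0 (v0 + q) = 1" using partner[of "u0 + 1" v0] pr by (simp add: q_def)
  have b: "p u0 (v0 + r (u0 - 1) v0) = - 1" using partner[of "u0 - 1" v0] pr by simp
  have q2: "r (u0 - 1) v0 = - q" using a b q q' by auto
  have b: "p u0 (v0 - q) = - 1" using b q2 by simp
  have *: "p u v = pinwheel_p (q * psign u0) u0 v0 u v \<and> r u v = pinwheel_r (q * psign u0) u0 v0 u v"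
    if "diamond N u v" "\<bar>u - u0\<bar> + \<bar>v - v0\<bar> \<le> 2" for u v
  proof -
    have "odd (u - u0 + (v - v0))" using False that(1) by (auto simp: diamond_def)
    then have "odd (\<bar>u - u0\<bar> + \<bar>v - v0\<bar>)" by (auto simp: abs_if)
    then have "\<bar>u - u0\<bar> + \<bar>v - v0\<bar> = 1" using that(2) by presburger
    then have "u = u0 + 1 \<and> v = v0 \<or> u = u0 - 1 \<and> v = v0 \<or> u = u0 \<and> v = v0 + 1 \<or> u = u0 \<and> v = v0 - 1"
      by arith
    then show ?thesis using pr q q2 a b psign_cases[of u0] by (auto simp: pinwheel_p_def pinwheel_r_def q_def[symmetric])
  qed
  show ?thesis
    by (rule exI[of _ "q * psign u0"]) (use * c q psign_cases[of u0] in \<open>auto simp: spin_def\<close>)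
next
  case True
  have lt: "\<bar>u0\<bar> + \<bar>v0\<bar> + 2 \<le> N" using c True parity_gap by (simp add: center_def)
  have D: "diamond N (u0 + 2) v0" "diamond N (u0 - 2) v0" "diamond N u0 (v0 + 2)" "diamond N u0 (v0 - 2)" "diamond N u0 v0"
    using True lt by (auto simp: diamond_def)
  have pr: "p (u0 + 2) v0 = -1" "p (u0 - 2) v0 = 1" "r u0 (v0 + 2) = -1" "r u0 (v0 - 2) = 1" "p u0 v0 = 0" "r u0 v0 = 0"
    using center_row[OF c D(1)] center_row[OF c D(2)] center_row[OF c D(5)] center_col[OF c D(3)] center_col[OF c D(4)]
      center_col[OF c D(5)] by auto
  \<comment> \<open>The four cells at distance two choose among the four cells around the monomer.\<close>
  define q1 where "q1 = r (u0 + 2) v0"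
  define q2 where "q2 = r (u0 - 2) v0"
  define q3 where "q3 = p u0 (v0 + 2)"
  define q4 where "q4 = p u0 (v0 - 2)"
  have q: "q1 = 1 \<or> q1 = -1" "q2 = 1 \<or> q2 = -1" "q3 = 1 \<or> q3 = -1" "q4 = 1 \<or> q4 = -1"
    using zero_iff[of "u0 + 2" v0] r_cases[of "u0 + 2" v0] zero_iff[of "u0 - 2" v0] r_cases[of "u0 - 2" v0]
      zero_iff[of u0 "v0 + 2"] p_cases[of u0 "v0 + 2"] zero_iff[of u0 "v0 - 2"] p_cases[of u0 "v0 - 2"] pr
    by (auto simp: q1_def q2_def q3_def q4_def)
  have 1: "p (u0 + 1) (v0 + q1) = 1" "r (u0 + 1) (v0 + q1) = - q1"
    using partner[of "u0 + 2" v0] pr by (simp_all add: q1_def add.commute)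
  have 2: "p (u0 - 1) (v0 + q2) = -1" "r (u0 - 1) (v0 + q2) = - q2"
    using partner[of "u0 - 2" v0] pr by (simp_all add: q2_def)
  have 3: "p (u0 + q3) (v0 + 1) = - q3" "r (u0 + q3) (v0 + 1) = 1"
    using partner[of "u0" "v0 + 2"] pr zero_iff by (simp_all add: q3_def add.commute)
  have 4: "p (u0 + q4) (v0 - 1) = - q4" "r (u0 + q4) (v0 - 1) = -1"
    using partner[of "u0" "v0 - 2"] pr zero_iff by (simp_all add: q4_def)
  have eq: "q2 = - q1" "q3 = - q1" "q4 = q1"
    using q 1 2 3 4 by auto
  have *: "p u v = pinwheel_p (- q1 * psign u0) u0 v0 u v \<and> r u v = pinwheel_r (- q1 * psign u0) u0 v0 u v"
    if "diamond N u v" "\<bar>u - u0\<bar> + \<bar>v - v0\<bar> \<le> 2" for u v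
  proof -
    have "even (u - u0 + (v - v0))" using True that(1) by (auto simp: diamond_def)
    then have "even (\<bar>u - u0\<bar> + \<bar>v - v0\<bar>)" by (auto simp: abs_if)
    then have "\<bar>u - u0\<bar> + \<bar>v - v0\<bar> = 0 \<or> \<bar>u - u0\<bar> + \<bar>v - v0\<bar> = 2" using that(2) by presburger
    then have "(u = u0 \<or> u = u0 + 2 \<or> u = u0 - 2) \<and> v = v0 \<or> u = u0 \<and> (v = v0 + 2 \<or> v = v0 - 2)
       \<or> (u = u0 + 1 \<or> u = u0 - 1) \<and> (v = v0 + 1 \<or> v = v0 - 1)"
      by arith
    moreover have "r (u0 + 2) v0 = q1" "r (u0 - 2) v0 = - q1" "p u0 (v0 + 2) = - q1" "p u0 (v0 - 2) = q1"
      using eq by (simp_all add: q1_def[symmetric] q2_def[symmetric] q3_def[symmetric] q4_def[symmetric])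
    moreover have "q1 = 1 \<and> p (u0 + 1) (v0 + 1) = 1 \<and> r (u0 + 1) (v0 + 1) = -1 \<and> p (u0 - 1) (v0 - 1) = -1 \<and> r (u0 - 1) (v0 - 1) = 1
        \<and> p (u0 - 1) (v0 + 1) = 1 \<and> r (u0 - 1) (v0 + 1) = 1 \<and> p (u0 + 1) (v0 - 1) = -1 \<and> r (u0 + 1) (v0 - 1) = -1 \<or>
      q1 = -1 \<and> p (u0 + 1) (v0 + 1) = -1 \<and> r (u0 + 1) (v0 + 1) = 1 \<and> p (u0 - 1) (v0 - 1) = 1 \<and> r (u0 - 1) (v0 - 1) = -1
        \<and> p (u0 - 1) (v0 + 1) = -1 \<and> r (u0 - 1) (v0 + 1) = -1 \<and> p (u0 + 1) (v0 - 1) = 1 \<and> r (u0 + 1) (v0 - 1) = 1"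
      using q(1) 1 2 3 4 unfolding eq by (elim disjE) simp_all
    ultimately show ?thesis using pr psign_cases[of u0]
      by (elim disjE conjE) (simp_all add: pinwheel_p_def pinwheel_r_def)
  qed
  show ?thesis
    by (rule exI[of _ "- q1 * psign u0"]) (use * c q psign_cases[of u0] in \<open>auto simp: spin_def\<close>)
qed

lemma swap_spin:
  assumes "spin x u0 v0"
  shows "tatami_field.spin N (\<lambda>u v. r v u) (\<lambda>u v. p v u) (- x * psign N) v0 u0"
  unfolding tatami_field.spin_def[OF swap] swap_center
proof (intro conjI allI impI)
  show "- x * psign N = 1 \<or> - x * psign N = - 1" "center u0 v0"
    using assms psign_cases[of N] by (auto simp: spin_def)
  fix u v assume *: "diamond N u v" "\<bar>u - v0\<bar> + \<bar>v - u0\<bar> \<le> 2"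
  then have "diamond N v u" "\<bar>v - u0\<bar> + \<bar>u - v0\<bar> \<le> 2" by (simp_all add: diamond_swap)
  then show "r v u = pinwheel_p (- x * psign N) v0 u0 u v" "p v u = pinwheel_r (- x * psign N) v0 u0 u v"
    using assms pinwheel_p_swap[of N v u x v0 u0] pinwheel_r_swap[of N v u x v0 u0] by (auto simp: spin_def)
qed

lemma neg_spin:
  assumes "spin x u0 v0"
  shows "tatami_field.spin N (\<lambda>u v. - p (- u) v) (\<lambda>u v. r (- u) v) (- x) (- u0) v0"
  unfolding tatami_field.spin_def[OF neg] neg_center
proof (intro conjI allI impI)
  show "- x = 1 \<or> - x = - 1" "center u0 v0"
    using assms by (auto simp: spin_def)
  fix u v assume *: "diamond N u v" "\<bar>u - - u0\<bar> + \<bar>v - v0\<bar> \<le> 2"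
  then have "diamond N (-u) v" "\<bar>- u - u0\<bar> + \<bar>v - v0\<bar> \<le> 2" by simp_all
  then show "- p (- u) v = pinwheel_p (- x) (- u0) v0 u v" "r (- u) v = pinwheel_r (- x) (- u0) v0 u v"
    using assms pinwheel_p_neg[of x u0 v0 "-u" v] pinwheel_r_neg[of x u0 v0 "-u" v] by (auto simp: spin_def)
qed

text \<open>Two adjacent rows force each other. In row \<open>v0\<close> all cells right of the center have \<open>p = -1\<close>, and such
  a cell cannot move towards row \<open>v0 - q\<close>, because the cell there moves away. A cell of row \<open>v0 - q\<close> in
  turn has \<open>p = -1\<close> because of its predecessor, and it cannot move to row \<open>v0\<close>, because the cell there
  moves to the other side.\<close>

lemma ray_right:
  assumes sp: "spin x u0 v0" and q: "q = - x * psign (N + v0)"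
  shows "u > u0 \<Longrightarrow> (diamond N u v0 \<longrightarrow> r u v0 = q) \<and> (diamond N u (v0 - q) \<longrightarrow> p u (v0 - q) = -1 \<and> r u (v0 - q) = - q)"
proof (induction "nat (u - u0)" arbitrary: u rule: less_induct)
  case less
  have x: "x = 1 \<or> x = -1" and c: "center u0 v0"
    and near: "\<And>u v. diamond N u v \<Longrightarrow> \<bar>u - u0\<bar> + \<bar>v - v0\<bar> \<le> 2 \<Longrightarrow> p u v = pinwheel_p x u0 v0 u v \<and> r u v = pinwheel_r x u0 v0 u v"
    using sp by (auto simp: spin_def)
  have lt: "\<bar>u0\<bar> + \<bar>v0\<bar> < N" using c by (simp add: center_def)
  have q1: "q = 1 \<or> q = -1" using x q psign_cases[of "N + v0"] by auto
  have IH: "(diamond N (u - k) v0 \<longrightarrow> r (u - k) v0 = q) \<and> (diamond N (u - k) (v0 - q) \<longrightarrow> p (u - k) (v0 - q) = -1 \<and> r (u - k) (v0 - q) = - q)"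
    if "k > 0" "u - k > u0" for k
    using less.hyps[of "u - k"] that by auto
  show ?case
  proof (rule conjI; rule impI)
    assume D: "diamond N u v0"
    have qa: "q = - x * psign u" using q diamond_psign[OF D] by simp
    show "r u v0 = q"
    proof (cases "u \<le> u0 + 2")
      case True
      then show ?thesis using near[OF D] less.prems qa by (auto simp: pinwheel_r_def)
    next
      case False
      have D1: "diamond N (u - 1) (v0 - q)"
        using D lt False q1 by (auto simp: diamond_def)
      have p: "p u v0 = -1" using center_row[OF c D] less.prems by simp
      have "r u v0 \<noteq> - q"
      proof
        assume a: "r u v0 = - q"
        then have "r (u - 1) (v0 - q) = q" using partner[of u v0] p by simp
        then show False using IH[of 1] False D1 q1 by auto
      qed
      then show ?thesis using zero_iff[of u v0] r_cases[of u v0] p q1 by auto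
    qed
  next
    assume D: "diamond N u (v0 - q)"
    have qa: "q = x * psign u" using q diamond_psign[OF D] q1 by (auto simp: psign_def split: if_splits)
    show "p u (v0 - q) = -1 \<and> r u (v0 - q) = - q"
    proof (cases "u = u0 + 1")
      case True
      then show ?thesis using near[OF D] q1 qa by (auto simp: pinwheel_p_def pinwheel_r_def)
    next
      case False
      have D2: "diamond N (u - 2) (v0 - q)" using D lt False less.prems q1 by (auto simp: diamond_def)
      have "p (u - 2) (v0 - q) \<noteq> 1"
      proof (cases "u = u0 + 2")
        case True
        then have "p (u - 2) (v0 - q) = x * psign u * sgn (- q)" using near[OF D2] q1 by (auto simp: pinwheel_p_def)
        then show ?thesis using q1 qa by auto
      next
        case False
        then show "p (u - 2) (v0 - q) \<noteq> 1" using IH[of 2] D2 less.prems \<open>u \<noteq> u0 + 1\<close> by auto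
      qed
      then have p: "p u (v0 - q) = -1" using p_after[OF D2 _ D] by auto
      have D1: "diamond N (u - 1) v0" using D lt False less.prems q1 by (auto simp: diamond_def)
      have r1: "r (u - 1) v0 = q" using IH[of 1] D1 False less.prems by auto
      have "r u (v0 - q) \<noteq> q"
      proof
        assume a: "r u (v0 - q) = q"
        then have "r (u - 1) v0 = - q" using partner[of u "v0 - q"] p by simp
        then show False using r1 q1 by auto
      qed
      then show ?thesis using p zero_iff[of u "v0 - q"] r_cases[of u "v0 - q"] q1 by auto
    qed
  qed
qed

lemma row_ray_right:
  assumes sp: "spin x u0 v0" and D: "diamond N u v" and u: "u > u0"
    and v: "\<bar>v - v0\<bar> \<le> 1" "pinwheel_p x u0 v0 u v = -1"
  shows "p u v = pinwheel_p x u0 v0 u v \<and> r u v = pinwheel_r x u0 v0 u v"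
proof (cases "v = v0")
  case True
  then show ?thesis using ray_right[OF sp refl u] D u sp diamond_psign[OF D]
    by (auto simp: pinwheel_p_def pinwheel_r_def spin_def center_row)
next
  case False
  define q where "q = - x * psign (N + v0)"
  have x: "x = 1 \<or> x = -1" using sp by (simp add: spin_def)
  have v': "v = v0 + 1 \<or> v = v0 - 1" using v False by linarith
  have "psign (N + v) = psign u" using diamond_psign[OF D] .
  moreover have "psign (N + v) = - psign (N + v0)" using v' by (auto simp: psign_def)
  ultimately have "psign (N + v0) = - psign u" by simp
  then have qa: "q = x * psign u" by (simp add: q_def)
  then have "v = v0 - q" using v' v(2) x psign_cases[of u] by (auto simp: pinwheel_p_def)
  then show ?thesis using ray_right[OF sp q_def u] D u v(2) qa by (auto simp: pinwheel_r_def)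
qed

text \<open>Among the rows \<open>v0 - 1\<close>, \<open>v0\<close>, \<open>v0 + 1\<close> the hypothesis on \<open>pinwheel_p\<close> selects, on either side of the
  center, row \<open>v0\<close> and the one neighbouring row that also points towards the center.\<close>

lemma row_ray:
  assumes sp: "spin x u0 v0" and D: "diamond N u v" and u: "u \<noteq> u0"
    and v: "\<bar>v - v0\<bar> \<le> 1" "pinwheel_p x u0 v0 u v = sgn (u0 - u)"
  shows "p u v = pinwheel_p x u0 v0 u v \<and> r u v = pinwheel_r x u0 v0 u v"
proof (cases "u > u0")
  case True
  then show ?thesis using row_ray_right[OF sp D] v by simp
next
  case False
  then show ?thesis using tatami_field.row_ray_right[OF neg neg_spin[OF sp], of "-u" v] u v D
    pinwheel_p_neg[of x u0 v0 u v] pinwheel_r_neg[of x u0 v0 u v] by auto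
qed

lemma col_ray:
  assumes sp: "spin x u0 v0" and D: "diamond N u v" and v: "v \<noteq> v0"
    and u: "\<bar>u - u0\<bar> \<le> 1" "pinwheel_r x u0 v0 u v = sgn (v0 - v)"
  shows "p u v = pinwheel_p x u0 v0 u v \<and> r u v = pinwheel_r x u0 v0 u v"
  using tatami_field.row_ray[OF swap swap_spin[OF sp], of v u] D u v
    pinwheel_p_swap[OF D, of x v0 u0] pinwheel_r_swap[OF D, of x v0 u0] by (simp add: diamond_swap)

text \<open>The ray to the right of \<open>(u0, v0)\<close> and the ray below \<open>(u1, v1)\<close> meet at \<open>(u1, v0)\<close>. Each of them consists of
  two adjacent lines of forced moves, and at the crossing these prescribe different moves.\<close>

lemma no_two_centers_aux:
  assumes c: "center u0 v0" and c': "center u1 v1" and lt: "u0 < u1" "v0 < v1" "\<bar>u1\<bar> + \<bar>v0\<bar> < N"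
  shows False
proof -
  obtain x y where x: "spin x u0 v0" and y: "spin y u1 v1" using center_spin c c' by blast
  have xy: "x = 1 \<or> x = -1" "y = 1 \<or> y = -1" using x y by (auto simp: spin_def)
  show False
  proof (cases "diamond N u1 v0")
    case True
    have "r u1 v0 = - x * psign u1" using row_ray[OF x True] lt by (auto simp: pinwheel_p_def pinwheel_r_def)
    then have 1: "x * psign u1 = -1" using center_col[OF c' True] lt by simp
    have "p u1 v0 = - y * psign u1" using col_ray[OF y True] lt by (auto simp: pinwheel_p_def pinwheel_r_def)
    then have 2: "y * psign u1 = 1" using center_row[OF c True] lt by simp
    have D: "diamond N (u1 + 1) (v0 - 1)" using True lt(3) parity_gap[of u1 v0 N] by (auto simp: diamond_def)
    have "p (u1 + 1) (v0 - 1) = -1" using row_ray[OF x D] lt 1 by (auto simp: pinwheel_p_def)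
    moreover have "p (u1 + 1) (v0 - 1) = 1" using col_ray[OF y D] lt 2 by (auto simp: pinwheel_p_def pinwheel_r_def)
    ultimately show False by simp
  next
    case False
    have D: "diamond N (u1 + 1) v0" "diamond N u1 (v0 + 1)" "diamond N u1 (v0 - 1)" using False lt by (auto simp: diamond_def)
    have p1: "p (u1 + 1) v0 = -1" using center_row[OF c D(1)] lt by simp
    have r1: "r (u1 + 1) v0 = x * psign u1" using row_ray[OF x D(1)] lt by (auto simp: pinwheel_p_def pinwheel_r_def)
    have t: "p u1 (v0 + x * psign u1) = 1" "r u1 (v0 + x * psign u1) = - x * psign u1"
      using partner[of "u1 + 1" v0] p1 r1 by simp_all
    have "x * psign u1 \<noteq> 1"
      using t center_col[OF c' D(2)] lt by (auto simp: sgn_if split: if_splits)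
    then have x1: "x * psign u1 = -1" using xy psign_cases[of u1] by auto
    then have "p u1 (v0 - 1) = 1" using t by simp
    then have y1: "y * psign u1 = -1" using col_ray[OF y D(3)] lt by (auto simp: pinwheel_p_def pinwheel_r_def)
    have "p u1 (v0 + 1) = -1" using row_ray[OF x D(2)] lt x1 by (auto simp: pinwheel_p_def)
    moreover have "p u1 (v0 + 1) \<noteq> -1"
    proof (cases "v1 = v0 + 1")
      case True
      then show ?thesis using center_row[OF c'] D(2) by auto
    next
      case False
      then show ?thesis using col_ray[OF y D(2)] lt y1 by (auto simp: pinwheel_p_def pinwheel_r_def)
    qed
    ultimately show False by simp
  qed
qed

text \<open>Because \<open>\<bar>u0\<bar> + \<bar>v0\<bar>\<close> and \<open>\<bar>u1\<bar> + \<bar>v1\<bar>\<close> are both less than \<open>N\<close>, at least one of the two crossing points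
  \<open>(u1, v0)\<close> and \<open>(u0, v1)\<close> lies inside the diamond.\<close>

lemma no_two_centers_pos:
  assumes c: "center u0 v0" and c': "center u1 v1" and lt: "u0 < u1" "v0 < v1"
  shows False
proof (cases "\<bar>u1\<bar> + \<bar>v0\<bar> < N")
  case True
  then show ?thesis using no_two_centers_aux c c' lt by blast
next
  case False
  then have "\<bar>v1\<bar> + \<bar>u0\<bar> < N" using c c' by (simp add: center_def)
  then show ?thesis
    using tatami_field.no_two_centers_aux[OF swap, of v0 u0 v1 u1] swap_center c c' lt by blast
qed

lemma center_same_row:
  assumes c: "center u0 v0" and c': "center u1 v0" shows "u0 = u1"
proof -
  have "False" if c: "center u0 v0" and c': "center u1 v0" and "u0 < u1" for u0 u1
  proof -
    define w where "w = (if even (u0 + v0 + N) then u0 + 2 else u0 + 1)"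
    have b: "\<bar>u0\<bar> + \<bar>v0\<bar> < N" using c by (simp add: center_def)
    have "diamond N w v0"
    proof (cases "even (u0 + v0 + N)")
      case True
      then have "\<bar>u0\<bar> + \<bar>v0\<bar> + 2 \<le> N" using b parity_gap by blast
      then show ?thesis using True by (auto simp: w_def diamond_def)
    qed (use b in \<open>auto simp: w_def diamond_def\<close>)
    then have "sgn (u0 - w) = sgn (u1 - w)" using center_row[OF c] center_row[OF c'] by simp
    then have "w > u1" by (auto simp: w_def sgn_if split: if_splits)
    then have w: "w = u0 + 2" "u1 = u0 + 1" "even (u0 + v0 + N)" using that(3) by (auto simp: w_def split: if_splits)
    then have "diamond N u0 v0" using b by (auto simp: diamond_def)
    then show False using center_row[OF c, of u0] center_row[OF c', of u0] w by simp
  qed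
  then show ?thesis using assms by (metis linorder_neqE_linordered_idom)
qed

lemma center_same_col: "center u0 v0 \<Longrightarrow> center u0 v1 \<Longrightarrow> v0 = v1"
  using tatami_field.center_same_row[OF swap] swap_center by blast

theorem center_unique:
  assumes c: "center u0 v0" and c': "center u1 v1" shows "u0 = u1 \<and> v0 = v1"
proof (rule ccontr)
  assume "\<not> ?thesis"
  then have ne: "u0 \<noteq> u1" "v0 \<noteq> v1" using center_same_row center_same_col c c' by blast+
  have *: False if "center u0 v0" "center u1 v1" "u0 < u1" "v0 \<noteq> v1" for u0 v0 u1 v1
  proof (cases "v0 < v1")
    case True
    then show ?thesis using no_two_centers_pos that by blast
  next
    case False
    have "tatami_field.center N (\<lambda>u v. - p (- u) v) (\<lambda>u v. r (- u) v) (- u0) v0"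
      "tatami_field.center N (\<lambda>u v. - p (- u) v) (\<lambda>u v. r (- u) v) (- u1) v1" using that neg_center by blast+
    then show ?thesis using tatami_field.no_two_centers_pos[OF neg, of "-u1" v1 "-u0" v0] that False by auto
  qed
  show False using *[OF c c'] *[OF c' c] ne by force
qed

end

section \<open>Fields from arrows\<close>

text \<open>It is convenient to describe a field by arrows on all cells: a cell whose arrow leaves the diamond
  is a monomer.\<close>

definition fits :: "int \<Rightarrow> (int \<Rightarrow> int \<Rightarrow> int) \<Rightarrow> (int \<Rightarrow> int \<Rightarrow> int) \<Rightarrow> int \<Rightarrow> int \<Rightarrow> bool" where
  "fits N P R u v \<longleftrightarrow> diamond N u v \<and> diamond N (u + P u v) (v + R u v)"

definition trim_p :: "int \<Rightarrow> (int \<Rightarrow> int \<Rightarrow> int) \<Rightarrow> (int \<Rightarrow> int \<Rightarrow> int) \<Rightarrow> int \<Rightarrow> int \<Rightarrow> int" where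
  "trim_p N P R u v = (if fits N P R u v then P u v else 0)"
definition trim_r :: "int \<Rightarrow> (int \<Rightarrow> int \<Rightarrow> int) \<Rightarrow> (int \<Rightarrow> int \<Rightarrow> int) \<Rightarrow> int \<Rightarrow> int \<Rightarrow> int" where
  "trim_r N P R u v = (if fits N P R u v then R u v else 0)"

text \<open>The conditions of a tatami field, except that an arrow may leave the diamond. The arrow \<open>(0, 0)\<close> marks
  an interior monomer.\<close>

definition arrows :: "int \<Rightarrow> (int \<Rightarrow> int \<Rightarrow> int) \<Rightarrow> (int \<Rightarrow> int \<Rightarrow> int) \<Rightarrow> bool" where
  "arrows N P R \<longleftrightarrow> (\<forall>u v. diamond N u v \<longrightarrow>
     (P u v = 0 \<and> R u v = 0 \<or> (P u v = 1 \<or> P u v = -1) \<and> (R u v = 1 \<or> R u v = -1)) \<and>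
     (diamond N (u + P u v) (v + R u v) \<longrightarrow>
        P (u + P u v) (v + R u v) = - P u v \<and> R (u + P u v) (v + R u v) = - R u v) \<and>
     (diamond N (u + 2) v \<longrightarrow> P u v = 1 \<or> P (u + 2) v = -1) \<and>
     (diamond N u (v + 2) \<longrightarrow> R u v = 1 \<or> R u (v + 2) = -1))"

lemma arrows_swap: "arrows N (\<lambda>u v. R v u) (\<lambda>u v. P v u) \<longleftrightarrow> arrows N P R"
proof -
  have "arrows N (\<lambda>u v. R v u) (\<lambda>u v. P v u)" if "arrows N P R" for P R
    unfolding arrows_def
  proof (intro allI impI)
    fix u v assume D: "diamond N u v"
    then have "diamond N v u" by (simp add: diamond_swap)
    note A = that[unfolded arrows_def, rule_format, OF this]
    have sw: "diamond N (u + R v u) (v + P v u) = diamond N (v + P v u) (u + R v u)" "diamond N (u + 2) v = diamond N v (u + 2)"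
      "diamond N u (v + 2) = diamond N (v + 2) u" by (rule diamond_swap)+
    show "(R v u = 0 \<and> P v u = 0 \<or> (R v u = 1 \<or> R v u = - 1) \<and> (P v u = 1 \<or> P v u = - 1)) \<and>
           (diamond N (u + R v u) (v + P v u) \<longrightarrow>
            R (v + P v u) (u + R v u) = - R v u \<and> P (v + P v u) (u + R v u) = - P v u) \<and>
           (diamond N (u + 2) v \<longrightarrow> R v u = 1 \<or> R v (u + 2) = - 1) \<and>
           (diamond N u (v + 2) \<longrightarrow> P v u = 1 \<or> P (v + 2) u = - 1)"
      unfolding sw using A by blast
  qed
  from this[of P R] this[of "\<lambda>u v. R v u" "\<lambda>u v. P v u"] show ?thesis by auto
qed

lemma fits_swap: "fits N (\<lambda>u v. R v u) (\<lambda>u v. P v u) v u \<longleftrightarrow> fits N P R u v"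
  unfolding fits_def using diamond_swap by blast

text \<open>If two consecutive cells of a row are in the diamond, then so are both cells between them, hence an
  arrow that points from one towards the other fits.\<close>

lemma arrows_row_aux:
  assumes "arrows N P R" "diamond N u v" "diamond N (u + 2) v"
  shows "trim_p N P R u v = 1 \<or> trim_p N P R (u + 2) v = -1"
proof -
  note A = assms(1)[unfolded arrows_def, rule_format]
  have R1: "R u v = 0 \<and> P u v = 0 \<or> R u v = 1 \<or> R u v = -1" and R2: "R (u+2) v = 0 \<and> P (u + 2) v = 0 \<or> R (u+2) v = 1 \<or> R (u+2) v = -1"
    using A[OF assms(2)] A[OF assms(3)] by blast+
  have T: "diamond N (u + 1) (v + 1)" "diamond N (u + 1) (v - 1)" using assms(2,3) by (auto simp: diamond_def)
  have "P u v = 1 \<or> P (u + 2) v = -1" using A[OF assms(2)] assms(3) by blast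
  then show ?thesis
  proof
    assume "P u v = 1"
    then have "fits N P R u v" using assms(2) T R1 by (auto simp: fits_def)
    then show ?thesis using \<open>P u v = 1\<close> by (simp add: trim_p_def)
  next
    assume p: "P (u + 2) v = -1"
    then have e: "u + 2 + P (u + 2) v = u + 1" by simp
    have "R (u + 2) v = 1 \<or> R (u + 2) v = -1" using R2 p by auto
    then have "diamond N (u + 2 + P (u + 2) v) (v + R (u + 2) v)" unfolding e using T by auto
    then have "fits N P R (u + 2) v" using assms(3) by (auto simp: fits_def)
    then show ?thesis using p by (simp add: trim_p_def)
  qed
qed

lemma trim_swap: "trim_p N (\<lambda>u v. R v u) (\<lambda>u v. P v u) v u = trim_r N P R u v"
  unfolding trim_p_def trim_r_def fits_swap[of N R P v u] by (rule refl)

lemma arrows_field: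
  assumes "arrows N P R"
  shows "tatami_field N (trim_p N P R) (trim_r N P R)"
proof unfold_locales
  note A = assms[unfolded arrows_def, rule_format]
  fix u v
  show "\<not> diamond N u v \<Longrightarrow> trim_p N P R u v = 0 \<and> trim_r N P R u v = 0"
    by (simp add: trim_p_def trim_r_def fits_def)
  show "diamond N u v \<Longrightarrow> diamond N (u + 2) v \<Longrightarrow> trim_p N P R u v = 1 \<or> trim_p N P R (u + 2) v = - 1"
    by (rule arrows_row_aux[OF assms])
  show "diamond N u v \<Longrightarrow> diamond N u (v + 2) \<Longrightarrow> trim_r N P R u v = 1 \<or> trim_r N P R u (v + 2) = - 1"
  proof -
    assume "diamond N u v" "diamond N u (v + 2)"
    then have D: "diamond N v u" "diamond N (v + 2) u" using diamond_swap by blast+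
    show ?thesis using arrows_row_aux[OF iffD2[OF arrows_swap assms] D] unfolding trim_swap[of N R P v u] trim_swap[of N R P "v + 2" u] .
  qed
  assume D: "diamond N u v"
  show "trim_p N P R u v = 0 \<and> trim_r N P R u v = 0 \<or>
       (trim_p N P R u v = 1 \<or> trim_p N P R u v = - 1) \<and>
       (trim_r N P R u v = 1 \<or> trim_r N P R u v = - 1) \<and>
       diamond N (u + trim_p N P R u v) (v + trim_r N P R u v) \<and>
       trim_p N P R (u + trim_p N P R u v) (v + trim_r N P R u v) = - trim_p N P R u v \<and>
       trim_r N P R (u + trim_p N P R u v) (v + trim_r N P R u v) = - trim_r N P R u v"
  proof (cases "fits N P R u v")
    case False
    then show ?thesis by (simp add: trim_p_def trim_r_def)
  next
    case True
    then have T: "diamond N (u + P u v) (v + R u v)" by (simp add: fits_def)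
    then have *: "P (u + P u v) (v + R u v) = - P u v" "R (u + P u v) (v + R u v) = - R u v" using A[OF D] by blast+
    then have F: "fits N P R (u + P u v) (v + R u v)" using T D by (simp add: fits_def)
    have e: "trim_p N P R u v = P u v" "trim_r N P R u v = R u v" using True by (simp_all add: trim_p_def trim_r_def)
    have e': "trim_p N P R (u + P u v) (v + R u v) = - P u v" "trim_r N P R (u + P u v) (v + R u v) = - R u v"
      using F * by (simp_all add: trim_p_def trim_r_def)
    have "P u v = 0 \<and> R u v = 0 \<or> (P u v = 1 \<or> P u v = - 1) \<and> (R u v = 1 \<or> R u v = - 1)" using A[OF D] by blast
    then show ?thesis unfolding e e' using T by blast
  qed
qed

section \<open>Flipping pairs of lines\<close>

definition flip :: "int set \<Rightarrow> int \<Rightarrow> int" where "flip A i = (if i \<in> A then -1 else 1)"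

text \<open>Where all columns have the signs \<open>b * psign u\<close>, the cells of row \<open>v\<close> move to row \<open>v + b * psign (N + v)\<close>,
  and those of that row move back. This divides the rows into pairs \<open>e * i\<close>, \<open>e * (i + 1)\<close> with
  \<open>e = b * psign (N + i)\<close>, one for each \<open>i \<ge> 0\<close>, on alternating sides of \<open>0\<close>; \<open>pair_index N b v\<close> is the
  number \<open>i\<close> of the pair of row \<open>v\<close>.\<close>

definition pair_index :: "int \<Rightarrow> int \<Rightarrow> int \<Rightarrow> int" where
  "pair_index N b v = (if v = b * psign (N + v) * \<bar>v\<bar> then \<bar>v\<bar> else \<bar>v\<bar> - 1)"

lemma flip_cases: "flip A i = 1 \<or> flip A i = -1" by (simp add: flip_def)
lemma pair_index_le: "pair_index N b v \<le> \<bar>v\<bar>" "\<bar>v\<bar> - 1 \<le> pair_index N b v" by (auto simp: pair_index_def)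

lemma psign_neighbour [simp]: "psign (N + (v + 1)) = - psign (N + v)" "psign (N + (v - 1)) = - psign (N + v)" 
  by (auto simp: psign_def)

lemma pair_index_partner:
  assumes "b = 1 \<or> b = -1"
  shows "pair_index N b (v + b * psign (N + v)) = pair_index N b v"
proof -
  define e where "e = b * psign (N + v)"
  have e: "e = 1 \<or> e = -1" using assms psign_cases[of "N + v"] by (auto simp: e_def)
  have "b * psign (N + (v + e)) = - e" using e by (auto simp: e_def)
  then show ?thesis unfolding pair_index_def e_def[symmetric] using e by (auto simp: abs_if)
qed

text \<open>The cells of the rows to be flipped move to the other row of their pair, and \<open>p\<close> depends there on the
  row only. After a flip they still move to the other row of their pair, which has been flipped as well.
  No cell outside moves into a flipped pair, because the moves in there stay inside the pair.\<close>

lemma flip_rows: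
  assumes ar: "arrows N P R" and b: "b = 1 \<or> b = -1"
    and zone: "\<And>u v. diamond N u v \<Longrightarrow> pair_index N b v \<in> A \<Longrightarrow> R u v = b * psign (N + v) \<and> P u v = l v"
    and l: "\<And>v. \<bar>v\<bar> \<le> N \<Longrightarrow> pair_index N b v \<in> A \<Longrightarrow> (l v = 1 \<or> l v = -1) \<and> l (v + b * psign (N + v)) = - l v"
  shows "arrows N (\<lambda>u v. P u v * flip A (pair_index N b v)) R"
  unfolding arrows_def
proof (intro allI impI)
  fix u v assume D: "diamond N u v"
  let ?P = "\<lambda>u v. P u v * flip A (pair_index N b v)"
  have A1: "P u v = 0 \<and> R u v = 0 \<or> (P u v = 1 \<or> P u v = - 1) \<and> (R u v = 1 \<or> R u v = - 1)"
    and A2: "diamond N (u + P u v) (v + R u v) \<Longrightarrow> P (u + P u v) (v + R u v) = - P u v \<and> R (u + P u v) (v + R u v) = - R u v"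
    and A3: "diamond N (u + 2) v \<Longrightarrow> P u v = 1 \<or> P (u + 2) v = - 1"
    and A4: "diamond N u (v + 2) \<Longrightarrow> R u v = 1 \<or> R u (v + 2) = - 1"
    using ar[unfolded arrows_def, rule_format, OF D] by blast+
  have vN: "\<bar>v\<bar> \<le> N" using D unfolding diamond_def by linarith
  have 1: "?P u v = 0 \<and> R u v = 0 \<or> (?P u v = 1 \<or> ?P u v = - 1) \<and> (R u v = 1 \<or> R u v = - 1)"
    using A1 flip_cases[of A "pair_index N b v"] by auto
  have 2: "?P (u + ?P u v) (v + R u v) = - ?P u v \<and> R (u + ?P u v) (v + R u v) = - R u v"
    if T: "diamond N (u + ?P u v) (v + R u v)"
  proof (cases "pair_index N b v \<in> A")
    case True
    have z: "R u v = b * psign (N + v)" "P u v = l v" using zone[OF D True] by auto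
    have i: "pair_index N b (v + R u v) \<in> A" using True z pair_index_partner[OF b] by simp
    have z': "R (u + ?P u v) (v + R u v) = b * psign (N + (v + R u v))" "P (u + ?P u v) (v + R u v) = l (v + R u v)"
      using zone[OF T i] by auto
    have "psign (N + (v + R u v)) = - psign (N + v)" using z b psign_cases[of "N + v"] by auto
    then show ?thesis using z z' l[OF vN True] True i by (simp add: flip_def)
  next
    case False
    then have P: "?P u v = P u v" by (simp add: flip_def)
    then have T': "diamond N (u + P u v) (v + R u v)" using T unfolding P by blast
    have B: "P (u + P u v) (v + R u v) = - P u v" "R (u + P u v) (v + R u v) = - R u v" using A2 T' by auto
    have "pair_index N b (v + R u v) \<notin> A"
    proof
      assume i: "pair_index N b (v + R u v) \<in> A"
      then have "R (u + P u v) (v + R u v) = b * psign (N + (v + R u v))" using zone[OF T' i] by simp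
      then have "(v + R u v) + b * psign (N + (v + R u v)) = v" using B by simp
      then have "pair_index N b v = pair_index N b (v + R u v)" using pair_index_partner[OF b, of N "v + R u v"] by (simp only:)
      then show False using False i by simp
    qed
    then have f: "flip A (pair_index N b v) = 1" "flip A (pair_index N b (v + R u v)) = 1" using False by (simp_all add: flip_def)
    show ?thesis using B by (simp add: f)
  qed
  have 3: "?P u v = 1 \<or> ?P (u + 2) v = - 1" if D2: "diamond N (u + 2) v"
  proof (cases "pair_index N b v \<in> A")
    case True
    then show ?thesis using zone[OF D True] zone[OF D2 True] l[OF vN True] by (auto simp: flip_def)
  next
    case False
    then show ?thesis using A3 D2 by (auto simp: flip_def)
  qed
  show "(?P u v = 0 \<and> R u v = 0 \<or> (?P u v = 1 \<or> ?P u v = - 1) \<and> (R u v = 1 \<or> R u v = - 1)) \<and>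
           (diamond N (u + ?P u v) (v + R u v) \<longrightarrow>
            ?P (u + ?P u v) (v + R u v) = - ?P u v \<and> R (u + ?P u v) (v + R u v) = - R u v) \<and>
           (diamond N (u + 2) v \<longrightarrow> ?P u v = 1 \<or> ?P (u + 2) v = - 1) \<and>
           (diamond N u (v + 2) \<longrightarrow> R u v = 1 \<or> R u (v + 2) = - 1)"
    using 1 2 3 A4 by blast
qed

lemma flip_cols:
  assumes ar: "arrows N P R" and a: "a = 1 \<or> a = -1"
    and zone: "\<And>u v. diamond N u v \<Longrightarrow> pair_index N a u \<in> B \<Longrightarrow> P u v = a * psign (N + u) \<and> R u v = l u"
    and l: "\<And>u. \<bar>u\<bar> \<le> N \<Longrightarrow> pair_index N a u \<in> B \<Longrightarrow> (l u = 1 \<or> l u = -1) \<and> l (u + a * psign (N + u)) = - l u"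
  shows "arrows N P (\<lambda>u v. R u v * flip B (pair_index N a u))"
proof -
  have "arrows N (\<lambda>u v. R v u * flip B (pair_index N a v)) (\<lambda>u v. P v u)"
  proof (rule flip_rows[where l = l])
    show "arrows N (\<lambda>u v. R v u) (\<lambda>u v. P v u)" by (rule iffD2[OF arrows_swap ar])
    fix u v assume "diamond N u v" "pair_index N a v \<in> B"
    then show "P v u = a * psign (N + v) \<and> R v u = l v" using zone[of v u] diamond_swap by blast
  qed (rule a, rule l)
  then show ?thesis by (rule iffD1[OF arrows_swap[of N "\<lambda>u v. R u v * flip B (pair_index N a u)" P]])
qed

text \<open>As \<open>pair_index N b v \<le> \<bar>v\<bar>\<close>, the bound \<open>i + j > N\<close> ensures that no cell of the diamond lies both in a flipped
  row and in a flipped column, so that the two kinds of flips do not interfere.\<close>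

lemma flips:
  assumes ar: "arrows N P R" and ab: "a = 1 \<or> a = -1" "b = 1 \<or> b = -1"
    and zoneA: "\<And>u v. diamond N u v \<Longrightarrow> pair_index N b v \<in> A \<Longrightarrow> R u v = b * psign (N + v) \<and> P u v = l v"
    and l: "\<And>v. \<bar>v\<bar> \<le> N \<Longrightarrow> pair_index N b v \<in> A \<Longrightarrow> (l v = 1 \<or> l v = -1) \<and> l (v + b * psign (N + v)) = - l v"
    and zoneB: "\<And>u v. diamond N u v \<Longrightarrow> pair_index N a u \<in> B \<Longrightarrow> P u v = a * psign (N + u) \<and> R u v = k u"
    and k: "\<And>u. \<bar>u\<bar> \<le> N \<Longrightarrow> pair_index N a u \<in> B \<Longrightarrow> (k u = 1 \<or> k u = -1) \<and> k (u + a * psign (N + u)) = - k u"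
    and AB: "\<And>i j. i \<in> A \<Longrightarrow> j \<in> B \<Longrightarrow> i + j > N"
  shows "arrows N (\<lambda>u v. P u v * flip A (pair_index N b v)) (\<lambda>u v. R u v * flip B (pair_index N a u))"
proof (rule flip_cols[where l = k])
  show "arrows N (\<lambda>u v. P u v * flip A (pair_index N b v)) R"
    by (rule flip_rows[where l = l, OF ar ab(2) zoneA l])
  fix u v assume D: "diamond N u v" and B: "pair_index N a u \<in> B"
  have "pair_index N b v \<notin> A"
    using AB[OF _ B, of "pair_index N b v"] pair_index_le(1)[of N b v] pair_index_le(1)[of N a u] D by (auto simp: diamond_def)
  then show "P u v * flip A (pair_index N b v) = a * psign (N + u) \<and> R u v = k u"
    using zoneB[OF D B] by (simp add: flip_def)
qed (rule ab(1), rule k)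

section \<open>Flipped bricks and flipped pinwheels\<close>

text \<open>The brick pattern with signs \<open>a\<close> and \<open>b\<close>, after flipping the row pairs in \<open>A\<close> and the column pairs in \<open>B\<close>.
  The signs of the columns determine how rows are paired and vice versa, which is why \<open>b\<close> occurs in
  the pair index of a row.\<close>

definition flipped_bricks_p :: "int \<Rightarrow> int \<Rightarrow> int \<Rightarrow> int set \<Rightarrow> int \<Rightarrow> int \<Rightarrow> int" where
  "flipped_bricks_p N a b A u v = a * psign v * flip A (pair_index N b v)"
definition flipped_bricks_r :: "int \<Rightarrow> int \<Rightarrow> int \<Rightarrow> int set \<Rightarrow> int \<Rightarrow> int \<Rightarrow> int" where
  "flipped_bricks_r N a b B u v = b * psign u * flip B (pair_index N a u)"

lemma psign_step: "a = 1 \<or> a = -1 \<Longrightarrow> psign (u + a * psign w) = - psign u"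
  using psign_cases[of w] by auto

lemma diamond_psign': "diamond N u v \<Longrightarrow> psign (N + u) = psign v" using diamond_psign[of N v u] diamond_swap by blast

lemma arrows_bricks:
  assumes "a = 1 \<or> a = -1" "b = 1 \<or> b = -1"
  shows "arrows N (\<lambda>u v. a * psign v) (\<lambda>u v. b * psign u)"
  unfolding arrows_def
  using assms by (auto simp: psign_def)

lemma arrows_flipped_bricks:
  assumes ab: "a = 1 \<or> a = -1" "b = 1 \<or> b = -1" and AB: "\<And>i j. i \<in> A \<Longrightarrow> j \<in> B \<Longrightarrow> i + j > N"
  shows "arrows N (flipped_bricks_p N a b A) (flipped_bricks_r N a b B)"
  unfolding flipped_bricks_p_def[abs_def] flipped_bricks_r_def[abs_def]
proof (rule flips[OF arrows_bricks[OF ab] ab, where l = "\<lambda>v. a * psign v" and k = "\<lambda>u. b * psign u"])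
  fix w assume "\<bar>w\<bar> \<le> N"
  show "(a * psign w = 1 \<or> a * psign w = - 1) \<and> a * psign (w + b * psign (N + w)) = - (a * psign w)"
    "(b * psign w = 1 \<or> b * psign w = - 1) \<and> b * psign (w + a * psign (N + w)) = - (b * psign w)"
    using ab psign_cases[of w] psign_step[OF ab(1), of w "N + w"] psign_step[OF ab(2), of w "N + w"] by auto
next
  fix u v assume D: "diamond N u v"
  show "b * psign u = b * psign (N + v) \<and> a * psign v = a * psign v" "a * psign v = a * psign (N + u) \<and> b * psign u = b * psign u"
    using diamond_psign[OF D] diamond_psign'[OF D] by simp_all
qed (rule AB)

text \<open>The row pairs to be flipped lie in the corner regions \<open>\<bar>v\<bar> > N - \<bar>u0\<bar>\<close>, whose cells satisfy \<open>\<bar>u\<bar> < \<bar>u0\<bar>\<close>.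
  There all columns lie on the same side of the center, and their signs are those of a brick pattern
  with \<open>b = x * sgn u0\<close>.\<close>

definition flipped_pinwheel_p :: "int \<Rightarrow> int \<Rightarrow> int \<Rightarrow> int \<Rightarrow> int set \<Rightarrow> int \<Rightarrow> int \<Rightarrow> int" where
  "flipped_pinwheel_p N x u0 v0 A u v = pinwheel_p x u0 v0 u v * flip A (pair_index N (x * sgn u0) v)"
definition flipped_pinwheel_r :: "int \<Rightarrow> int \<Rightarrow> int \<Rightarrow> int \<Rightarrow> int set \<Rightarrow> int \<Rightarrow> int \<Rightarrow> int" where
  "flipped_pinwheel_r N x u0 v0 B u v = pinwheel_r x u0 v0 u v * flip B (pair_index N (- x * psign N * sgn v0) u)"

lemma arrows_pinwheel:
  assumes x: "x = 1 \<or> x = -1"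
  shows "arrows N (pinwheel_p x u0 v0) (pinwheel_r x u0 v0)"
  unfolding arrows_def
proof (intro allI impI)
  fix u v assume D: "diamond N u v"
  define y where "y = x * psign u"
  have y: "y = 1 \<or> y = -1" using x psign_cases[of u] by (auto simp: y_def)
  have P: "pinwheel_p x u0 v0 u v = (if v = v0 then sgn (u0 - u) else y * sgn (v - v0))" 
    and R: "pinwheel_r x u0 v0 u v = (if u = u0 then sgn (v0 - v) else - y * sgn (u - u0))" for v
    by (auto simp: pinwheel_p_def pinwheel_r_def y_def)
  have P1: "pinwheel_p x u0 v0 (u + 1) w = (if w = v0 then sgn (u0 - u - 1) else - y * sgn (w - v0))"
     "pinwheel_r x u0 v0 (u + 1) w = (if u + 1 = u0 then sgn (v0 - w) else y * sgn (u + 1 - u0))"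
     "pinwheel_p x u0 v0 (u - 1) w = (if w = v0 then sgn (u0 - u + 1) else - y * sgn (w - v0))"
     "pinwheel_r x u0 v0 (u - 1) w = (if u - 1 = u0 then sgn (v0 - w) else y * sgn (u - 1 - u0))" 
     "pinwheel_p x u0 v0 (u + 2) w = (if w = v0 then sgn (u0 - u - 2) else y * sgn (w - v0))" for w
    by (auto simp: pinwheel_p_def pinwheel_r_def y_def algebra_simps)
  have "pinwheel_p x u0 v0 (u + pinwheel_p x u0 v0 u v) (v + pinwheel_r x u0 v0 u v) = - pinwheel_p x u0 v0 u v \<and> pinwheel_r x u0 v0 (u + pinwheel_p x u0 v0 u v) (v + pinwheel_r x u0 v0 u v) = - pinwheel_r x u0 v0 u v"
    using y P R P1
    apply (cases u u0 rule: linorder_cases; cases v v0 rule: linorder_cases; elim disjE)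
    by (simp_all add: sgn_if)
  moreover have "pinwheel_p x u0 v0 u v = 0 \<and> pinwheel_r x u0 v0 u v = 0 \<or> (pinwheel_p x u0 v0 u v = 1 \<or> pinwheel_p x u0 v0 u v = - 1) \<and> (pinwheel_r x u0 v0 u v = 1 \<or> pinwheel_r x u0 v0 u v = - 1)"
    using y by (auto simp: P R sgn_if)
  moreover have "pinwheel_p x u0 v0 u v = 1 \<or> pinwheel_p x u0 v0 (u + 2) v = - 1" 
    using y by (auto simp: P P1 sgn_if)
  moreover have "pinwheel_r x u0 v0 u v = 1 \<or> pinwheel_r x u0 v0 u (v + 2) = - 1" 
    using y by (auto simp: R sgn_if)
  ultimately show "(pinwheel_p x u0 v0 u v = 0 \<and> pinwheel_r x u0 v0 u v = 0 \<or> (pinwheel_p x u0 v0 u v = 1 \<or> pinwheel_p x u0 v0 u v = - 1) \<and> (pinwheel_r x u0 v0 u v = 1 \<or> pinwheel_r x u0 v0 u v = - 1)) \<and>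
           (diamond N (u + pinwheel_p x u0 v0 u v) (v + pinwheel_r x u0 v0 u v) \<longrightarrow>
            pinwheel_p x u0 v0 (u + pinwheel_p x u0 v0 u v) (v + pinwheel_r x u0 v0 u v) = - pinwheel_p x u0 v0 u v \<and> pinwheel_r x u0 v0 (u + pinwheel_p x u0 v0 u v) (v + pinwheel_r x u0 v0 u v) = - pinwheel_r x u0 v0 u v) \<and>
           (diamond N (u + 2) v \<longrightarrow> pinwheel_p x u0 v0 u v = 1 \<or> pinwheel_p x u0 v0 (u + 2) v = - 1) \<and>
           (diamond N u (v + 2) \<longrightarrow> pinwheel_r x u0 v0 u v = 1 \<or> pinwheel_r x u0 v0 u (v + 2) = - 1)"
    by blast
qed

text \<open>A row of such a pair meets only columns with \<open>\<bar>u\<bar> < \<bar>u0\<bar>\<close>, and it lies farther from \<open>0\<close> than \<open>v0\<close>.\<close>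

lemma pinwheel_corner_rows:
  assumes x: "x = 1 \<or> x = -1" and c: "\<bar>u0\<bar> + \<bar>v0\<bar> < N" and i: "pair_index N b v > N - \<bar>u0\<bar>" and D: "diamond N u v"
  shows "pinwheel_r x u0 v0 u v = x * sgn u0 * psign (N + v) \<and> pinwheel_p x u0 v0 u v = x * psign (N + v) * sgn v"
proof -
  have v: "\<bar>v\<bar> > N - \<bar>u0\<bar>" using i pair_index_le(1)[of N b v] by linarith
  then have "\<bar>u\<bar> < \<bar>u0\<bar>" "\<bar>v0\<bar> < \<bar>v\<bar>" using D c by (auto simp: diamond_def)
  then have "sgn (u - u0) = - sgn u0" "u \<noteq> u0" "sgn (v - v0) = sgn v" "v \<noteq> v0" by (auto simp: sgn_if)
  then show ?thesis using diamond_psign[OF D] by (auto simp: pinwheel_p_def pinwheel_r_def)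
qed

lemma pinwheel_corner_cols:
  assumes x: "x = 1 \<or> x = -1" and c: "\<bar>u0\<bar> + \<bar>v0\<bar> < N" and i: "pair_index N b u > N - \<bar>v0\<bar>" and D: "diamond N u v"
  shows "pinwheel_p x u0 v0 u v = - x * psign N * sgn v0 * psign (N + u) \<and> pinwheel_r x u0 v0 u v = - x * psign u * sgn u"
proof -
  have v: "\<bar>u\<bar> > N - \<bar>v0\<bar>" using i pair_index_le(1)[of N b u] by linarith
  then have "\<bar>v\<bar> < \<bar>v0\<bar>" "\<bar>u0\<bar> < \<bar>u\<bar>" using D c by (auto simp: diamond_def)
  then have "sgn (v - v0) = - sgn v0" "u \<noteq> u0" "sgn (u - u0) = sgn u" "v \<noteq> v0" by (auto simp: sgn_if)
  then show ?thesis using D by (auto simp: pinwheel_p_def pinwheel_r_def psign_def diamond_def)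
qed

lemma sgn_step: "\<bar>v\<bar> > (1 :: int) \<Longrightarrow> e = 1 \<or> e = -1 \<Longrightarrow> sgn (v + e) = sgn v"
  by (auto simp: sgn_if)

lemma sgn_partner:
  assumes "b = 1 \<or> b = -1" "pair_index N b v > 0"
  shows "sgn (v + b * psign (N + v)) = sgn v"
proof (cases "\<bar>v\<bar> > 1")
  case True
  then show ?thesis using sgn_step[OF True, of "b * psign (N + v)"] assms(1) psign_cases[of "N + v"] by auto
next
  case False
  then show ?thesis using assms psign_cases[of "N + v"] by (auto simp: pair_index_def sgn_if abs_if split: if_splits)
qed

lemma arrows_flipped_pinwheel:
  assumes x: "x = 1 \<or> x = -1" and c: "\<bar>u0\<bar> + \<bar>v0\<bar> < N"
    and A: "A \<subseteq> {N - \<bar>u0\<bar> + 1..N - 1}" and B: "B \<subseteq> {N - \<bar>v0\<bar> + 1..N - 1}"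
  shows "arrows N (flipped_pinwheel_p N x u0 v0 A) (flipped_pinwheel_r N x u0 v0 B)"
proof -
  define b where "b = (if u0 = 0 then 1 else x * sgn u0)"
  define a where "a = (if v0 = 0 then 1 else - x * psign N * sgn v0)"
  have ab: "a = 1 \<or> a = -1" "b = 1 \<or> b = -1" using x psign_cases[of N] by (auto simp: a_def b_def sgn_if)
  have A0: "u0 \<noteq> 0" if "i \<in> A" for i using that A by auto
  have B0: "v0 \<noteq> 0" if "i \<in> B" for i using that B by auto
  have Ab: "flipped_pinwheel_p N x u0 v0 A = (\<lambda>u v. pinwheel_p x u0 v0 u v * flip A (pair_index N b v))"
    using A0 by (auto simp: flipped_pinwheel_p_def fun_eq_iff b_def flip_def)
  have Ba: "flipped_pinwheel_r N x u0 v0 B = (\<lambda>u v. pinwheel_r x u0 v0 u v * flip B (pair_index N a u))"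
    using B0 by (auto simp: flipped_pinwheel_r_def fun_eq_iff a_def flip_def)
  have Ai: "i > N - \<bar>u0\<bar> \<and> i > 0" if "i \<in> A" for i
    using subsetD[OF A that] c abs_ge_zero[of v0] unfolding atLeastAtMost_iff by linarith
  have Bi: "i > N - \<bar>v0\<bar> \<and> i > 0" if "i \<in> B" for i
    using subsetD[OF B that] c abs_ge_zero[of u0] unfolding atLeastAtMost_iff by linarith
  show ?thesis unfolding Ab Ba
  proof (rule flips[OF arrows_pinwheel[OF x] ab, where l = "\<lambda>v. x * psign (N + v) * sgn v" and k = "\<lambda>u. - x * psign u * sgn u"])
    fix u v assume D: "diamond N u v" and i: "pair_index N b v \<in> A"
    show "pinwheel_r x u0 v0 u v = b * psign (N + v) \<and> pinwheel_p x u0 v0 u v = x * psign (N + v) * sgn v"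
      using pinwheel_corner_rows[OF x c _ D] Ai[OF i] A0[OF i] by (auto simp: b_def)
  next
    fix v assume i: "pair_index N b v \<in> A"
    have "v \<noteq> 0" using Ai[OF i] pair_index_le(1)[of N b v] by auto
    have "psign (N + (v + b * psign (N + v))) = - psign (N + v)"
      using ab psign_cases[of "N + v"] by auto
    then show "(x * psign (N + v) * sgn v = 1 \<or> x * psign (N + v) * sgn v = - 1) \<and>
         x * psign (N + (v + b * psign (N + v))) * sgn (v + b * psign (N + v)) = - (x * psign (N + v) * sgn v)"
      using sgn_partner[OF ab(2), of N v] Ai[OF i] \<open>v \<noteq> 0\<close> x psign_cases[of "N + v"] by (auto simp: sgn_if)
  next
    fix u v assume D: "diamond N u v" and i: "pair_index N a u \<in> B"
    show "pinwheel_p x u0 v0 u v = a * psign (N + u) \<and> pinwheel_r x u0 v0 u v = - x * psign u * sgn u"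
      using pinwheel_corner_cols[OF x c _ D] Bi[OF i] B0[OF i] by (auto simp: a_def)
  next
    fix u assume i: "pair_index N a u \<in> B"
    have "u \<noteq> 0" using Bi[OF i] pair_index_le(1)[of N a u] by auto
    have "psign (u + a * psign (N + u)) = - psign u"
      using ab psign_cases[of "N + u"] by auto
    then show "(- x * psign u * sgn u = 1 \<or> - x * psign u * sgn u = - 1) \<and>
         - x * psign (u + a * psign (N + u)) * sgn (u + a * psign (N + u)) = - (- x * psign u * sgn u)"
      using sgn_partner[OF ab(1), of N u] Bi[OF i] \<open>u \<noteq> 0\<close> x psign_cases[of "u"] by (auto simp: sgn_if)
  next
    fix i j assume "i \<in> A" "j \<in> B"
    then show "i + j > N" using A B c by force
  qed
qed

section \<open>Every field is a flipped brick pattern or a flipped pinwheel\<close>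

definition outer_line :: "int \<Rightarrow> int \<Rightarrow> int \<Rightarrow> int" where "outer_line N b i = b * psign (N + i) * (i + 1)"
definition inner_line :: "int \<Rightarrow> int \<Rightarrow> int \<Rightarrow> int" where "inner_line N b i = b * psign (N + i) * i"

lemma psign_scale: "e = 1 \<or> e = -1 \<Longrightarrow> psign (N + e * i) = psign (N + i)"
  by (auto simp: psign_def)

text \<open>Where the columns have the signs \<open>b * psign u\<close>, the outer line of a pair moves inwards. So none of its arrows leaves the diamond, which makes it the
  line on which the sign of the pair can be read.\<close>

lemma pair_lines:
  assumes b: "b = 1 \<or> b = -1" and i: "i \<ge> 0"
  shows "\<bar>outer_line N b i\<bar> = i + 1" "\<bar>inner_line N b i\<bar> = i" "pair_index N b (outer_line N b i) = i" "pair_index N b (inner_line N b i) = i"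
    "inner_line N b i = outer_line N b i + b * psign (N + outer_line N b i)" "outer_line N b i * (b * psign (N + outer_line N b i)) < 0"
    "psign (inner_line N b i) = - psign (outer_line N b i)"
proof -
  define e where "e = b * psign (N + i)"
  have e: "e = 1 \<or> e = -1" using b psign_cases[of "N + i"] by (auto simp: e_def)
  have o: "outer_line N b i = e * (i + 1)" and n: "inner_line N b i = e * i" by (simp_all add: outer_line_def inner_line_def e_def)
  have ao: "b * psign (N + outer_line N b i) = - e" unfolding o using psign_scale[OF e, of N "i + 1"] by (simp add: e_def)
  have an: "b * psign (N + inner_line N b i) = e" unfolding n using psign_scale[OF e, of N "i"] by (simp add: e_def)
  show "\<bar>outer_line N b i\<bar> = i + 1" "\<bar>inner_line N b i\<bar> = i" using e i by (auto simp: o n)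
  show "pair_index N b (outer_line N b i) = i" unfolding pair_index_def ao using e i by (auto simp: o)
  show "pair_index N b (inner_line N b i) = i" unfolding pair_index_def an using e i by (auto simp: n)
  show "inner_line N b i = outer_line N b i + b * psign (N + outer_line N b i)" unfolding ao using e by (auto simp: o n algebra_simps)
  show "outer_line N b i * (b * psign (N + outer_line N b i)) < 0" unfolding ao using e i by (auto simp: o)
  show "psign (inner_line N b i) = - psign (outer_line N b i)" using psign_scale[OF e, of 0 i] psign_scale[OF e, of 0 "i + 1"]
    by (simp add: o n)
qed

lemma pair_index_cases:
  assumes b: "b = 1 \<or> b = -1" and i: "pair_index N b v = i" "i \<ge> 0"
  shows "v = outer_line N b i \<or> v = inner_line N b i"
proof -
  define e where "e = b * psign (N + v)"
  have e: "e = 1 \<or> e = -1" using b psign_cases[of "N + v"] by (auto simp: e_def)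
  show ?thesis
  proof (cases "v = e * \<bar>v\<bar>")
    case True
    then have "i = \<bar>v\<bar>" using i by (simp add: pair_index_def e_def)
    then have "v = e * i" "psign (N + v) = psign (N + i)" using True psign_scale[OF e, of N i] by auto
    then show ?thesis by (simp add: inner_line_def e_def)
  next
    case False
    then have "i = \<bar>v\<bar> - 1" using i by (simp add: pair_index_def e_def)
    moreover have "v = - e * \<bar>v\<bar>" using False e by auto
    ultimately have v: "v = (- e) * (i + 1)" by simp
    have "psign (N + v) = psign (N + (i + 1))" using psign_scale[of "- e" N "i + 1"] e unfolding v by auto
    then have "- e = b * psign (N + i)" unfolding e_def by simp
    then have "v = b * psign (N + i) * (i + 1)" using v by (simp only:)
    then have "v = outer_line N b i" unfolding outer_line_def .
    then show ?thesis ..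
  qed
qed

text \<open>A cell at the end of its row and of its column, both pointing outwards, would move out of the
  diamond.\<close>

lemma corner_out:
  assumes "c = 1 \<or> c = (-1 :: int)" "d = 1 \<or> d = -1" "\<bar>u\<bar> + \<bar>v\<bar> \<le> N" "u = c * (N - \<bar>v\<bar>)" "v = d * (N - \<bar>u\<bar>)"
  shows "\<not> diamond N (u + c) (v + d)"
proof -
  have step: "\<bar>w + e\<bar> = \<bar>w\<bar> + 1" if "e = 1 \<or> e = -1" "w = e * k" "k \<ge> 0" for w e k :: int
    using that by (elim disjE) simp_all
  have "N - \<bar>v\<bar> \<ge> 0" "N - \<bar>u\<bar> \<ge> 0" using assms(3) by linarith+
  then have "\<bar>u + c\<bar> = \<bar>u\<bar> + 1" "\<bar>v + d\<bar> = \<bar>v\<bar> + 1" using step assms by blast+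
  moreover have "\<bar>u\<bar> = N - \<bar>v\<bar>" using assms(1,4) \<open>N - \<bar>v\<bar> \<ge> 0\<close> by (elim disjE) simp_all
  ultimately show ?thesis unfolding diamond_def by linarith
qed

context tatami_field begin

lemma eq_trim:
  assumes 1: "\<And>u v. diamond N u v \<Longrightarrow> p u v \<noteq> 0 \<Longrightarrow> p u v = P u v \<and> r u v = R u v"
    and 2: "\<And>u v. diamond N u v \<Longrightarrow> p u v = 0 \<Longrightarrow> \<not> diamond N (u + P u v) (v + R u v) \<or> P u v = 0 \<and> R u v = 0"
  shows "p = trim_p N P R \<and> r = trim_r N P R"
proof -
  have "p u v = trim_p N P R u v \<and> r u v = trim_r N P R u v" for u v
  proof (cases "diamond N u v \<and> p u v \<noteq> 0")
    case True
    then have e: "P u v = p u v" "R u v = r u v" using 1 by simp_all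
    then show ?thesis using partner(1)[of u v] True by (simp add: trim_p_def trim_r_def fits_def)
  next
    case False
    then have "p u v = 0" "r u v = 0" using outside[of u v] zero_iff[of u v] by auto
    then show ?thesis using False 2[of u v] by (auto simp: trim_p_def trim_r_def fits_def)
  qed
  then show ?thesis by (simp add: fun_eq_iff)
qed

lemma pure_row_p: "pure_row v c \<Longrightarrow> diamond N u v \<Longrightarrow> p u v \<noteq> 0 \<Longrightarrow> p u v = c"
  unfolding pure_row_def by blast
lemma pure_col_r: "pure_col u c \<Longrightarrow> diamond N u v \<Longrightarrow> r u v \<noteq> 0 \<Longrightarrow> r u v = c"
  unfolding pure_col_def by blast
lemma pure_row_pm: "pure_row v c \<Longrightarrow> c = 1 \<or> c = -1"
  unfolding pure_row_def by blast
lemma pure_col_pm: "pure_col u c \<Longrightarrow> c = 1 \<or> c = -1"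
  unfolding pure_col_def by blast
lemma pure_row_0: "pure_row v c \<Longrightarrow> diamond N u v \<Longrightarrow> p u v = 0 \<Longrightarrow> u = c * (N - \<bar>v\<bar>)"
  unfolding pure_row_def by auto
lemma pure_col_0: "pure_col u c \<Longrightarrow> diamond N u v \<Longrightarrow> r u v = 0 \<Longrightarrow> v = c * (N - \<bar>u\<bar>)"
  unfolding pure_col_def by auto

text \<open>A cell of the outer row \<open>v\<close> moves inwards, hence inside the diamond, to row \<open>v + e\<close>; its partner there has
  the opposite sign.\<close>

lemma pair_sign:
  assumes "pure_row v c" "pure_row (v + e) c'" "pure_col u e" "diamond N u v" "v * e < 0"
  shows "c' = - c"
proof -
  have e: "e = 1 \<or> e = -1" using pure_col_pm assms(3) .
  have "r u v \<noteq> 0"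
  proof
    assume "r u v = 0"
    then have "v = e * (N - \<bar>u\<bar>)" using pure_col_0 assms by blast
    moreover have "N - \<bar>u\<bar> \<ge> 0" using assms(4) unfolding diamond_def by linarith
    ultimately show False using assms(5) e by auto
  qed
  then have p0: "p u v \<noteq> 0" "r u v = e" "p u v = c" using zero_iff pure_col_r pure_row_p assms by blast+
  have "diamond N (u + c) (v + e)" "p (u + c) (v + e) = - c" using partner[OF p0(1)] p0 by auto
  then show ?thesis using pure_row_p[OF assms(2), of "u + c"] p0 by auto
qed

text \<open>The rows with \<open>\<bar>v\<bar> < K\<close> have the signs \<open>l\<close> of a base pattern, and \<open>X\<close> contains the row of the
  center if there is one. From index \<open>K - 1\<close> on, the two rows of a pair have opposite signs, as they do
  in the base pattern; so either both signs agree with the base pattern or both differ from it, and \<open>A\<close>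
  collects the pairs that differ.\<close>

lemma rows_as_flips:
  assumes b: "b = 1 \<or> b = -1" and K: "K > 0"
    and pure: "\<And>v. \<bar>v\<bar> \<le> N \<Longrightarrow> v \<notin> X \<Longrightarrow> \<exists>c. pure_row v c"
    and X: "\<And>v. v \<in> X \<Longrightarrow> \<bar>v\<bar> < K - 1"
    and base: "\<And>v. \<bar>v\<bar> \<le> N \<Longrightarrow> v \<notin> X \<Longrightarrow> l v = 1 \<or> l v = -1"
    and base2: "\<And>i. K - 1 \<le> i \<Longrightarrow> i < N \<Longrightarrow> l (inner_line N b i) = - l (outer_line N b i)"
    and col: "\<And>i. K - 1 \<le> i \<Longrightarrow> i < N \<Longrightarrow> \<exists>u. diamond N u (outer_line N b i) \<and> pure_col u (b * psign (N + outer_line N b i))"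
    and low: "\<And>v. \<bar>v\<bar> \<le> N \<Longrightarrow> v \<notin> X \<Longrightarrow> \<bar>v\<bar> < K \<Longrightarrow> pure_row v (l v)"
    and col0: "K \<le> N \<Longrightarrow> pure_col 0 b"
  shows "\<exists>A\<subseteq>{K..N - 1}. \<forall>v. \<bar>v\<bar> \<le> N \<longrightarrow> v \<notin> X \<longrightarrow> pure_row v (l v * flip A (pair_index N b v))"
proof -
  define A where "A = {i \<in> {K..N - 1}. \<not> pure_row (outer_line N b i) (l (outer_line N b i))}"
  have pair: "\<exists>c. pure_row (outer_line N b i) c \<and> pure_row (inner_line N b i) (- c)" if i: "K - 1 \<le> i" "i < N" for i
  proof -
    have i0: "i \<ge> 0" using i K by simp
    note of = pair_lines[OF b i0, of N]
    have "outer_line N b i \<notin> X" "inner_line N b i \<notin> X" using X of(1,2) i by force+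
    then obtain c c' where c: "pure_row (outer_line N b i) c" "pure_row (inner_line N b i) c'" using pure of(1,2) i by fastforce
    obtain u where "diamond N u (outer_line N b i)" "pure_col u (b * psign (N + outer_line N b i))" using col i by blast
    then have "c' = - c" using pair_sign[OF c(1)] c(2) of(5,6) by auto
    then show ?thesis using c by blast
  qed
  have pmneg: "c = l' \<or> c = - l'" if "pure_row v c" "l' = 1 \<or> l' = -1" for v c l'
    using pure_row_pm[OF that(1)] that(2) by auto
  have "pure_row v (l v * flip A (pair_index N b v))" if v: "\<bar>v\<bar> \<le> N" "v \<notin> X" for v
  proof -
    define i where "i = pair_index N b v"
    have iv: "i \<le> \<bar>v\<bar>" "\<bar>v\<bar> - 1 \<le> i" using pair_index_le(1)[of N b v] pair_index_le(2)[of v N b] by (auto simp: i_def)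
    show ?thesis
    proof (cases "\<bar>v\<bar> < K")
      case True
      then have "i \<notin> A" using iv by (auto simp: A_def)
      then show ?thesis using low[OF v True] by (simp add: flip_def i_def)
    next
      case False
      then have iK: "i \<ge> K - 1" "i \<ge> 0" using iv K by auto
      note of = pair_lines[OF b iK(2), of N]
      show ?thesis
      proof (cases "i < N")
        case True
        obtain c where c: "pure_row (outer_line N b i) c" "pure_row (inner_line N b i) (- c)" using pair iK(1) True by blast
        have lo: "l (outer_line N b i) = 1 \<or> l (outer_line N b i) = -1"
          by (rule base) (use of(1) True X[of "outer_line N b i"] iK in auto)
        note li = base2[OF iK(1) True]
        have vv: "v = outer_line N b i \<or> v = inner_line N b i" using pair_index_cases[OF b] iK(2) i_def by blast
        have cl: "c = l (outer_line N b i) * flip A i"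
        proof (cases "i = K - 1")
          \<comment> \<open>This pair straddles the bound: its inner row has the base sign, hence so has its outer row.\<close>
          case True
          then have "i \<notin> A" by (auto simp: A_def)
          have "pure_row (inner_line N b i) (l (inner_line N b i))"
            by (rule low) (use of(2) True X[of "inner_line N b i"] \<open>i < N\<close> K in auto)
          moreover obtain u where u: "diamond N u (outer_line N b i)" "pure_col u (b * psign (N + outer_line N b i))" using col iK(1) \<open>i < N\<close> by blast
          ultimately have "l (inner_line N b i) = - c" by (intro pair_sign[OF c(1) _ u(2,1) of(6)]) (simp add: of(5)[symmetric])
          then show ?thesis using li \<open>i \<notin> A\<close> by (simp add: flip_def)
        next
          case False
          show ?thesis
          proof (cases "i \<in> A")
            case True
            then have "c \<noteq> l (outer_line N b i)" using c(1) by (auto simp: A_def)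
            then show ?thesis using pmneg[OF c(1) lo] True by (simp add: flip_def)
          next
            case False
            then have pr: "pure_row (outer_line N b i) (l (outer_line N b i))" using \<open>i \<noteq> K - 1\<close> iK \<open>i < N\<close> by (auto simp: A_def)
            obtain u where u: "diamond N u (outer_line N b i)" "pure_col u (b * psign (N + outer_line N b i))" using col iK(1) \<open>i < N\<close> by blast
            have "- c = - l (outer_line N b i)" by (rule pair_sign[OF pr _ u(2,1) of(6)]) (use c(2) of(5) in simp)
            then have "l (outer_line N b i) = c" by simp
            then show ?thesis using False by (simp add: flip_def)
          qed
        qed
        show ?thesis using vv
        proof
          assume "v = outer_line N b i"
          then show ?thesis using c(1) cl i_def by simp
        next
          assume "v = inner_line N b i"
          then show ?thesis using c(2) cl i_def li by simp
        qed
      next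
        case False
        \<comment> \<open>The row is a single cell. It is a monomer, as its column points out of the diamond, and hence
          it is pure with either sign.\<close>
        then have iN: "i = N" "\<bar>v\<bar> = N" using iv v by auto
        then have "i \<notin> A" by (auto simp: A_def)
        have KN: "K \<le> N" using \<open>\<not> \<bar>v\<bar> < K\<close> iN by simp
        have vb: "v = b * psign (N + v) * N" using iN i_def by (auto simp: pair_index_def split: if_splits)
        have "psign (N + v) = 1" using iN(2) by (auto simp: psign_def abs_if split: if_splits)
        then have vN: "v = b * N" using vb by simp
        have D: "diamond N u v \<longleftrightarrow> u = 0" for u using iN(2) by (auto simp: diamond_def abs_if split: if_splits)
        have "p 0 v = 0"
        proof (rule ccontr)
          assume "p 0 v \<noteq> 0"
          moreover have "r 0 v = b" using pure_col_r[OF col0[OF KN], of v] D zero_iff calculation by blast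
          ultimately have "diamond N (p 0 v) (v + b)" using partner(1)[of 0 v] by simp
          moreover have "\<bar>v + b\<bar> > N" using vN b KN K by auto
          ultimately show False unfolding diamond_def by linarith
        qed
        moreover have "l v * flip A i = 1 \<or> l v * flip A i = -1" using base[OF v] \<open>i \<notin> A\<close> by (simp add: flip_def)
        ultimately show ?thesis using D iN by (auto simp: pure_row_def i_def)
      qed
    qed
  qed
  then show ?thesis by (intro exI[of _ A]) (auto simp: A_def)
qed

end

lemma diamond_edge: "\<bar>v\<bar> \<le> N \<Longrightarrow> diamond N (N - \<bar>v\<bar>) v"
  by (cases "v \<ge> 0") (auto simp: diamond_def)

context tatami_field begin

text \<open>Such a row crosses the ray that runs from the center in column \<open>u0\<close>, in one of the two adjacent columns
  that make up this ray, and the move at the crossing determines its sign.\<close>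

lemma row_sign:
  assumes sp: "spin x u0 v0" and v: "v \<noteq> v0" "\<bar>u0\<bar> + \<bar>v\<bar> \<le> N" and pr: "pure_row v c"
  shows "c = x * psign (N + v) * sgn (v - v0)"
proof -
  have x: "x = 1 \<or> x = -1" using sp by (simp add: spin_def)
  \<comment> \<open>The parity of \<open>v\<close> decides which of the two columns of the ray meets the row in a cell.\<close>
  define e where "e = (if diamond N u0 v then 0 else x * psign u0 * sgn (v0 - v))"
  have "e = 0 \<or> e = 1 \<or> e = -1" using x psign_cases[of u0] by (auto simp: e_def sgn_if)
  have D: "diamond N (u0 + e) v"
  proof (cases "diamond N u0 v")
    case False
    then have "odd (u0 + v + N)" using v by (auto simp: diamond_def)
    moreover have "e = 1 \<or> e = -1" using False x psign_cases[of u0] v(1) by (auto simp: e_def sgn_if)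
    moreover have "\<bar>u0\<bar> + \<bar>v\<bar> < N"
      using v(2) \<open>odd (u0 + v + N)\<close> by (auto simp: abs_if order_less_le split: if_splits)
    ultimately show ?thesis unfolding diamond_def by auto
  qed (simp add: e_def)
  have R: "pinwheel_r x u0 v0 (u0 + e) v = sgn (v0 - v)"
    using x psign_cases[of u0] v(1) by (auto simp: pinwheel_r_def e_def sgn_if)
  have "p (u0 + e) v = pinwheel_p x u0 v0 (u0 + e) v"
    using col_ray[OF sp D v(1) _ R] \<open>e = 0 \<or> e = 1 \<or> e = -1\<close> by auto
  also have "\<dots> = x * psign (N + v) * sgn (v - v0)" using v(1) diamond_psign[OF D] by (simp add: pinwheel_p_def)
  finally have "p (u0 + e) v = x * psign (N + v) * sgn (v - v0)" .
  moreover from this have "p (u0 + e) v \<noteq> 0" using x psign_cases[of "N + v"] v(1) by (auto simp: sgn_if)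
  ultimately show ?thesis using pure_row_p[OF pr D] by simp
qed

lemma col_sign:
  assumes sp: "spin x u0 v0" and u: "u \<noteq> u0" "\<bar>u\<bar> + \<bar>v0\<bar> \<le> N" and pr: "pure_col u c"
  shows "c = - x * psign u * sgn (u - u0)"
proof -
  have "c = - x * psign N * psign (N + u) * sgn (u - u0)"
    using tatami_field.row_sign[OF swap swap_spin[OF sp] u(1), of c] u(2) pr swap_pure by (simp add: add.commute)
  moreover have "- x * psign N * psign (N + u) = - x * psign u" by (simp add: psign_def)
  ultimately show ?thesis by (simp only:)
qed

lemma center_pure_row: "center u0 v0 \<Longrightarrow> v \<noteq> v0 \<Longrightarrow> \<bar>v\<bar> \<le> N \<Longrightarrow> \<exists>c. pure_row v c"
  using row_dichotomy center_unique by blast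
lemma center_pure_col: "center u0 v0 \<Longrightarrow> u \<noteq> u0 \<Longrightarrow> \<bar>u\<bar> \<le> N \<Longrightarrow> \<exists>c. pure_col u c"
  using col_dichotomy center_unique by blast

lemma center_rows:
  assumes sp: "spin x u0 v0"
  shows "\<exists>A\<subseteq>{N - \<bar>u0\<bar> + 1..N - 1}. \<forall>v. \<bar>v\<bar> \<le> N \<longrightarrow> v \<noteq> v0 \<longrightarrow>
     pure_row v (x * psign (N + v) * sgn (v - v0) * flip A (pair_index N (x * sgn u0) v))"
proof -
  have x: "x = 1 \<or> x = -1" and c: "center u0 v0" using sp by (simp_all add: spin_def)
  have lt: "\<bar>u0\<bar> + \<bar>v0\<bar> < N" using c by (simp add: center_def)
  define b where "b = (if u0 = 0 then 1 else x * sgn u0)"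
  have b: "b = 1 \<or> b = -1" using x by (auto simp: b_def sgn_if)
  have low: "pure_row v (x * psign (N + v) * sgn (v - v0))" if v: "v \<noteq> v0" "\<bar>u0\<bar> + \<bar>v\<bar> \<le> N" for v
  proof -
    have "\<bar>v\<bar> \<le> N" using v(2) by linarith
    then obtain d where "pure_row v d" using center_pure_row[OF c v(1)] by blast
    then show ?thesis using row_sign[OF sp v] by blast
  qed
  have colb: "pure_col u (b * psign u)" if "\<bar>u\<bar> < \<bar>u0\<bar>" for u
  proof -
    have "u \<noteq> u0" "\<bar>u\<bar> + \<bar>v0\<bar> \<le> N" using that lt by auto
    then obtain d where d: "pure_col u d" using center_pure_col[OF c, of u] by force
    have "d = - x * psign u * sgn (u - u0)" using col_sign[OF sp \<open>u \<noteq> u0\<close> _ d] \<open>\<bar>u\<bar> + \<bar>v0\<bar> \<le> N\<close> by blast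
    also have "sgn (u - u0) = - sgn u0" using that by (auto simp: sgn_if)
    finally have "d = b * psign u" using that by (auto simp: b_def)
    then show ?thesis using d by simp
  qed
  have "\<exists>A\<subseteq>{N - \<bar>u0\<bar> + 1..N - 1}. \<forall>v. \<bar>v\<bar> \<le> N \<longrightarrow> v \<notin> {v0} \<longrightarrow>
     pure_row v (x * psign (N + v) * sgn (v - v0) * flip A (pair_index N b v))"
  proof (rule rows_as_flips[OF b, where X = "{v0}"])
    show "0 < N - \<bar>u0\<bar> + 1" using lt by linarith
    show "\<exists>c. pure_row v c" if "\<bar>v\<bar> \<le> N" "v \<notin> {v0}" for v using center_pure_row[OF c] that by blast
    show "\<bar>v\<bar> < N - \<bar>u0\<bar> + 1 - 1" if "v \<in> {v0}" for v using that lt by simp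
    show "x * psign (N + v) * sgn (v - v0) = 1 \<or> x * psign (N + v) * sgn (v - v0) = - 1" if "\<bar>v\<bar> \<le> N" "v \<notin> {v0}" for v
      using x psign_cases[of "N + v"] that by (auto simp: sgn_if)
    show "pure_row v (x * psign (N + v) * sgn (v - v0))" if "\<bar>v\<bar> \<le> N" "v \<notin> {v0}" "\<bar>v\<bar> < N - \<bar>u0\<bar> + 1" for v
      using low[of v] that by simp
    show "pure_col 0 b" if "N - \<bar>u0\<bar> + 1 \<le> N"
      using colb[of 0] that by simp
    fix i assume i: "N - \<bar>u0\<bar> + 1 - 1 \<le> i" "i < N"
    then have i0: "i \<ge> 0" "\<bar>v0\<bar> < i" using lt by auto
    note of = pair_lines[OF b i0(1), of N]
    have "sgn (inner_line N b i - v0) = sgn (outer_line N b i - v0)"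
    proof -
      have "sgn (w - v0) = sgn w" if "\<bar>v0\<bar> < \<bar>w\<bar>" for w using that by (auto simp: sgn_if)
      moreover have "sgn (inner_line N b i) = sgn (outer_line N b i)"
        using i0 by (simp add: inner_line_def outer_line_def sgn_mult)
      ultimately show ?thesis using of(1,2) i0 by auto
    qed
    moreover have "psign (N + inner_line N b i) = - psign (N + outer_line N b i)" using of(7) by (auto simp: psign_def split: if_splits)
    ultimately show "x * psign (N + inner_line N b i) * sgn (inner_line N b i - v0) = - (x * psign (N + outer_line N b i) * sgn (outer_line N b i - v0))"
      by simp
    show "\<exists>u. diamond N u (outer_line N b i) \<and> pure_col u (b * psign (N + outer_line N b i))"
    proof -
      define u where "u = N - \<bar>outer_line N b i\<bar>"
      have "diamond N u (outer_line N b i)" unfolding u_def by (rule diamond_edge) (use of(1) i in simp)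
      moreover have "\<bar>u\<bar> < \<bar>u0\<bar>" using of(1) i by (auto simp: u_def)
      ultimately show ?thesis using colb[of u] diamond_psign by metis
    qed
  qed
  moreover have "u0 \<noteq> 0" if "i \<in> A" "A \<subseteq> {N - \<bar>u0\<bar> + 1..N - 1}" for i A using that by auto
  then have "flip A (pair_index N b v) = flip A (pair_index N (x * sgn u0) v)" if "A \<subseteq> {N - \<bar>u0\<bar> + 1..N - 1}" for A v
    using that by (cases "u0 = 0") (auto simp: flip_def b_def)
  ultimately show ?thesis by (metis (no_types, lifting) singletonD)
qed

lemma center_cols:
  assumes sp: "spin x u0 v0"
  shows "\<exists>B\<subseteq>{N - \<bar>v0\<bar> + 1..N - 1}. \<forall>u. \<bar>u\<bar> \<le> N \<longrightarrow> u \<noteq> u0 \<longrightarrow>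
     pure_col u (- x * psign u * sgn (u - u0) * flip B (pair_index N (- x * psign N * sgn v0) u))"
proof -
  have "- x * psign N * psign (N + u) = - x * psign u" for u by (simp add: psign_def)
  then show ?thesis using tatami_field.center_rows[OF swap swap_spin[OF sp]] unfolding swap_pure by (simp only:)
qed

theorem center_data:
  assumes sp: "spin x u0 v0"
  shows "\<exists>A\<subseteq>{N - \<bar>u0\<bar> + 1..N - 1}. \<exists>B\<subseteq>{N - \<bar>v0\<bar> + 1..N - 1}.
     p = trim_p N (flipped_pinwheel_p N x u0 v0 A) (flipped_pinwheel_r N x u0 v0 B) \<and> r = trim_r N (flipped_pinwheel_p N x u0 v0 A) (flipped_pinwheel_r N x u0 v0 B)"
proof -
  have x: "x = 1 \<or> x = -1" and c: "center u0 v0" using sp by (simp_all add: spin_def)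
  have lt: "\<bar>u0\<bar> + \<bar>v0\<bar> < N" using c by (simp add: center_def)
  obtain A where A: "A \<subseteq> {N - \<bar>u0\<bar> + 1..N - 1}" "\<And>v. \<bar>v\<bar> \<le> N \<Longrightarrow> v \<noteq> v0 \<Longrightarrow>
     pure_row v (x * psign (N + v) * sgn (v - v0) * flip A (pair_index N (x * sgn u0) v))"
    using center_rows[OF sp] by blast
  obtain B where B: "B \<subseteq> {N - \<bar>v0\<bar> + 1..N - 1}" "\<And>u. \<bar>u\<bar> \<le> N \<Longrightarrow> u \<noteq> u0 \<Longrightarrow>
     pure_col u (- x * psign u * sgn (u - u0) * flip B (pair_index N (- x * psign N * sgn v0) u))"
    using center_cols[OF sp] by blast
  let ?P = "flipped_pinwheel_p N x u0 v0 A" and ?R = "flipped_pinwheel_r N x u0 v0 B"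
  have row: "pure_row v (?P u v)" if "diamond N u v" "v \<noteq> v0" for u v
  proof -
    have "\<bar>v\<bar> \<le> N" using that(1) unfolding diamond_def by linarith
    then show ?thesis using A(2)[of v] that(2) diamond_psign[OF that(1)] by (simp add: flipped_pinwheel_p_def pinwheel_p_def)
  qed
  have col: "pure_col u (?R u v)" if "diamond N u v" "u \<noteq> u0" for u v
  proof -
    have "\<bar>u\<bar> \<le> N" using that(1) unfolding diamond_def by linarith
    then show ?thesis using B(2)[of u] that(2) by (simp add: flipped_pinwheel_r_def pinwheel_r_def)
  qed
  have row0: "?P u v0 = p u v0" if "diamond N u v0" for u
  proof -
    have "pair_index N (x * sgn u0) v0 \<notin> A" using A(1) pair_index_le(1)[of N "x * sgn u0" v0] lt by force
    then show ?thesis using center_row[OF c that] by (simp add: flipped_pinwheel_p_def pinwheel_p_def flip_def)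
  qed
  have col0: "?R u0 v = r u0 v" if "diamond N u0 v" for v
  proof -
    have "pair_index N (- x * psign N * sgn v0) u0 \<notin> B" using B(1) pair_index_le(1)[of N "- x * psign N * sgn v0" u0] lt by force
    then show ?thesis using center_col[OF c that] by (simp add: flipped_pinwheel_r_def pinwheel_r_def flip_def)
  qed
  have "p = trim_p N ?P ?R \<and> r = trim_r N ?P ?R"
  proof (rule eq_trim)
    fix u v assume D: "diamond N u v" and p: "p u v \<noteq> 0"
    then have r: "r u v \<noteq> 0" using zero_iff by blast
    show "p u v = ?P u v \<and> r u v = ?R u v"
    proof
      show "p u v = ?P u v" using row0 D pure_row_p[OF row D p, of u] by (cases "v = v0") auto
      show "r u v = ?R u v" using col0 D pure_col_r[OF col D r, of v] by (cases "u = u0") auto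
    qed
  next
    fix u v assume D: "diamond N u v" and p: "p u v = 0"
    then have r: "r u v = 0" using zero_iff by blast
    show "\<not> diamond N (u + ?P u v) (v + ?R u v) \<or> ?P u v = 0 \<and> ?R u v = 0"
    proof (cases "u = u0 \<or> v = v0")
      case True
      then have "u = u0 \<and> v = v0" using center_row[OF c] center_col[OF c] D p r by (auto simp: sgn_if split: if_splits)
      then show ?thesis using row0 col0 D p r by auto
    next
      case False
      then have rc: "pure_row v (?P u v)" "pure_col u (?R u v)" using row col D by auto
      have "\<not> diamond N (u + ?P u v) (v + ?R u v)"
        by (rule corner_out[OF pure_row_pm[OF rc(1)] pure_col_pm[OF rc(2)] _ pure_row_0[OF rc(1) D p] pure_col_0[OF rc(2) D r]])
          (use D in \<open>simp add: diamond_def\<close>)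
      then show ?thesis by blast
    qed
  qed
  then show ?thesis using A(1) B(1) by blast
qed

lemma no_center_pure_row: "(\<And>u v. \<not> center u v) \<Longrightarrow> \<bar>v\<bar> \<le> N \<Longrightarrow> \<exists>c. pure_row v c"
  using row_dichotomy by blast
lemma no_center_pure_col: "(\<And>u v. \<not> center u v) \<Longrightarrow> \<bar>u\<bar> \<le> N \<Longrightarrow> \<exists>c. pure_col u c"
  using col_dichotomy by blast

text \<open>Near the axis \<open>u = 0\<close> there are columns of both parities with the standard signs, namely column \<open>0\<close>
  and one of its neighbours. Together they meet every row, and they force the two rows of each pair to
  have opposite signs.\<close>

lemma brick_rows:
  assumes nc: "\<And>u v. \<not> center u v" and N: "N \<ge> 1" and a: "pure_row 0 a" and b: "pure_col 0 b"
  shows "\<exists>A\<subseteq>{1..N - 1}. \<forall>v. \<bar>v\<bar> \<le> N \<longrightarrow> pure_row v (a * psign v * flip A (pair_index N b v))"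
proof -
  note a1 = pure_row_pm[OF a] and b1 = pure_col_pm[OF b]
  have "\<exists>w. \<bar>w\<bar> = 1 \<and> pure_col w (- b)"
  proof -
    \<comment> \<open>A cell of row \<open>0\<close> such that it or its partner lies in column \<open>0\<close>.\<close>
    define z where "z = (if even N then 0 else - a)"
    have D: "diamond N z 0" using N a1 by (auto simp: z_def diamond_def)
    have "p z 0 \<noteq> 0" using pure_row_0[OF a D] a1 N by (auto simp: z_def split: if_splits)
    then have pz: "p z 0 = a" "r z 0 \<noteq> 0" using pure_row_p[OF a D] zero_iff by auto
    have t: "diamond N (z + a) (r z 0)" "r (z + a) (r z 0) = - r z 0" using partner[of z 0] pz a1 by auto
    show ?thesis
    proof (cases "even N")
      case True
      then have z: "z = 0" by (simp add: z_def)
      have "r 0 0 = b" using pure_col_r[OF b, of 0] D pz z by simp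
      then have t': "diamond N a b" "r a b = - b" using t z by auto
      obtain d where d: "pure_col a d" using no_center_pure_col[OF nc, of a] a1 N by auto
      then have "d = - b" using pure_col_r[OF d t'(1)] t'(2) b1 by auto
      then show ?thesis using d a1 by (intro exI[of _ a]) auto
    next
      case False
      then have z: "z = - a" by (simp add: z_def)
      have "- r z 0 = b" using pure_col_r[OF b, of "r z 0"] t z pz by auto
      moreover obtain d where d: "pure_col z d" using no_center_pure_col[OF nc, of z] a1 N z by auto
      ultimately have "d = - b" using pure_col_r[OF d D] pz by auto
      then show ?thesis using d a1 z by (intro exI[of _ z]) auto
    qed
  qed
  then obtain w where w: "\<bar>w\<bar> = 1" "pure_col w (- b)" by blast
  have "\<exists>A\<subseteq>{1..N - 1}. \<forall>v. \<bar>v\<bar> \<le> N \<longrightarrow> v \<notin> {} \<longrightarrow> pure_row v (a * psign v * flip A (pair_index N b v))"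
  proof (rule rows_as_flips[OF b1])
    show "\<exists>c. pure_row v c" if "\<bar>v\<bar> \<le> N" for v using no_center_pure_row[OF nc] that by blast
    show "a * psign v = 1 \<or> a * psign v = - 1" for v using a1 psign_cases[of v] by auto
    show "pure_row v (a * psign v)" if "\<bar>v\<bar> < 1" for v using a that by simp
    show "pure_col 0 b" by (rule b)
    fix i :: int assume i: "1 - 1 \<le> i" "i < N"
    note of = pair_lines[OF b1, of i N]
    show "a * psign (inner_line N b i) = - (a * psign (outer_line N b i))" using of i by simp
    show "\<exists>u. diamond N u (outer_line N b i) \<and> pure_col u (b * psign (N + outer_line N b i))"
    proof (cases "even (N + outer_line N b i)")
      case True
      then have "diamond N 0 (outer_line N b i)" using of i by (auto simp: diamond_def)
      then show ?thesis using b True by (auto simp: psign_def)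
    next
      case False
      have "\<bar>outer_line N b i\<bar> \<noteq> N"
      proof
        assume "\<bar>outer_line N b i\<bar> = N"
        then have "outer_line N b i = N \<or> outer_line N b i = - N" by linarith
        then show False using False by auto
      qed
      then have "\<bar>outer_line N b i\<bar> < N" using of(1) i by auto
      moreover have "odd w" using w(1) by (auto simp: abs_if split: if_splits)
      ultimately have "diamond N w (outer_line N b i)" using w(1) False by (auto simp: diamond_def)
      then show ?thesis using w(2) False by (intro exI[of _ w]) (auto simp: psign_def)
    qed
  qed simp_all
  then show ?thesis by blast
qed

lemma brick_cols:
  assumes nc: "\<And>u v. \<not> center u v" and N: "N \<ge> 1" and a: "pure_row 0 a" and b: "pure_col 0 b"
  shows "\<exists>B\<subseteq>{1..N - 1}. \<forall>u. \<bar>u\<bar> \<le> N \<longrightarrow> pure_col u (b * psign u * flip B (pair_index N a u))"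
proof -
  have "tatami_field.pure_col N (\<lambda>u v. p v u) 0 a"
    using a unfolding tatami_field.pure_col_def[OF swap] pure_row_def by (simp add: diamond_swap[of N])
  then show ?thesis
    using tatami_field.brick_rows[OF swap, of b a] N b nc unfolding swap_pure swap_center by blast
qed

end

lemma line_before_inner:
  fixes N b i :: int
  assumes b: "b = 1 \<or> b = -1" and i: "i \<ge> 1"
  defines "e \<equiv> b * psign (N + i)"
  shows "\<bar>inner_line N b i - e\<bar> = i - 1" "pair_index N b (inner_line N b i - e) < i" "psign (inner_line N b i - e) = - psign (inner_line N b i)"
    "psign (inner_line N b i) = psign i" "e = 1 \<or> e = -1" "inner_line N b i = e * i"
proof -
  show e: "e = 1 \<or> e = -1" using b psign_cases[of "N + i"] by (auto simp: e_def)
  show n: "inner_line N b i = e * i" by (simp add: inner_line_def e_def)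
  show 1: "\<bar>inner_line N b i - e\<bar> = i - 1" using e i unfolding n by auto
  show "pair_index N b (inner_line N b i - e) < i" using pair_index_le(1)[of N b "inner_line N b i - e"] 1 by linarith
  show "psign (inner_line N b i - e) = - psign (inner_line N b i)" using e by auto
  show "psign (inner_line N b i) = psign i" unfolding n using psign_scale[OF e, of 0 i] by simp
qed

context tatami_field begin

text \<open>Let \<open>i\<close> and \<open>j\<close> be the least flipped indices. Then the inner row \<open>v\<close> of pair \<open>i\<close> and the row \<open>v - e\<close>
  before it have the same sign, and so do the columns \<open>u\<close> and \<open>u - f\<close>. A cell at the crossing of these
  lines moves from one of the two columns into the other one, or from one of the two rows into the
  other one, although partners have opposite signs. If \<open>i + j \<le> N\<close>, such a cell exists and is not a
  monomer.\<close>

lemma no_crossing: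
  assumes a: "a = 1 \<or> a = -1" and b: "b = 1 \<or> b = -1"
    and rows: "\<And>v. \<bar>v\<bar> \<le> N \<Longrightarrow> pure_row v (a * psign v * flip A (pair_index N b v))"
    and cols: "\<And>u. \<bar>u\<bar> \<le> N \<Longrightarrow> pure_col u (b * psign u * flip B (pair_index N a u))"
    and i: "i \<in> A" "\<And>k. k \<in> A \<Longrightarrow> i \<le> k" "1 \<le> i" and j: "j \<in> B" "\<And>k. k \<in> B \<Longrightarrow> j \<le> k" "1 \<le> j"
  shows "i + j > N"
proof (rule ccontr)
  assume "\<not> ?thesis"
  then have ij: "i + j \<le> N" by simp
  define e where "e = b * psign (N + i)"
  define f where "f = a * psign (N + j)"
  define v where "v = inner_line N b i"
  define u where "u = inner_line N a j"
  note V = line_before_inner[OF b i(3), of N, folded e_def v_def]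
  note U = line_before_inner[OF a j(3), of N, folded f_def u_def]
  have iv: "\<bar>v\<bar> = i" "pair_index N b v = i" using pair_lines(2,4)[OF b, of i N] i(3) by (auto simp: v_def)
  have ju: "\<bar>u\<bar> = j" "pair_index N a u = j" using pair_lines(2,4)[OF a, of j N] j(3) by (auto simp: u_def)
  have vin: "pair_index N b (v - e) \<notin> A" and uin: "pair_index N a (u - f) \<notin> B" using V(2) U(2) i(2) j(2) by force+
  have r1: "pure_row v (- a * psign i)" using rows[of v] iv i j ij V(4) by (simp add: flip_def)
  have r2: "pure_row (v - e) (- a * psign i)" using rows[of "v - e"] vin V i j ij by (simp add: flip_def)
  have c1: "pure_col u (- b * psign j)" using cols[of u] ju i j ij U(4) by (simp add: flip_def)
  have c2: "pure_col (u - f) (- b * psign j)" using cols[of "u - f"] uin U i j ij by (simp add: flip_def)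
  have ui: "\<bar>u - f\<bar> = j - 1" using U by simp
  show False
  proof (cases "even (i + j + N)")
    case True
    \<comment> \<open>The cell \<open>(u, v)\<close> moves to \<open>(u - f, v - e)\<close>.\<close>
    have "even (u + v) \<longleftrightarrow> even (i + j)" using iv(1) ju(1) by (auto simp: abs_if split: if_splits)
    then have D: "diamond N u v" using True ij iv ju unfolding diamond_def by simp
    have s: "- a * psign i = - f" "- b * psign j = - e" using True by (auto simp: e_def f_def psign_def)
    have "p u v \<noteq> 0"
    proof
      assume "p u v = 0"
      then have "u = - f * (N - \<bar>v\<bar>)" using pure_row_0[OF r1 D] s by simp
      then show False using U(5,6) iv j(3) ij by auto
    qed
    then have "p u v = - f" "r u v = - e" using pure_row_p[OF r1 D] pure_col_r[OF c1 D] zero_iff s by auto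
    then have "diamond N (u - f) (v - e)" "p (u - f) (v - e) = f" using partner[OF \<open>p u v \<noteq> 0\<close>] by auto
    then show False using pure_row_p[OF r2, of "u - f"] U(5) s by auto
  next
    case False
    \<comment> \<open>The cell \<open>(u - f, v)\<close> moves to \<open>(u, v + e)\<close>.\<close>
    have "even (u + v) \<longleftrightarrow> even (i + j)" using iv(1) ju(1) by (auto simp: abs_if split: if_splits)
    then have D: "diamond N (u - f) v" using False ij iv ui U(5) unfolding diamond_def by auto
    have s: "- a * psign i = f" "- b * psign j = e" using False by (auto simp: e_def f_def psign_def)
    have "p (u - f) v \<noteq> 0"
    proof
      assume "p (u - f) v = 0"
      then have "u - f = f * (N - \<bar>v\<bar>)" by (rule pure_row_0[OF r1[unfolded s(1)] D])
      then have "\<bar>u - f\<bar> = N - i" using U(5) iv(1) ij j(3) by auto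
      then show False using ui ij by simp
    qed
    then have "p (u - f) v = f" "r (u - f) v = e" using pure_row_p[OF r1 D] pure_col_r[OF c2 D] zero_iff s by auto
    then have "diamond N u (v + e)" "r u (v + e) = - e" using partner[OF \<open>p (u - f) v \<noteq> 0\<close>] by auto
    then show False using pure_col_r[OF c1, of "v + e"] V(5) s by auto
  qed
qed

theorem brick_data:
  assumes nc: "\<And>u v. \<not> center u v" and N: "N \<ge> 1"
  shows "\<exists>a b A B. (a = 1 \<or> a = -1) \<and> (b = 1 \<or> b = -1) \<and> A \<subseteq> {1..N - 1} \<and> B \<subseteq> {1..N - 1} \<and>
     (\<forall>i\<in>A. \<forall>j\<in>B. i + j > N) \<and>
     p = trim_p N (flipped_bricks_p N a b A) (flipped_bricks_r N a b B) \<and> r = trim_r N (flipped_bricks_p N a b A) (flipped_bricks_r N a b B)"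
proof -
  obtain a where a: "pure_row 0 a" using no_center_pure_row[OF nc, of 0] N by auto
  obtain b where b: "pure_col 0 b" using no_center_pure_col[OF nc, of 0] N by auto
  obtain A where A: "A \<subseteq> {1..N - 1}" and rows: "\<And>v. \<bar>v\<bar> \<le> N \<Longrightarrow> pure_row v (a * psign v * flip A (pair_index N b v))"
    using brick_rows[OF nc N a b] by blast
  obtain B where B: "B \<subseteq> {1..N - 1}" and cols: "\<And>u. \<bar>u\<bar> \<le> N \<Longrightarrow> pure_col u (b * psign u * flip B (pair_index N a u))"
    using brick_cols[OF nc N a b] by blast
  have ab: "a = 1 \<or> a = -1" "b = 1 \<or> b = -1" using pure_row_pm[OF a] pure_col_pm[OF b] .
  have cross: "i + j > N" if ij: "i \<in> A" "j \<in> B" for i j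
  proof -
    have fin: "finite A" "finite B" using A B finite_subset by blast+
    have ne: "A \<noteq> {}" "B \<noteq> {}" using ij by auto
    have "Min A + Min B > N"
      by (rule no_crossing[OF ab rows cols Min_in[OF fin(1) ne(1)] Min_le[OF fin(1)] _ Min_in[OF fin(2) ne(2)] Min_le[OF fin(2)]])
        (use A B Min_in[OF fin(1) ne(1)] Min_in[OF fin(2) ne(2)] in auto)
    then show ?thesis using Min_le[OF fin(1) ij(1)] Min_le[OF fin(2) ij(2)] by linarith
  qed
  let ?P = "flipped_bricks_p N a b A" and ?R = "flipped_bricks_r N a b B"
  have row: "pure_row v (?P u v)" and col: "pure_col u (?R u v)" if "diamond N u v" for u v
  proof -
    have "\<bar>v\<bar> \<le> N" "\<bar>u\<bar> \<le> N" using that unfolding diamond_def by linarith+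
    then show "pure_row v (?P u v)" "pure_col u (?R u v)" using rows[of v] cols[of u] by (simp_all add: flipped_bricks_p_def flipped_bricks_r_def)
  qed
  have pr: "p = trim_p N ?P ?R \<and> r = trim_r N ?P ?R"
  proof (rule eq_trim)
    fix u v assume D: "diamond N u v" and p: "p u v \<noteq> 0"
    then have r: "r u v \<noteq> 0" using zero_iff by blast
    show "p u v = ?P u v \<and> r u v = ?R u v"
      using pure_row_p[OF row D p] pure_col_r[OF col D r] D by blast
  next
    fix u v assume D: "diamond N u v" and p: "p u v = 0"
    then have r: "r u v = 0" using zero_iff by blast
    note rc = row[OF D] col[OF D]
    have "\<not> diamond N (u + ?P u v) (v + ?R u v)"
      by (rule corner_out[OF pure_row_pm[OF rc(1)] pure_col_pm[OF rc(2)] _ pure_row_0[OF rc(1) D p] pure_col_0[OF rc(2) D r]])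
        (use D in \<open>simp add: diamond_def\<close>)
    then show "\<not> diamond N (u + ?P u v) (v + ?R u v) \<or> ?P u v = 0 \<and> ?R u v = 0" by blast
  qed
  show ?thesis
    by (rule exI[of _ a], rule exI[of _ b], rule exI[of _ A], rule exI[of _ B])
      (intro conjI ballI ab A B cross conjunct1[OF pr] conjunct2[OF pr])
qed

end

section \<open>The parametrisation of tatami fields\<close>

definition brick_fields where
  "brick_fields N = (\<lambda>(a, b, A, B). (trim_p N (flipped_bricks_p N a b A) (flipped_bricks_r N a b B), trim_r N (flipped_bricks_p N a b A) (flipped_bricks_r N a b B)))"
definition pinwheel_fields where
  "pinwheel_fields N = (\<lambda>((x, u0, v0), A, B). (trim_p N (flipped_pinwheel_p N x u0 v0 A) (flipped_pinwheel_r N x u0 v0 B), trim_r N (flipped_pinwheel_p N x u0 v0 A) (flipped_pinwheel_r N x u0 v0 B)))"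

text \<open>The pair with index \<open>0\<close> is not flipped because it carries the signs \<open>a\<close> and \<open>b\<close> of the pattern. Of the pair
  with index \<open>N\<close> the diamond contains a single cell, and its flip would change nothing.\<close>

definition brick_params :: "int \<Rightarrow> (int \<times> int \<times> int set \<times> int set) set" where
  "brick_params N = {1, -1} \<times> {1, -1} \<times>
     {(A, B). A \<subseteq> {1..N - 1} \<and> B \<subseteq> {1..N - 1} \<and> (\<forall>i\<in>A. \<forall>j\<in>B. i + j > N)}"

text \<open>The components are the sense of rotation, the center and the sets of flipped pairs. The row pairs with
  index greater than \<open>N - \<bar>u0\<bar>\<close> do not meet the column of the center; the rays fix the signs of all others.\<close>

definition pinwheel_params :: "int \<Rightarrow> ((int \<times> int \<times> int) \<times> int set \<times> int set) set" where
  "pinwheel_params N = (SIGMA (x, u0, v0) : {1, -1} \<times> {(u0, v0). \<bar>u0\<bar> + \<bar>v0\<bar> < N}.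
     Pow {N - \<bar>u0\<bar> + 1..N - 1} \<times> Pow {N - \<bar>v0\<bar> + 1..N - 1})"

definition tatami_fields :: "int \<Rightarrow> ((int \<Rightarrow> int \<Rightarrow> int) \<times> (int \<Rightarrow> int \<Rightarrow> int)) set" where
  "tatami_fields N = {(p, r). tatami_field N p r}"

text \<open>Cells near the axis on an outer line do move, so the sign of the line can be read off there.\<close>

lemma fits_inward_row:
  assumes "diamond N z w" "\<bar>z\<bar> \<le> 1" "P z w = 1 \<or> P z w = -1" "R z w = 1 \<or> R z w = -1" "w * R z w < 0"
  shows "fits N P R z w"
proof -
  have "\<bar>w + R z w\<bar> = \<bar>w\<bar> - 1" using assms(4,5) by (auto simp: mult_less_0_iff)
  moreover have "\<bar>z + P z w\<bar> \<le> \<bar>z\<bar> + 1" using assms(3) by auto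
  ultimately show ?thesis using assms(1,3,4) by (auto simp: fits_def diamond_def)
qed

lemma fits_inward_col:
  assumes "diamond N w z" "\<bar>z\<bar> \<le> 1" "P w z = 1 \<or> P w z = -1" "R w z = 1 \<or> R w z = -1" "w * P w z < 0"
  shows "fits N P R w z"
proof -
  have "\<bar>w + P w z\<bar> = \<bar>w\<bar> - 1" using assms(3,5) by (auto simp: mult_less_0_iff)
  moreover have "\<bar>z + R w z\<bar> \<le> \<bar>z\<bar> + 1" using assms(4) by auto
  ultimately show ?thesis using assms(1,3,4) by (auto simp: fits_def diamond_def)
qed

text \<open>A cell of row \<open>w\<close> in one of the two columns of the pair with index \<open>0\<close>, which is never flipped.\<close>

lemma brick_axis:
  assumes a: "a = 1 \<or> a = -1" and w: "\<bar>w\<bar> \<le> N"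
  shows "\<exists>z. diamond N z w \<and> \<bar>z\<bar> \<le> 1 \<and> pair_index N a z \<le> 0"
proof (cases "even (N + w)")
  case True
  then show ?thesis using w pair_index_le(1)[of N a 0] by (intro exI[of _ 0]) (auto simp: diamond_def)
next
  case False
  have "\<bar>w\<bar> \<noteq> N"
  proof
    assume "\<bar>w\<bar> = N"
    then have "w = N \<or> w = - N" by linarith
    then show False using False by auto
  qed
  moreover have "pair_index N a (outer_line N a 0) \<le> 0" using pair_lines(3)[OF a, of 0 N] by auto
  moreover have "\<bar>outer_line N a 0\<bar> = 1" using pair_lines(1)[OF a, of 0 N] by simp
  moreover have "odd (outer_line N a 0)" using calculation(3) by (auto simp: abs_if split: if_splits)
  ultimately show ?thesis using w False by (intro exI[of _ "outer_line N a 0"]) (auto simp: diamond_def)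
qed

lemma flip_inj: "flip A i = flip A' i \<Longrightarrow> i \<in> A \<longleftrightarrow> i \<in> A'"
  by (auto simp: flip_def split: if_splits)

lemma flipped_bricks_p_pm: "a = 1 \<or> a = -1 \<Longrightarrow> flipped_bricks_p N a b A u v = 1 \<or> flipped_bricks_p N a b A u v = -1"
  using psign_cases[of v] by (auto simp: flipped_bricks_p_def flip_def)
lemma flipped_bricks_r_pm: "b = 1 \<or> b = -1 \<Longrightarrow> flipped_bricks_r N a b B u v = 1 \<or> flipped_bricks_r N a b B u v = -1"
  using psign_cases[of u] by (auto simp: flipped_bricks_r_def flip_def)

lemma brick_read_row:
  assumes ab: "a = 1 \<or> a = -1" "b = 1 \<or> b = -1" and i: "0 \<le> i" "i < N"
  shows "\<exists>z. \<forall>A B. B \<subseteq> {1..N - 1} \<longrightarrow>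
    trim_p N (flipped_bricks_p N a b A) (flipped_bricks_r N a b B) z (outer_line N b i) = a * psign (outer_line N b i) * flip A i"
proof -
  note of = pair_lines[OF ab(2) i(1), of N]
  obtain z where z: "diamond N z (outer_line N b i)" "\<bar>z\<bar> \<le> 1" "pair_index N a z \<le> 0"
    using brick_axis[OF ab(1), of "outer_line N b i" N] of(1) i by auto
  have "trim_p N (flipped_bricks_p N a b A) (flipped_bricks_r N a b B) z (outer_line N b i) = a * psign (outer_line N b i) * flip A i"
    if "B \<subseteq> {1..N - 1}" for A B
  proof -
    have "pair_index N a z \<notin> B" using that z(3) by force
    then have "flipped_bricks_r N a b B z (outer_line N b i) = b * psign (N + outer_line N b i)"
      using diamond_psign[OF z(1)] by (simp add: flipped_bricks_r_def flip_def)
    then have "fits N (flipped_bricks_p N a b A) (flipped_bricks_r N a b B) z (outer_line N b i)"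
      using of(6) by (intro fits_inward_row[OF z(1,2) flipped_bricks_p_pm[OF ab(1)] flipped_bricks_r_pm[OF ab(2)]]) simp
    then show ?thesis using of(3) by (simp add: trim_p_def flipped_bricks_p_def)
  qed
  then show ?thesis by blast
qed

lemma brick_read_col:
  assumes ab: "a = 1 \<or> a = -1" "b = 1 \<or> b = -1" and i: "0 \<le> i" "i < N"
  shows "\<exists>z. \<forall>A B. A \<subseteq> {1..N - 1} \<longrightarrow>
    trim_r N (flipped_bricks_p N a b A) (flipped_bricks_r N a b B) (outer_line N a i) z = b * psign (outer_line N a i) * flip B i"
proof -
  note of = pair_lines[OF ab(1) i(1), of N]
  obtain z where z: "diamond N z (outer_line N a i)" "\<bar>z\<bar> \<le> 1" "pair_index N b z \<le> 0"
    using brick_axis[OF ab(2), of "outer_line N a i" N] of(1) i by auto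
  then have D: "diamond N (outer_line N a i) z" by (simp add: diamond_swap)
  have "trim_r N (flipped_bricks_p N a b A) (flipped_bricks_r N a b B) (outer_line N a i) z = b * psign (outer_line N a i) * flip B i"
    if "A \<subseteq> {1..N - 1}" for A B
  proof -
    have "pair_index N b z \<notin> A" using that z(3) by force
    then have "flipped_bricks_p N a b A (outer_line N a i) z = a * psign (N + outer_line N a i)"
      using diamond_psign[OF z(1)] by (simp add: flipped_bricks_p_def flip_def)
    then have "fits N (flipped_bricks_p N a b A) (flipped_bricks_r N a b B) (outer_line N a i) z"
      using of(6) by (intro fits_inward_col[OF D z(2) flipped_bricks_p_pm[OF ab(1)] flipped_bricks_r_pm[OF ab(2)]]) simp
    then show ?thesis using of(3) by (simp add: trim_r_def flipped_bricks_r_def)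
  qed
  then show ?thesis by blast
qed

text \<open>The leftmost cell of row \<open>0\<close> can only move to the right, and whether it moves shows the sign \<open>a\<close>.\<close>

lemma brick_read_ab:
  assumes ab: "a = 1 \<or> a = -1" "b = 1 \<or> b = -1" and A: "A \<subseteq> {1..N - 1}" and B: "B \<subseteq> {1..N - 1}" and N: "N \<ge> 1"
  shows "trim_p N (flipped_bricks_p N a b A) (flipped_bricks_r N a b B) (- N) 0 = 1 \<longleftrightarrow> a = 1"
    "trim_r N (flipped_bricks_p N a b A) (flipped_bricks_r N a b B) 0 (- N) = 1 \<longleftrightarrow> b = 1"
proof -
  have "pair_index N b 0 \<notin> A" "pair_index N a 0 \<notin> B" using A B pair_index_le(1)[of N b 0] pair_index_le(1)[of N a 0] by auto
  then have 1: "flipped_bricks_p N a b A u 0 = a" "flipped_bricks_r N a b B 0 u = b" for u by (simp_all add: flipped_bricks_p_def flipped_bricks_r_def flip_def)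
  have "fits N (flipped_bricks_p N a b A) (flipped_bricks_r N a b B) (- N) 0" if "a = 1"
    using flipped_bricks_r_pm[OF ab(2), of N a B "-N" 0] N that unfolding fits_def diamond_def 1 by auto
  then show "trim_p N (flipped_bricks_p N a b A) (flipped_bricks_r N a b B) (- N) 0 = 1 \<longleftrightarrow> a = 1"
    using ab(1) by (auto simp: trim_p_def 1)
  have "fits N (flipped_bricks_p N a b A) (flipped_bricks_r N a b B) 0 (- N)" if "b = 1"
    using flipped_bricks_p_pm[OF ab(1), of N b A 0 "-N"] N that unfolding fits_def diamond_def 1 by auto
  then show "trim_r N (flipped_bricks_p N a b A) (flipped_bricks_r N a b B) 0 (- N) = 1 \<longleftrightarrow> b = 1"
    using ab(2) by (auto simp: trim_r_def 1)
qed

lemma inj_brick: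
  assumes N: "N \<ge> 1"
  shows "inj_on (brick_fields N) (brick_params N)"
proof (rule inj_onI)
  fix d d' assume d: "d \<in> brick_params N" "d' \<in> brick_params N" and eq: "brick_fields N d = brick_fields N d'"
  obtain a b A B a' b' A' B' where dd: "d = (a, b, A, B)" "d' = (a', b', A', B')" by (metis prod.exhaust)
  have ab: "a = 1 \<or> a = -1" "b = 1 \<or> b = -1" "a' = 1 \<or> a' = -1" "b' = 1 \<or> b' = -1"
    and AB: "A \<subseteq> {1..N - 1}" "B \<subseteq> {1..N - 1}" "A' \<subseteq> {1..N - 1}" "B' \<subseteq> {1..N - 1}"
    using d unfolding dd brick_params_def by auto
  have e: "trim_p N (flipped_bricks_p N a b A) (flipped_bricks_r N a b B) = trim_p N (flipped_bricks_p N a' b' A') (flipped_bricks_r N a' b' B')"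
    "trim_r N (flipped_bricks_p N a b A) (flipped_bricks_r N a b B) = trim_r N (flipped_bricks_p N a' b' A') (flipped_bricks_r N a' b' B')"
    using eq by (simp_all add: dd brick_fields_def)
  have aa: "a' = a" "b' = b"
    using brick_read_ab[OF ab(1,2) AB(1,2) N] brick_read_ab[OF ab(3,4) AB(3,4) N] ab unfolding e by auto
  have nz: "s * psign w * k = s * psign w * l \<Longrightarrow> k = l" if "s = 1 \<or> s = -1" for s w k l :: int
    using that psign_cases[of w] by auto
  have A: "A = A'"
  proof (rule set_eqI)
    fix i
    show "i \<in> A \<longleftrightarrow> i \<in> A'"
    proof (cases "0 \<le> i \<and> i < N")
      case True
      then obtain z where z: "\<And>A B. B \<subseteq> {1..N - 1} \<Longrightarrow>
          trim_p N (flipped_bricks_p N a b A) (flipped_bricks_r N a b B) z (outer_line N b i) = a * psign (outer_line N b i) * flip A i"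
        using brick_read_row[OF ab(1,2)] by blast
      have "a * psign (outer_line N b i) * flip A i = a * psign (outer_line N b i) * flip A' i"
        using z[OF AB(2), of A] z[OF AB(4), of A'] unfolding e(1)[unfolded aa] by (rule trans[OF sym])
      then show ?thesis using nz[OF ab(1)] flip_inj by blast
    qed (use AB in auto)
  qed
  have B: "B = B'"
  proof (rule set_eqI)
    fix i
    show "i \<in> B \<longleftrightarrow> i \<in> B'"
    proof (cases "0 \<le> i \<and> i < N")
      case True
      then obtain z where z: "\<And>A B. A \<subseteq> {1..N - 1} \<Longrightarrow>
          trim_r N (flipped_bricks_p N a b A) (flipped_bricks_r N a b B) (outer_line N a i) z = b * psign (outer_line N a i) * flip B i"
        using brick_read_col[OF ab(1,2)] by blast
      have "b * psign (outer_line N a i) * flip B i = b * psign (outer_line N a i) * flip B' i"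
        using z[OF AB(1), of B] z[OF AB(3), of B'] unfolding e(2)[unfolded aa] by (rule trans[OF sym])
      then show ?thesis using nz[OF ab(2)] flip_inj by blast
    qed (use AB in auto)
  qed
  show "d = d'" unfolding dd aa A B ..
qed

text \<open>On a row that contains a center the sign changes, but here every row has one sign.\<close>

lemma brick_field_ok:
  assumes N: "N \<ge> 1" and d: "d \<in> brick_params N"
  shows "brick_fields N d \<in> tatami_fields N" "\<not> tatami_field.center N (fst (brick_fields N d)) (snd (brick_fields N d)) u0 v0"
proof -
  obtain a b A B where dd: "d = (a, b, A, B)" by (metis prod.exhaust)
  have ab: "a = 1 \<or> a = -1" "b = 1 \<or> b = -1"
    and AB: "A \<subseteq> {1..N - 1}" "B \<subseteq> {1..N - 1}" and c: "\<And>i j. i \<in> A \<Longrightarrow> j \<in> B \<Longrightarrow> i + j > N"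
    using d unfolding dd brick_params_def by auto
  let ?p = "trim_p N (flipped_bricks_p N a b A) (flipped_bricks_r N a b B)" and ?r = "trim_r N (flipped_bricks_p N a b A) (flipped_bricks_r N a b B)"
  have tf: "tatami_field N ?p ?r" by (rule arrows_field[OF arrows_flipped_bricks[OF ab c]])
  then show "brick_fields N d \<in> tatami_fields N" by (simp add: dd brick_fields_def tatami_fields_def)
  have "\<not> tatami_field.center N ?p ?r u0 v0"
  proof
    assume c: "tatami_field.center N ?p ?r u0 v0"
    then have lt: "\<bar>u0\<bar> + \<bar>v0\<bar> < N" by (simp add: tatami_field.center_def[OF tf])
    define e :: int where "e = (if even (u0 + v0 + N) then 2 else 1)"
    have D: "diamond N (u0 + e) v0" "diamond N (u0 - e) v0"
      using lt parity_gap[OF lt] by (cases "even (u0 + v0 + N)"; simp add: diamond_def e_def; linarith)+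
    have e: "e > 0" by (simp add: e_def)
    have "?p (u0 + e) v0 = -1" "?p (u0 - e) v0 = 1"
      using tatami_field.center_row[OF tf c D(1)] tatami_field.center_row[OF tf c D(2)] e by (auto simp: sgn_if)
    then have "flipped_bricks_p N a b A (u0 + e) v0 = -1" "flipped_bricks_p N a b A (u0 - e) v0 = 1"
      by (auto simp: trim_p_def split: if_splits)
    then show False by (simp add: flipped_bricks_p_def)
  qed
  then show "\<not> tatami_field.center N (fst (brick_fields N d)) (snd (brick_fields N d)) u0 v0"
    by (simp add: dd brick_fields_def)
qed

lemma toward:
  assumes "\<bar>u0\<bar> + \<bar>v0\<bar> < (N::int)" "\<bar>u\<bar> + \<bar>v0\<bar> \<le> N" "u \<noteq> u0"
  shows "\<bar>u + sgn (u0 - u)\<bar> + \<bar>v0\<bar> + 1 \<le> N"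
  using assms by (cases u u0 rule: linorder_cases) auto

lemma pinwheel_field_ok:
  assumes x: "x = 1 \<or> x = -1" and lt: "\<bar>u0\<bar> + \<bar>v0\<bar> < N"
    and A: "A \<subseteq> {N - \<bar>u0\<bar> + 1..N - 1}" and B: "B \<subseteq> {N - \<bar>v0\<bar> + 1..N - 1}"
  defines "p \<equiv> trim_p N (flipped_pinwheel_p N x u0 v0 A) (flipped_pinwheel_r N x u0 v0 B)" and "r \<equiv> trim_r N (flipped_pinwheel_p N x u0 v0 A) (flipped_pinwheel_r N x u0 v0 B)"
  shows "tatami_field N p r" "tatami_field.center N p r u0 v0"
    "p u0 (v0 + (if even (u0 + v0 + N) then 2 else 1)) = x * psign u0"
proof -
  note ar = arrows_flipped_pinwheel[OF x lt A B]
  note arD = ar[unfolded arrows_def, rule_format]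
  show tf: "tatami_field N p r" unfolding p_def r_def by (rule arrows_field[OF ar])
  have nA: "pair_index N b v \<notin> A" if "\<bar>v\<bar> \<le> N - \<bar>u0\<bar>" for b v
    using A pair_index_le(1)[of N b v] that by force
  have nB: "pair_index N b u \<notin> B" if "\<bar>u\<bar> \<le> N - \<bar>v0\<bar>" for b u
    using B pair_index_le(1)[of N b u] that by force
  have P: "flipped_pinwheel_p N x u0 v0 A u v = pinwheel_p x u0 v0 u v" if "\<bar>v\<bar> \<le> N - \<bar>u0\<bar>" for u v
    using nA[OF that] by (simp add: flipped_pinwheel_p_def flip_def)
  have R: "flipped_pinwheel_r N x u0 v0 B u v = pinwheel_r x u0 v0 u v" if "\<bar>u\<bar> \<le> N - \<bar>v0\<bar>" for u v
    using nB[OF that] by (simp add: flipped_pinwheel_r_def flip_def)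
  have row: "p u v0 = sgn (u0 - u)" if D: "diamond N u v0" for u
  proof -
    have 1: "flipped_pinwheel_p N x u0 v0 A u v0 = sgn (u0 - u)" using P[of v0 u] lt by (simp add: pinwheel_p_def)
    have "fits N (flipped_pinwheel_p N x u0 v0 A) (flipped_pinwheel_r N x u0 v0 B) u v0" if "u \<noteq> u0"
    proof -
      have "flipped_pinwheel_p N x u0 v0 A u v0 = 0 \<or> flipped_pinwheel_r N x u0 v0 B u v0 = 1 \<or> flipped_pinwheel_r N x u0 v0 B u v0 = -1" using arD[OF D] by blast
      then have r: "flipped_pinwheel_r N x u0 v0 B u v0 = 1 \<or> flipped_pinwheel_r N x u0 v0 B u v0 = -1" using 1 that by (auto simp: sgn_if split: if_splits)
      have "\<bar>u\<bar> + \<bar>v0\<bar> \<le> N" using D by (simp add: diamond_def)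
      then have "\<bar>u + sgn (u0 - u)\<bar> + \<bar>v0\<bar> + 1 \<le> N" using toward[OF lt] that by blast
      then show ?thesis using D r that unfolding fits_def 1 diamond_def by (auto simp: sgn_if)
    qed
    then show ?thesis using 1 by (cases "u = u0") (auto simp: p_def trim_p_def)
  qed
  have col: "r u0 v = sgn (v0 - v)" if D: "diamond N u0 v" for v
  proof -
    have 1: "flipped_pinwheel_r N x u0 v0 B u0 v = sgn (v0 - v)" using R[of u0 v] lt by (simp add: pinwheel_r_def)
    have "fits N (flipped_pinwheel_p N x u0 v0 A) (flipped_pinwheel_r N x u0 v0 B) u0 v" if "v \<noteq> v0"
    proof -
      have "flipped_pinwheel_r N x u0 v0 B u0 v = 0 \<or> flipped_pinwheel_p N x u0 v0 A u0 v = 1 \<or> flipped_pinwheel_p N x u0 v0 A u0 v = -1" using arD[OF D] by blast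
      then have r: "flipped_pinwheel_p N x u0 v0 A u0 v = 1 \<or> flipped_pinwheel_p N x u0 v0 A u0 v = -1" using 1 that by (auto simp: sgn_if split: if_splits)
      have "\<bar>v\<bar> + \<bar>u0\<bar> \<le> N" using D by (simp add: diamond_def)
      then have "\<bar>v + sgn (v0 - v)\<bar> + \<bar>u0\<bar> + 1 \<le> N" using toward[of v0 u0 N v] lt that by simp
      then show ?thesis using D r that unfolding fits_def 1 diamond_def by (auto simp: sgn_if)
    qed
    then show ?thesis using 1 by (cases "v = v0") (auto simp: r_def trim_r_def)
  qed
  show c: "tatami_field.center N p r u0 v0" unfolding tatami_field.center_def[OF tf] using lt row col by blast
  \<comment> \<open>The first cell beyond the center in its column shows the sense of rotation.\<close>
  define w where "w = v0 + (if even (u0 + v0 + N) then 2 else 1)"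
  have D: "diamond N u0 w" 
    using lt parity_gap[OF lt] by (cases "even (u0 + v0 + N)"; simp add: diamond_def w_def; linarith)
  have "r u0 w = -1" using col[OF D] by (auto simp: w_def)
  then have "fits N (flipped_pinwheel_p N x u0 v0 A) (flipped_pinwheel_r N x u0 v0 B) u0 w" by (auto simp: r_def trim_r_def split: if_splits)
  moreover have "\<bar>w\<bar> \<le> N - \<bar>u0\<bar>" using D unfolding diamond_def by linarith
  ultimately have "p u0 w = x * psign u0" using P[of w u0] by (simp add: p_def trim_p_def pinwheel_p_def w_def)
  then show "p u0 (v0 + (if even (u0 + v0 + N) then 2 else 1)) = x * psign u0" by (simp only: w_def)
qed

lemma pinwheel_read_row:
  assumes x: "x = 1 \<or> x = -1" and lt: "\<bar>u0\<bar> + \<bar>v0\<bar> < N" and i: "N - \<bar>u0\<bar> + 1 \<le> i" "i < N"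
  shows "\<exists>z w k. k \<noteq> 0 \<and> (\<forall>A B. A \<subseteq> {N - \<bar>u0\<bar> + 1..N - 1} \<longrightarrow> B \<subseteq> {N - \<bar>v0\<bar> + 1..N - 1} \<longrightarrow>
    trim_p N (flipped_pinwheel_p N x u0 v0 A) (flipped_pinwheel_r N x u0 v0 B) z w = k * flip A i)"
proof -
  define b where "b = x * sgn u0"
  have u0: "u0 \<noteq> 0" using i by auto
  have b: "b = 1 \<or> b = -1" using x u0 by (auto simp: b_def sgn_if)
  have i0: "0 \<le> i" using i lt by linarith
  note of = pair_lines[OF b i0, of N]
  define w where "w = outer_line N b i"
  obtain z where z: "diamond N z w" "\<bar>z\<bar> \<le> 1"
    using brick_axis[of 1 w N] of(1) i w_def by auto
  have pair_index: "pair_index N b w > N - \<bar>u0\<bar>" using i of(3) w_def by simp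
  note zone = pinwheel_corner_rows[OF x lt pair_index z(1)]
  have zz: "\<bar>z\<bar> \<le> N - \<bar>v0\<bar>" using z(1) of(1) i lt unfolding diamond_def w_def by linarith
  have "trim_p N (flipped_pinwheel_p N x u0 v0 A) (flipped_pinwheel_r N x u0 v0 B) z w = pinwheel_p x u0 v0 z w * flip A i"
    if AB: "A \<subseteq> {N - \<bar>u0\<bar> + 1..N - 1}" "B \<subseteq> {N - \<bar>v0\<bar> + 1..N - 1}" for A B
  proof -
    have P: "flipped_pinwheel_p N x u0 v0 A z w = pinwheel_p x u0 v0 z w * flip A i" using of(3) by (simp add: flipped_pinwheel_p_def w_def b_def)
    have "pair_index N (- x * psign N * sgn v0) z \<notin> B" using AB(2) pair_index_le(1)[of N "- x * psign N * sgn v0" z] zz by force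
    then have R: "flipped_pinwheel_r N x u0 v0 B z w = b * psign (N + w)" using zone by (simp add: flipped_pinwheel_r_def flip_def b_def)
    have Rpm: "flipped_pinwheel_r N x u0 v0 B z w = 1 \<or> flipped_pinwheel_r N x u0 v0 B z w = -1" unfolding R using b psign_cases[of "N + w"] by auto
    then have Ppm: "flipped_pinwheel_p N x u0 v0 A z w = 1 \<or> flipped_pinwheel_p N x u0 v0 A z w = -1"
      using arrows_flipped_pinwheel[OF x lt AB, unfolded arrows_def, rule_format, OF z(1)] by force
    have "w * flipped_pinwheel_r N x u0 v0 B z w < 0" unfolding R using of(6) unfolding w_def .
    then have "fits N (flipped_pinwheel_p N x u0 v0 A) (flipped_pinwheel_r N x u0 v0 B) z w"
      by (rule fits_inward_row[where P = "flipped_pinwheel_p N x u0 v0 A" and R = "flipped_pinwheel_r N x u0 v0 B", OF z Ppm Rpm])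
    then show ?thesis by (simp add: trim_p_def P)
  qed
  moreover have "pinwheel_p x u0 v0 z w \<noteq> 0"
    using zone x psign_cases[of "N + w"] of(1) i0 by (auto simp: w_def sgn_if)
  ultimately show ?thesis by blast
qed

lemma pinwheel_read_col:
  assumes x: "x = 1 \<or> x = -1" and lt: "\<bar>u0\<bar> + \<bar>v0\<bar> < N" and i: "N - \<bar>v0\<bar> + 1 \<le> i" "i < N"
  shows "\<exists>z w k. k \<noteq> 0 \<and> (\<forall>A B. A \<subseteq> {N - \<bar>u0\<bar> + 1..N - 1} \<longrightarrow> B \<subseteq> {N - \<bar>v0\<bar> + 1..N - 1} \<longrightarrow>
    trim_r N (flipped_pinwheel_p N x u0 v0 A) (flipped_pinwheel_r N x u0 v0 B) w z = k * flip B i)"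
proof -
  define a where "a = - x * psign N * sgn v0"
  have v0: "v0 \<noteq> 0" using i by auto
  have a: "a = 1 \<or> a = -1" using x v0 psign_cases[of N] by (auto simp: a_def sgn_if)
  have i0: "0 \<le> i" using i lt by linarith
  note of = pair_lines[OF a i0, of N]
  define w where "w = outer_line N a i"
  obtain z where z': "diamond N z w" and z: "\<bar>z\<bar> \<le> 1"
    using brick_axis[of 1 w N] of(1) i w_def by auto
  have D: "diamond N w z" using z' by (simp add: diamond_swap)
  have pair_index: "pair_index N a w > N - \<bar>v0\<bar>" using i of(3) w_def by simp
  note zone = pinwheel_corner_cols[OF x lt pair_index D]
  have zz: "\<bar>z\<bar> \<le> N - \<bar>u0\<bar>" using D of(1) i lt unfolding diamond_def w_def by linarith
  have "trim_r N (flipped_pinwheel_p N x u0 v0 A) (flipped_pinwheel_r N x u0 v0 B) w z = pinwheel_r x u0 v0 w z * flip B i"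
    if AB: "A \<subseteq> {N - \<bar>u0\<bar> + 1..N - 1}" "B \<subseteq> {N - \<bar>v0\<bar> + 1..N - 1}" for A B
  proof -
    have R: "flipped_pinwheel_r N x u0 v0 B w z = pinwheel_r x u0 v0 w z * flip B i" using of(3) by (simp add: flipped_pinwheel_r_def w_def a_def)
    have "pair_index N (x * sgn u0) z \<notin> A" using AB(1) pair_index_le(1)[of N "x * sgn u0" z] zz by force
    then have P: "flipped_pinwheel_p N x u0 v0 A w z = a * psign (N + w)" using zone by (simp add: flipped_pinwheel_p_def flip_def a_def)
    have Ppm: "flipped_pinwheel_p N x u0 v0 A w z = 1 \<or> flipped_pinwheel_p N x u0 v0 A w z = -1" unfolding P using a psign_cases[of "N + w"] by auto
    then have Rpm: "flipped_pinwheel_r N x u0 v0 B w z = 1 \<or> flipped_pinwheel_r N x u0 v0 B w z = -1"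
      using arrows_flipped_pinwheel[OF x lt AB, unfolded arrows_def, rule_format, OF D] by force
    have "w * flipped_pinwheel_p N x u0 v0 A w z < 0" unfolding P using of(6) unfolding w_def .
    then have "fits N (flipped_pinwheel_p N x u0 v0 A) (flipped_pinwheel_r N x u0 v0 B) w z"
      by (rule fits_inward_col[where P = "flipped_pinwheel_p N x u0 v0 A" and R = "flipped_pinwheel_r N x u0 v0 B", OF D z Ppm Rpm])
    then show ?thesis by (simp add: trim_r_def R)
  qed
  moreover have "pinwheel_r x u0 v0 w z \<noteq> 0"
    using zone x psign_cases[of w] of(1) i0 by (auto simp: w_def sgn_if)
  ultimately show ?thesis by blast
qed

lemma inj_pinwheel: "inj_on (pinwheel_fields N) (pinwheel_params N)"
proof (rule inj_onI)
  fix d d' assume d: "d \<in> pinwheel_params N" "d' \<in> pinwheel_params N" and eq: "pinwheel_fields N d = pinwheel_fields N d'"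
  obtain x u0 v0 A B x' u0' v0' A' B' where dd: "d = ((x, u0, v0), A, B)" "d' = ((x', u0', v0'), A', B')"
    by (metis prod.exhaust)
  have x: "x = 1 \<or> x = -1" "x' = 1 \<or> x' = -1" and lt: "\<bar>u0\<bar> + \<bar>v0\<bar> < N" "\<bar>u0'\<bar> + \<bar>v0'\<bar> < N"
    and AB: "A \<subseteq> {N - \<bar>u0\<bar> + 1..N - 1}" "B \<subseteq> {N - \<bar>v0\<bar> + 1..N - 1}"
    and AB': "A' \<subseteq> {N - \<bar>u0'\<bar> + 1..N - 1}" "B' \<subseteq> {N - \<bar>v0'\<bar> + 1..N - 1}"
    using d unfolding dd pinwheel_params_def by auto
  have e: "trim_p N (flipped_pinwheel_p N x u0 v0 A) (flipped_pinwheel_r N x u0 v0 B) = trim_p N (flipped_pinwheel_p N x' u0' v0' A') (flipped_pinwheel_r N x' u0' v0' B')"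
    "trim_r N (flipped_pinwheel_p N x u0 v0 A) (flipped_pinwheel_r N x u0 v0 B) = trim_r N (flipped_pinwheel_p N x' u0' v0' A') (flipped_pinwheel_r N x' u0' v0' B')"
    using eq by (simp_all add: dd pinwheel_fields_def)
  note ok = pinwheel_field_ok[OF x(1) lt(1) AB] and ok' = pinwheel_field_ok[OF x(2) lt(2) AB', folded e]
  have uv: "u0' = u0" "v0' = v0" using tatami_field.center_unique[OF ok(1) ok(2) ok'(2)] by auto
  have "x * psign u0 = x' * psign u0" using ok(3) ok'(3) unfolding uv by simp
  then have xx: "x' = x" using psign_cases[of u0] by auto
  note e = e[unfolded uv xx] and AB' = AB'[unfolded uv]
  have A: "A = A'"
  proof (rule set_eqI)
    fix i
    show "i \<in> A \<longleftrightarrow> i \<in> A'"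
    proof (cases "N - \<bar>u0\<bar> + 1 \<le> i \<and> i < N")
      case True
      then obtain z w k where k: "k \<noteq> 0" and z: "\<And>A B. A \<subseteq> {N - \<bar>u0\<bar> + 1..N - 1} \<Longrightarrow> B \<subseteq> {N - \<bar>v0\<bar> + 1..N - 1} \<Longrightarrow>
          trim_p N (flipped_pinwheel_p N x u0 v0 A) (flipped_pinwheel_r N x u0 v0 B) z w = k * flip A i"
        using pinwheel_read_row[OF x(1) lt(1)] by blast
      have "k * flip A i = k * flip A' i" using z[OF AB] z[OF AB'] unfolding e(1) by (rule trans[OF sym])
      then have "flip A i = flip A' i" using mult_left_cancel[OF k] by blast
      then show ?thesis by (rule flip_inj)
    qed (use AB AB' in auto)
  qed
  have B: "B = B'"
  proof (rule set_eqI)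
    fix i
    show "i \<in> B \<longleftrightarrow> i \<in> B'"
    proof (cases "N - \<bar>v0\<bar> + 1 \<le> i \<and> i < N")
      case True
      then obtain z w k where k: "k \<noteq> 0" and z: "\<And>A B. A \<subseteq> {N - \<bar>u0\<bar> + 1..N - 1} \<Longrightarrow> B \<subseteq> {N - \<bar>v0\<bar> + 1..N - 1} \<Longrightarrow>
          trim_r N (flipped_pinwheel_p N x u0 v0 A) (flipped_pinwheel_r N x u0 v0 B) w z = k * flip B i"
        using pinwheel_read_col[OF x(1) lt(1)] by blast
      have "k * flip B i = k * flip B' i" using z[OF AB] z[OF AB'] unfolding e(2) by (rule trans[OF sym])
      then have "flip B i = flip B' i" using mult_left_cancel[OF k] by blast
      then show ?thesis by (rule flip_inj)
    qed (use AB AB' in auto)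
  qed
  show "d = d'" unfolding dd uv xx A B ..
qed

theorem tatami_fields_eq:
  assumes N: "N \<ge> 1"
  shows "tatami_fields N = brick_fields N ` brick_params N \<union> pinwheel_fields N ` pinwheel_params N"
    "brick_fields N ` brick_params N \<inter> pinwheel_fields N ` pinwheel_params N = {}"
proof -
  have pw: "pinwheel_fields N d \<in> tatami_fields N \<and> (\<exists>u0 v0. tatami_field.center N (fst (pinwheel_fields N d)) (snd (pinwheel_fields N d)) u0 v0)"
    if d: "d \<in> pinwheel_params N" for d
  proof -
    obtain x u0 v0 A B where dd: "d = ((x, u0, v0), A, B)" by (metis prod.exhaust)
    have x: "x = 1 \<or> x = -1" and lt: "\<bar>u0\<bar> + \<bar>v0\<bar> < N"
      and AB: "A \<subseteq> {N - \<bar>u0\<bar> + 1..N - 1}" "B \<subseteq> {N - \<bar>v0\<bar> + 1..N - 1}"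
      using d unfolding dd pinwheel_params_def by auto
    show ?thesis using pinwheel_field_ok(1,2)[OF x lt AB] by (auto simp: dd pinwheel_fields_def tatami_fields_def)
  qed
  show "brick_fields N ` brick_params N \<inter> pinwheel_fields N ` pinwheel_params N = {}"
  proof (rule equals0I)
    fix t assume "t \<in> brick_fields N ` brick_params N \<inter> pinwheel_fields N ` pinwheel_params N"
    then obtain d d' where d: "d \<in> brick_params N" "t = brick_fields N d" "d' \<in> pinwheel_params N" "t = pinwheel_fields N d'"
      by blast
    then obtain u0 v0 where "tatami_field.center N (fst t) (snd t) u0 v0" using pw[OF d(3)] by auto
    then show False using brick_field_ok(2)[OF N d(1)] d(2) by blast
  qed
  have "t \<in> brick_fields N ` brick_params N \<union> pinwheel_fields N ` pinwheel_params N" if "t \<in> tatami_fields N" for t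
  proof -
    obtain p r where t: "t = (p, r)" by fastforce
    have tf: "tatami_field N p r" using that by (simp add: t tatami_fields_def)
    show ?thesis
    proof (cases "\<exists>u0 v0. tatami_field.center N p r u0 v0")
      case True
      then obtain x u0 v0 where sp: "tatami_field.spin N p r x u0 v0" using tatami_field.center_spin[OF tf] by blast
      then have "x = 1 \<or> x = -1" "\<bar>u0\<bar> + \<bar>v0\<bar> < N"
        by (auto simp: tatami_field.spin_def[OF tf] tatami_field.center_def[OF tf])
      moreover obtain A B where "A\<subseteq>{N - \<bar>u0\<bar> + 1..N - 1}" "B\<subseteq>{N - \<bar>v0\<bar> + 1..N - 1}"
        "p = trim_p N (flipped_pinwheel_p N x u0 v0 A) (flipped_pinwheel_r N x u0 v0 B)" "r = trim_r N (flipped_pinwheel_p N x u0 v0 A) (flipped_pinwheel_r N x u0 v0 B)"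
        using tatami_field.center_data[OF tf sp] by blast
      ultimately have "((x, u0, v0), A, B) \<in> pinwheel_params N" "t = pinwheel_fields N ((x, u0, v0), A, B)"
        by (auto simp: pinwheel_params_def pinwheel_fields_def t)
      then show ?thesis by blast
    next
      case False
      then have nc: "\<not> tatami_field.center N p r u v" for u v by blast
      from tatami_field.brick_data[OF tf nc N] obtain a b A B where "a = 1 \<or> a = -1" "b = 1 \<or> b = -1"
        "A \<subseteq> {1..N - 1}" "B \<subseteq> {1..N - 1}" "\<forall>i\<in>A. \<forall>j\<in>B. i + j > N"
        "p = trim_p N (flipped_bricks_p N a b A) (flipped_bricks_r N a b B)" "r = trim_r N (flipped_bricks_p N a b A) (flipped_bricks_r N a b B)"
        by (elim exE conjE) (rule that)
      then have "(a, b, A, B) \<in> brick_params N" "t = brick_fields N (a, b, A, B)"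
        unfolding brick_params_def brick_fields_def t by simp_all
      then show ?thesis by blast
    qed
  qed
  then show "tatami_fields N = brick_fields N ` brick_params N \<union> pinwheel_fields N ` pinwheel_params N"
    using pw brick_field_ok(1)[OF N] by blast
qed

section \<open>The number of fields\<close>

text \<open>Replacing \<open>j\<close> by \<open>N - j\<close> in the second set turns the condition \<open>i + j > N\<close> into \<open>j < i\<close>, which allows a
  recursion on the largest possible element.\<close>

definition separated :: "nat \<Rightarrow> (int set \<times> int set) set" where
  "separated k = {(A, B). A \<subseteq> {1..int k} \<and> B \<subseteq> {1..int k} \<and> (\<forall>i\<in>A. \<forall>j\<in>B. j < i)}"

lemma finite_separated: "finite (separated k)"
  by (rule finite_subset[of _ "Pow {1..int k} \<times> Pow {1..int k}"]) (auto simp: separated_def)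

text \<open>If the new largest element belongs to \<open>B\<close>, then \<open>A\<close> is empty and the rest of \<open>B\<close> is arbitrary. Adding it to
  \<open>A\<close> is always possible.\<close>

lemma separated_Suc:
  "separated (Suc k) = separated k \<union> (\<lambda>(A, B). (insert (int k + 1) A, B)) ` separated k
     \<union> (\<lambda>B. ({}, insert (int k + 1) B)) ` Pow {1..int k}" (is "?L = ?R1 \<union> ?R2 \<union> ?R3")
proof
  let ?n = "int k + 1"
  have I: "{1..int (Suc k)} = insert ?n {1..int k}" by auto
  show "?L \<subseteq> ?R1 \<union> ?R2 \<union> ?R3"
  proof
    fix t assume "t \<in> ?L"
    then obtain A B where t: "t = (A, B)" and A: "A \<subseteq> insert ?n {1..int k}" and B: "B \<subseteq> insert ?n {1..int k}"
      and AB: "\<And>i j. i \<in> A \<Longrightarrow> j \<in> B \<Longrightarrow> j < i" by (auto simp: separated_def I[symmetric])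
    consider "?n \<in> B" | "?n \<notin> B" "?n \<in> A" | "?n \<notin> B" "?n \<notin> A" by blast
    then show "t \<in> ?R1 \<union> ?R2 \<union> ?R3"
    proof cases
      case 1
      then have "A = {}" using AB[OF _ 1] A by force
      then have "t = ({}, insert ?n (B - {?n}))" "B - {?n} \<in> Pow {1..int k}" using t 1 B by auto
      then show ?thesis by blast
    next
      case 2
      have "(A - {?n}, B) \<in> separated k" using A B AB 2 by (auto simp: separated_def)
      moreover have "t = (\<lambda>(A, B). (insert ?n A, B)) (A - {?n}, B)" using t 2 by auto
      ultimately show ?thesis by blast
    next
      case 3
      then have "A \<subseteq> {1..int k}" "B \<subseteq> {1..int k}" using A B by blast+
      then have "t \<in> separated k" using AB t by (auto simp: separated_def)
      then show ?thesis by blast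
    qed
  qed
  show "?R1 \<union> ?R2 \<union> ?R3 \<subseteq> ?L" by (fastforce simp: separated_def)
qed

lemma card_separated: "2 * card (separated k) = (k + 2) * 2 ^ k"
proof (induction k)
  case 0
  have "separated 0 = {({}, {})}" by (auto simp: separated_def)
  then show ?case by simp
next
  case (Suc k)
  let ?n = "int k + 1"
  let ?R2 = "(\<lambda>(A, B). (insert ?n A, B)) ` separated k" and ?R3 = "(\<lambda>B. ({} :: int set, insert ?n B)) ` Pow {1..int k}"
  have sub: "?n \<notin> A \<and> ?n \<notin> B" if "(A, B) \<in> separated k" for A B using that by (force simp: separated_def)
  have "inj_on (\<lambda>(A, B). (insert ?n A, B)) (separated k)"
    by (rule inj_onI) (use sub in \<open>auto simp: insert_ident\<close>)
  then have c2: "card ?R2 = card (separated k)" by (rule card_image)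
  have "inj_on (\<lambda>B. ({} :: int set, insert ?n B)) (Pow {1..int k})"
  proof (rule inj_onI)
    fix B B' assume "B \<in> Pow {1..int k}" "B' \<in> Pow {1..int k}" "({} :: int set, insert ?n B) = ({}, insert ?n B')"
    moreover have "?n \<notin> B" "?n \<notin> B'" using calculation by auto
    ultimately show "B = B'" by (auto simp: insert_ident)
  qed
  then have c3: "card ?R3 = 2 ^ k" by (simp add: card_image card_Pow)
  have d: "(separated k \<union> ?R2) \<inter> ?R3 = {}" "separated k \<inter> ?R2 = {}" using sub by fastforce+
  have "card (separated (Suc k)) = card (separated k) + card (separated k) + 2 ^ k"
    unfolding separated_Suc using d c2 c3 finite_separated[of k]
    by (simp add: card_Un_disjoint)
  then show ?case using Suc by (simp add: algebra_simps)
qed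

lemma card_brick_params:
  assumes m: "m \<ge> 1"
  shows "card (brick_params (int m)) = (m + 1) * 2 ^ m"
proof -
  define S where "S = {(A, B). A \<subseteq> {1..int m - 1} \<and> B \<subseteq> {1..int m - 1} \<and> (\<forall>i\<in>A. \<forall>j\<in>B. i + j > int m)}"
  define k where "k = m - 1"
  have k: "int m - 1 = int k" "int m = int k + 1" using m by (simp_all add: k_def)
  let ?f = "\<lambda>(A, B). (A, (\<lambda>j. int m - j) ` B)"
  have "bij_betw ?f S (separated k)"
  proof (rule bij_betw_byWitness[where f' = ?f])
    have inv: "(\<lambda>j. int m - j) ` (\<lambda>j. int m - j) ` B = B" for B by (auto simp: image_image)
    show "\<forall>a\<in>S. ?f (?f a) = a" "\<forall>a\<in>separated k. ?f (?f a) = a" by (auto simp: inv)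
    show "?f ` S \<subseteq> separated k" "?f ` separated k \<subseteq> S" unfolding S_def separated_def k by fastforce+
  qed
  then have "card S = card (separated k)" by (rule bij_betw_same_card)
  then have "2 * card S = (m + 1) * 2 ^ k" using card_separated[of k] m by (simp add: k_def)
  moreover have "brick_params (int m) = {1, -1} \<times> {1, -1} \<times> S" by (simp add: brick_params_def S_def)
  then have "card (brick_params (int m)) = 4 * card S" by (simp add: card_cartesian_product)
  moreover have "(2::nat) ^ m = 2 * 2 ^ k" using m by (cases m) (simp_all add: k_def)
  ultimately show ?thesis by simp
qed

lemma sum_symmetric_Suc:
  fixes f :: "int \<Rightarrow> 'a :: comm_monoid_add"
  shows "(\<Sum>u\<in>{- int (Suc k)..int (Suc k)}. f u) = (\<Sum>u\<in>{- int k..int k}. f u) + (f (int k + 1) + f (- int k - 1))"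
proof -
  have "{- int (Suc k)..int (Suc k)} = insert (int k + 1) (insert (- int k - 1) {- int k..int k})" by auto
  then show ?thesis by (simp add: add_ac)
qed

text \<open>The number of sets of flipped pairs that a center with this coordinate admits. The value at \<open>0\<close>
  is \<open>1\<close>, by truncated subtraction.\<close>

definition corner_weight :: "int \<Rightarrow> int" where "corner_weight u = 2 ^ nat (\<bar>u\<bar> - 1)"

lemma sum_corner_weight: "(\<Sum>u\<in>{- int k..int k}. corner_weight u) = 2 ^ (k + 1) - 1"
proof (induction k)
  case (Suc k)
  then show ?case unfolding sum_symmetric_Suc by (simp add: corner_weight_def)
qed (simp add: corner_weight_def)

text \<open>Partial sums, so that the induction can be on the range while \<open>M\<close> stays fixed.\<close>

lemma sum_corner_weight_shifted:
  "k \<le> M \<Longrightarrow> (\<Sum>u\<in>{- int k..int k}. corner_weight u * (2 ^ (nat (int M - \<bar>u\<bar>) + 1) - 1)) = (int k + 1) * 2 ^ (M + 1) - 2 ^ (k + 1) + 1"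
proof (induction k)
  case (Suc k)
  have "nat (int M - (int k + 1)) = M - Suc k" by simp
  moreover have "(2::int) ^ k * 2 ^ (M - Suc k + 1) = 2 ^ M" 
  proof -
    obtain d where "M = Suc k + d" using Suc.prems le_Suc_ex by blast
    then show ?thesis by (simp add: power_add)
  qed
  ultimately show ?case using Suc unfolding sum_symmetric_Suc by (simp add: corner_weight_def algebra_simps)
qed (simp add: corner_weight_def)

lemma sum_corner_weight_diamond:
  "(\<Sum>(u, v)\<in>{(u, v). \<bar>u\<bar> + \<bar>v\<bar> \<le> int M}. corner_weight u * corner_weight v) = int M * 2 ^ (M + 1) + 1"
proof -
  have "{(u, v). \<bar>u\<bar> + \<bar>v\<bar> \<le> int M} = (SIGMA u : {- int M..int M}. {- int (nat (int M - \<bar>u\<bar>))..int (nat (int M - \<bar>u\<bar>))})"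
    (is "?L = ?R")
  proof (rule set_eqI)
    fix t :: "int \<times> int"
    obtain u v where t: "t = (u, v)" by fastforce
    show "t \<in> ?L \<longleftrightarrow> t \<in> ?R" unfolding t by (cases "\<bar>u\<bar> \<le> int M") (simp_all, linarith+)
  qed
  then have "(\<Sum>(u, v)\<in>{(u, v). \<bar>u\<bar> + \<bar>v\<bar> \<le> int M}. corner_weight u * corner_weight v)
     = (\<Sum>u\<in>{- int M..int M}. \<Sum>v\<in>{- int (nat (int M - \<bar>u\<bar>))..int (nat (int M - \<bar>u\<bar>))}. corner_weight u * corner_weight v)"
    by (simp add: sum.Sigma)
  also have "\<dots> = (\<Sum>u\<in>{- int M..int M}. corner_weight u * (2 ^ (nat (int M - \<bar>u\<bar>) + 1) - 1))"
    by (simp only: sum_distrib_left[symmetric] sum_corner_weight)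
  also have "\<dots> = int M * 2 ^ (M + 1) + 1" using sum_corner_weight_shifted[of M M] by (simp add: algebra_simps)
  finally show ?thesis .
qed

lemma card_pinwheel_params:
  assumes m: "m \<ge> 1"
  shows "int (card (pinwheel_params (int m))) = 2 * ((int m - 1) * 2 ^ m + 1)"
proof -
  define M where "M = m - 1"
  have M: "int m - 1 = int M" "m = M + 1" using m by (simp_all add: M_def)
  let ?C = "{1, -1 :: int} \<times> {(u0, v0). \<bar>u0\<bar> + \<bar>v0\<bar> < int m}"
  have C: "{(u0, v0). \<bar>u0\<bar> + \<bar>v0\<bar> < int m} = {(u0, v0). \<bar>u0\<bar> + \<bar>v0\<bar> \<le> int M}" using M by auto
  have fin: "finite {(u0 :: int, v0 :: int). \<bar>u0\<bar> + \<bar>v0\<bar> \<le> int M}"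
    by (rule finite_subset[of _ "{- int M..int M} \<times> {- int M..int M}"]) auto
  have cp: "int (card (Pow {int m - \<bar>u\<bar> + 1..int m - 1})) = corner_weight u" for u
    by (simp add: card_Pow corner_weight_def algebra_simps)
  have "pinwheel_params (int m) = (SIGMA c : ?C.
     Pow {int m - \<bar>fst (snd c)\<bar> + 1..int m - 1} \<times> Pow {int m - \<bar>snd (snd c)\<bar> + 1..int m - 1})"
    unfolding pinwheel_params_def by (rule Sigma_cong) auto
  then have "card (pinwheel_params (int m)) = (\<Sum>c\<in>?C. card (Pow {int m - \<bar>fst (snd c)\<bar> + 1..int m - 1} \<times> Pow {int m - \<bar>snd (snd c)\<bar> + 1..int m - 1}))"
    using fin C by (simp add: card_SigmaI)
  then have "int (card (pinwheel_params (int m))) = (\<Sum>c\<in>?C. corner_weight (fst (snd c)) * corner_weight (snd (snd c)))"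
    by (simp only: of_nat_sum card_cartesian_product of_nat_mult cp)
  also have "\<dots> = (\<Sum>x\<in>{1, -1 :: int}. \<Sum>(u, v)\<in>{(u, v). \<bar>u\<bar> + \<bar>v\<bar> \<le> int M}. corner_weight u * corner_weight v)"
    unfolding C sum.cartesian_product by (intro sum.cong) auto
  also have "\<dots> = 2 * (int M * 2 ^ (M + 1) + 1)" by (simp only: sum_corner_weight_diamond) simp
  finally show ?thesis using M by simp
qed

theorem card_tatami_fields: "2 * int (card (tatami_fields (int m))) = 2 ^ (m + 1) * (3 * (int m + 1) - 4) + 4"
proof (cases "m = 0")
  case True
  have "tatami_fields 0 = {(\<lambda>u v. 0, \<lambda>u v. 0)}"
  proof -
    have D: "diamond 0 u v \<longleftrightarrow> u = 0 \<and> v = 0" for u v by (auto simp: diamond_def)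
    have 0: "tatami_field 0 (\<lambda>u v. 0) (\<lambda>u v. 0)" by unfold_locales (auto simp: D)
    have 1: "p = (\<lambda>u v. 0) \<and> r = (\<lambda>u v. 0)" if "tatami_field 0 p r" for p r
    proof -
      have "p u v = 0 \<and> r u v = 0" for u v
        using tatami_field.move[OF that, of u v] tatami_field.outside[OF that, of u v] D by auto
      then show ?thesis by (simp add: fun_eq_iff)
    qed
    show ?thesis
    proof (rule set_eqI)
      fix t :: "(int \<Rightarrow> int \<Rightarrow> int) \<times> (int \<Rightarrow> int \<Rightarrow> int)"
      obtain p r where t: "t = (p, r)" by fastforce
      show "t \<in> tatami_fields 0 \<longleftrightarrow> t \<in> {(\<lambda>u v. 0, \<lambda>u v. 0)}"
        unfolding t tatami_fields_def mem_Collect_eq prod.case singleton_iff prod.inject using 0 1 by blast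
    qed
  qed
  then show ?thesis using True by simp
next
  case False
  then have m: "m \<ge> 1" by simp
  then have N: "int m \<ge> 1" by simp
  have fin: "finite (brick_params (int m))" "finite (pinwheel_params (int m))"
  proof -
    show "finite (brick_params (int m))"
      by (rule finite_subset[of _ "{1, -1} \<times> {1, -1} \<times> Pow {1..int m - 1} \<times> Pow {1..int m - 1}"])
        (auto simp: brick_params_def)
    show "finite (pinwheel_params (int m))"
    proof (rule card_ge_0_finite)
      have "0 < 2 * (x + 1)" if "0 \<le> x" for x :: int using that by simp
      from this[of "(int m - 1) * 2 ^ m"] have "int (card (pinwheel_params (int m))) > 0"
        unfolding card_pinwheel_params[OF m] using m by simp
      then show "card (pinwheel_params (int m)) > 0" by simp
    qed
  qed
  have "card (tatami_fields (int m)) = card (brick_params (int m)) + card (pinwheel_params (int m))"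
    unfolding tatami_fields_eq(1)[OF N] using tatami_fields_eq(2)[OF N] fin card_image[OF inj_brick[OF N]] card_image[OF inj_pinwheel[of "int m"]]
    by (simp add: card_Un_disjoint)
  then have "int (card (tatami_fields (int m))) = (int m + 1) * 2 ^ m + 2 * ((int m - 1) * 2 ^ m + 1)"
    using card_brick_params[OF m] card_pinwheel_params[OF m] by (simp add: algebra_simps)
  then show ?thesis by (simp add: algebra_simps)
qed

section \<open>Squares of the parts of compositions\<close>

lemma compositions_1: "compositions 1 = {[1]}"
proof -
  have "as = [1]" if "as \<in> compositions 1" for as
    using that by (cases as; cases "tl as") (auto simp: compositions_def)
  then show ?thesis by (auto simp: compositions_def)
qed

definition increase_first :: "nat list \<Rightarrow> nat list" where "increase_first as = Suc (hd as) # tl as"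

lemma compositions_Suc:
  assumes "n \<ge> 1"
  shows "compositions (Suc n) = (\<lambda>as. 1 # as) ` compositions n \<union> increase_first ` compositions n"
    "inj_on (\<lambda>as. 1 # as) (compositions n)" "inj_on increase_first (compositions n)"
    "(\<lambda>as. 1 # as) ` compositions n \<inter> increase_first ` compositions n = {}"
proof -
  show "inj_on (\<lambda>as. 1 # as) (compositions n)" by (rule inj_onI) simp
  show "inj_on increase_first (compositions n)"
    by (rule inj_onI) (auto simp: increase_first_def compositions_def intro: list.expand)
  show "(\<lambda>as. 1 # as) ` compositions n \<inter> increase_first ` compositions n = {}"
    by (auto simp: increase_first_def compositions_def) (metis gr0_conv_Suc hd_in_set less_irrefl)
  show "compositions (Suc n) = (\<lambda>as. 1 # as) ` compositions n \<union> increase_first ` compositions n"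
  proof
    show "compositions (Suc n) \<subseteq> (\<lambda>as. 1 # as) ` compositions n \<union> increase_first ` compositions n"
    proof
      fix as assume as: "as \<in> compositions (Suc n)"
      then obtain a bs where ab: "as = a # bs" "a > 0" by (cases as) (auto simp: compositions_def)
      show "as \<in> (\<lambda>as. 1 # as) ` compositions n \<union> increase_first ` compositions n"
      proof (cases "a = 1")
        case True
        then have "bs \<in> compositions n" using as ab assms by (auto simp: compositions_def)
        then show ?thesis using ab True by blast
      next
        case False
        then have "(a - 1) # bs \<in> compositions n" "increase_first ((a - 1) # bs) = as"
          using as ab by (auto simp: compositions_def increase_first_def)
        then show ?thesis by (metis UnCI image_eqI)
      qed
    qed
    show "(\<lambda>as. 1 # as) ` compositions n \<union> increase_first ` compositions n \<subseteq> compositions (Suc n)"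
    proof -
      have "increase_first as \<in> compositions (Suc n)" if "as \<in> compositions n" for as
        using that by (cases as) (auto simp: compositions_def increase_first_def)
      then show ?thesis by (auto simp: compositions_def)
    qed
  qed
qed

lemma sum_compositions_Suc:
  fixes f :: "nat list \<Rightarrow> int"
  assumes "n \<ge> 1"
  shows "(\<Sum>as\<in>compositions (Suc n). f as) = (\<Sum>as\<in>compositions n. f (1 # as) + f (increase_first as))"
  unfolding compositions_Suc(1)[OF assms]
  using compositions_Suc(2-4)[OF assms]
  by (simp add: sum.union_disjoint finite_compositions sum.reindex sum.distrib)

text \<open>Increasing the first part \<open>a\<close> adds \<open>2 * a + 1\<close> to the sum of squares. The recursion therefore involves
  the number of compositions and the sum of their first parts, and these are determined in the
  same induction.\<close>

lemma sum_squares_compositions: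
  assumes "n \<ge> 1"
  shows "2 * (\<Sum>as\<in>compositions n. int (\<Sum>a\<leftarrow>as. a\<^sup>2)) = 2 ^ n * (3 * int n - 4) + 4"
proof -
  have "2 * (\<Sum>as\<in>compositions n. 1) = (2 ^ n :: int) \<and>
     (\<Sum>as\<in>compositions n. int (hd as)) = 2 ^ n - 1 \<and>
     2 * (\<Sum>as\<in>compositions n. int (\<Sum>a\<leftarrow>as. a\<^sup>2)) = 2 ^ n * (3 * int n - 4) + 4"
    using assms
  proof (induction n rule: dec_induct)
    case base
    show ?case unfolding compositions_1 by simp
  next
    case (step n)
    have g: "int (\<Sum>a\<leftarrow>increase_first as. a\<^sup>2) = int (\<Sum>a\<leftarrow>as. a\<^sup>2) + 2 * int (hd as) + 1" if "as \<in> compositions n" for as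
      using that by (cases as) (auto simp: compositions_def increase_first_def power2_eq_square)
    have S: "(\<Sum>as\<in>compositions (Suc n). int (\<Sum>a\<leftarrow>as. a\<^sup>2))
      = (\<Sum>as\<in>compositions n. 2 * int (\<Sum>a\<leftarrow>as. a\<^sup>2) + 2 * int (hd as) + 2 * 1)"
      unfolding sum_compositions_Suc[OF step(1)]
      by (intro sum.cong refl) (simp only: g, simp)
    have H: "(\<Sum>as\<in>compositions (Suc n). int (hd as)) = (\<Sum>as\<in>compositions n. int (hd as) + 2 * 1)"
      unfolding sum_compositions_Suc[OF step(1)] by (intro sum.cong refl) (simp add: increase_first_def)
    have C: "(\<Sum>as\<in>compositions (Suc n). 1) = (\<Sum>as\<in>compositions n. 2 * 1 :: int)"
      unfolding sum_compositions_Suc[OF step(1)] by simp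
    show ?case unfolding S H C sum.distrib sum_distrib_left[symmetric] using step.IH
      by (simp add: algebra_simps)
  qed
  then show ?thesis by blast
qed

section \<open>Tilings as fields\<close>

text \<open>A tiling as the involution that exchanges the two cells of every dimer and fixes the monomers.\<close>

definition mating :: "nat \<Rightarrow> (cell \<Rightarrow> cell) \<Rightarrow> bool" where
  "mating n g \<longleftrightarrow> (\<forall>c\<in>grid n. g c \<in> grid n \<and> g (g c) = c \<and> (monomer {c, g c} \<or> dimer {c, g c}))"

definition tiles :: "nat \<Rightarrow> (cell \<Rightarrow> cell) \<Rightarrow> cell set set" where
  "tiles n g = (\<lambda>c. {c, g c}) ` grid n"

definition block :: "nat \<Rightarrow> nat \<Rightarrow> cell set" where
  "block i j = {(i, j), (i + 1, j), (i, j + 1), (i + 1, j + 1)}"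

lemma mating_tile:
  assumes "mating n g" "c \<in> grid n" "t \<in> tiles n g" "c \<in> t" shows "t = {c, g c}"
  using assms unfolding mating_def tiles_def by (auto simp: insert_commute)

lemma tiles_tiling:
  assumes g: "mating n g" shows "monomer_dimer_tiling n (tiles n g)"
  unfolding monomer_dimer_tiling_def
proof
  show "partition_on (grid n) (tiles n g)"
  proof (rule partition_onI)
    show "\<Union> (tiles n g) = grid n" using g by (auto simp: tiles_def mating_def)
    show "disjnt t t'" if "t \<in> tiles n g" "t' \<in> tiles n g" "t \<noteq> t'" for t t'
    proof (rule ccontr)
      assume "\<not> disjnt t t'"
      then obtain c where c: "c \<in> t" "c \<in> t'" by (auto simp: disjnt_def)
      have "c \<in> grid n" using c that g by (auto simp: tiles_def mating_def)
      then show False using mating_tile[OF g _ that(1) c(1)] mating_tile[OF g _ that(2) c(2)] that(3) by auto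
    qed
  qed (auto simp: tiles_def)
  show "\<forall>t\<in>tiles n g. monomer t \<or> dimer t" using g by (auto simp: tiles_def mating_def)
qed

lemma tiling_mating:
  assumes T: "monomer_dimer_tiling n T" shows "\<exists>g. mating n g \<and> T = tiles n g"
proof -
  have P: "partition_on (grid n) T" and md: "\<And>t. t \<in> T \<Longrightarrow> monomer t \<or> dimer t"
    using T by (auto simp: monomer_dimer_tiling_def)
  have uniq: "t = t'" if "t \<in> T" "t' \<in> T" "c \<in> t" "c \<in> t'" for t t' c
    using partition_onD2[OF P] that unfolding disjoint_def by blast
  have ex: "\<exists>d. {c, d} \<in> T" if c: "c \<in> grid n" for c
  proof -
    obtain t where t: "t \<in> T" "c \<in> t" using c P by (auto simp: partition_on_def)
    have "\<exists>d. t = {c, d}" using md[OF t(1)] t(2)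
      by (auto simp: monomer_def dimer_def horizontal_dimer_def vertical_dimer_def insert_commute)
    then show ?thesis using t by auto
  qed
  define g where "g c = (SOME d. {c, d} \<in> T)" for c
  have g: "{c, g c} \<in> T" if "c \<in> grid n" for c unfolding g_def by (rule someI_ex[OF ex[OF that]])
  have sub: "t \<subseteq> grid n" if "t \<in> T" for t using that P by (auto simp: partition_on_def)
  have gg: "g c \<in> grid n" if "c \<in> grid n" for c using sub[OF g[OF that]] by auto
  have inv: "g (g c) = c" if c: "c \<in> grid n" for c
  proof -
    have "{g c, g (g c)} = {c, g c}" using uniq[OF g[OF gg[OF c]] g[OF c], of "g c"] by simp
    then show ?thesis by (metis doubleton_eq_iff)
  qed
  have m: "mating n g" unfolding mating_def using gg inv md g by blast
  moreover have "T = tiles n g"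
  proof
    show "tiles n g \<subseteq> T" using g by (auto simp: tiles_def)
    show "T \<subseteq> tiles n g"
    proof
      fix t assume t: "t \<in> T"
      then obtain c where c: "c \<in> t" using P by (metis ex_in_conv partition_on_def)
      then have cn: "c \<in> grid n" using sub[OF t] by blast
      have "t = {c, g c}" by (rule uniq[OF t g[OF cn] c]) simp
      then show "t \<in> tiles n g" using cn unfolding tiles_def by (rule image_eqI)
    qed
  qed
  ultimately show ?thesis by blast
qed

lemma tiles_inj:
  assumes "mating n g" "mating n h" "tiles n g = tiles n h" "c \<in> grid n" shows "g c = h c"
proof -
  have "{c, g c} \<in> tiles n h" using assms(3,4) by (auto simp: tiles_def)
  then have "{c, g c} = {c, h c}" using mating_tile[OF assms(2,4)] by simp
  then show ?thesis by (metis doubleton_eq_iff)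
qed

text \<open>The intervals \<open>[x, x + 1]\<close> with integral \<open>x\<close> that contain a given number have at most two left ends, and these are
  consecutive.\<close>

lemma unit_square_box:
  "\<exists>i j. \<forall>c. q \<in> unit_square c \<longrightarrow> c \<in> block i j"
proof -
  have *: "\<exists>a. \<forall>x::nat. real x \<le> y \<and> y \<le> real x + 1 \<longrightarrow> x = a \<or> x = a + 1" for y
  proof -
    define a where "a = nat \<lceil>y - 1\<rceil>"
    have "x = a \<or> x = a + 1" if x: "real x \<le> y" "y \<le> real x + 1" for x :: nat
    proof -
      have "\<lceil>y - 1\<rceil> \<le> int x" using x(2) by linarith
      then have "a \<le> x" by (simp add: a_def)
      moreover have "y - 1 \<le> real a" unfolding a_def by linarith
      then have "x \<le> a + 1" using x(1) by linarith
      ultimately show ?thesis by linarith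
    qed
    then show ?thesis by blast
  qed
  obtain i where i: "\<And>x::nat. real x \<le> fst q \<Longrightarrow> fst q \<le> real x + 1 \<Longrightarrow> x = i \<or> x = i + 1" using *[of "fst q"] by blast
  obtain j where j: "\<And>x::nat. real x \<le> snd q \<Longrightarrow> snd q \<le> real x + 1 \<Longrightarrow> x = j \<or> x = j + 1" using *[of "snd q"] by blast
  have "c \<in> block i j" if "q \<in> unit_square c" for c
    using i[of "fst c"] j[of "snd c"] that by (cases c; cases q) (auto simp: unit_square_def block_def)
  then show ?thesis by blast
qed

lemma card_block: "card (block i j) = 4" "finite (block i j)"
  by (simp_all add: block_def)

text \<open>Only the cells of one block can contain a given point. If four tiles share the point, each of them has
  exactly one cell in the block, so the block contains no dimer. Conversely, the four tiles of a block
  without dimer share its midpoint.\<close>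

lemma tatami_tiles:
  assumes g: "mating n g"
  shows "tatami (tiles n g) \<longleftrightarrow> (\<forall>i j. i + 1 < n \<longrightarrow> j + 1 < n \<longrightarrow> (\<exists>c\<in>block i j. g c \<in> block i j \<and> g c \<noteq> c))"
proof
  assume t: "tatami (tiles n g)"
  show "\<forall>i j. i + 1 < n \<longrightarrow> j + 1 < n \<longrightarrow> (\<exists>c\<in>block i j. g c \<in> block i j \<and> g c \<noteq> c)"
  proof (intro allI impI, rule ccontr)
    fix i j assume ij: "i + 1 < n" "j + 1 < n" and no: "\<not> (\<exists>c\<in>block i j. g c \<in> block i j \<and> g c \<noteq> c)"
    have sub: "block i j \<subseteq> grid n" using ij by (auto simp: block_def grid_def)
    define S where "S = (\<lambda>c. {c, g c}) ` block i j"
    have "inj_on (\<lambda>c. {c, g c}) (block i j)"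
    proof (rule inj_onI)
      fix c d assume cd: "c \<in> block i j" "d \<in> block i j" "{c, g c} = {d, g d}"
      then have "c = d \<or> g d = c" by (auto simp: doubleton_eq_iff)
      then show "c = d" using no cd by auto
    qed
    then have "card S = 4" by (simp add: S_def card_image card_block)
    moreover have "S \<subseteq> tiles n g" using sub by (auto simp: S_def tiles_def)
    moreover have "(real (i + 1), real (j + 1)) \<in> region t" if tS: "t \<in> S" for t
    proof -
      obtain c where c: "c \<in> block i j" "t = {c, g c}" using tS unfolding S_def by blast
      then have "(real (i + 1), real (j + 1)) \<in> unit_square c" by (auto simp: block_def unit_square_def)
      then show ?thesis using c by (auto simp: region_def)
    qed
    ultimately show False using t unfolding tatami_def by blast
  qed
next
  assume blk: "\<forall>i j. i + 1 < n \<longrightarrow> j + 1 < n \<longrightarrow> (\<exists>c\<in>block i j. g c \<in> block i j \<and> g c \<noteq> c)"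
  show "tatami (tiles n g)" unfolding tatami_def
  proof
    assume "\<exists>q. \<exists>S\<subseteq>tiles n g. card S = 4 \<and> (\<forall>t\<in>S. q \<in> region t)"
    then obtain q S where S: "S \<subseteq> tiles n g" "card S = 4" "\<And>t. t \<in> S \<Longrightarrow> q \<in> region t" by blast
    obtain i j where ij: "\<And>c. q \<in> unit_square c \<Longrightarrow> c \<in> block i j" using unit_square_box by blast
    have "\<forall>t\<in>S. \<exists>c. c \<in> t \<and> q \<in> unit_square c" using S(3) unfolding region_def by blast
    then obtain f where f: "\<And>t. t \<in> S \<Longrightarrow> f t \<in> t \<and> q \<in> unit_square (f t)" by metis
    have grd: "t \<subseteq> grid n" if "t \<in> tiles n g" for t using that g by (auto simp: tiles_def mating_def)
    have ft: "t = {f t, g (f t)}" if "t \<in> S" for t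
      using mating_tile[OF g, of "f t" t] f[OF that] S(1) grd that by blast
    have inj: "inj_on f S"
    proof (rule inj_onI)
      fix t t' assume "t \<in> S" "t' \<in> S" "f t = f t'"
      then show "t = t'" using ft by metis
    qed
    have "f ` S \<subseteq> block i j" using f ij by blast
    moreover have "card (f ` S) = card (block i j)" using card_image[OF inj] S(2) card_block by simp
    ultimately have fS: "f ` S = block i j" using card_block(2) card_subset_eq by blast
    have "(i + 1, j + 1) \<in> f ` S" unfolding fS by (simp add: block_def)
    then obtain t0 where "t0 \<in> S" "(i + 1, j + 1) = f t0" by blast
    then have "(i + 1, j + 1) \<in> grid n" using f[of t0] S(1) grd by force
    then have "i + 1 < n" "j + 1 < n" by (auto simp: grid_def)
    then obtain c where c: "c \<in> block i j" "g c \<in> block i j" "g c \<noteq> c" using blk by blast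
    obtain t t' where t: "t \<in> S" "c = f t" "t' \<in> S" "g c = f t'" using c fS by (metis imageE)
    have cg: "c \<in> grid n" using t f S(1) grd by blast
    have ggc: "g (g c) = c" using g cg by (simp add: mating_def)
    have "t' = {g c, c}" using ft[OF t(3)] unfolding t(4)[symmetric] ggc .
    moreover have "t = {c, g c}" using ft[OF t(1)] t(2) by simp
    ultimately have "t = t'" by auto
    then show False using t c by simp
  qed
qed

definition diag :: "nat \<Rightarrow> cell \<Rightarrow> int" where "diag n c = int (fst c) + int (snd c) - (int n - 1)"
definition anti :: "cell \<Rightarrow> int" where "anti c = int (fst c) - int (snd c)"
definition cell_at :: "nat \<Rightarrow> int \<Rightarrow> int \<Rightarrow> cell" where
  "cell_at n u v = (nat ((u + v + (int n - 1)) div 2), nat ((u - v + (int n - 1)) div 2))"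

lemma cell_at_coords: "cell_at n (diag n c) (anti c) = c"
  by (cases c) (simp add: cell_at_def diag_def anti_def)

lemma diamond_coords: "diamond (int n - 1) (diag n c) (anti c) \<longleftrightarrow> c \<in> grid n"
proof -
  obtain x y where c: "c = (x, y)" by fastforce
  have "even (int x + int y - (int n - 1) + (int x - int y) + (int n - 1))" by simp
  moreover have "\<bar>int x + int y - (int n - 1)\<bar> + \<bar>int x - int y\<bar> \<le> int n - 1 \<longleftrightarrow> x < n \<and> y < n" by linarith
  ultimately show ?thesis by (simp add: c diamond_def diag_def anti_def grid_def)
qed

lemma coords_cell_at:
  assumes "diamond (int n - 1) u v"
  shows "diag n (cell_at n u v) = u" "anti (cell_at n u v) = v" "cell_at n u v \<in> grid n"
proof -
  have ev: "even (u + v + (int n - 1))" and b: "\<bar>u\<bar> + \<bar>v\<bar> \<le> int n - 1" using assms by (auto simp: diamond_def)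
  obtain k where k: "u + v + (int n - 1) = 2 * k" using ev by blast
  have k2: "u - v + (int n - 1) = 2 * (k - v)" using k by simp
  have "0 \<le> k" "0 \<le> k - v" using k k2 b by linarith+
  then have c: "cell_at n u v = (nat k, nat (k - v))" "int (nat k) = k" "int (nat (k - v)) = k - v"
    by (simp_all add: cell_at_def k k2)
  show "diag n (cell_at n u v) = u" "anti (cell_at n u v) = v"
    unfolding c(1) diag_def anti_def fst_conv snd_conv c(2,3) using k by simp_all
  then show "cell_at n u v \<in> grid n" using assms diamond_coords[of n "cell_at n u v"] by simp
qed

lemma coords_eq: "diag n c = diag n d \<Longrightarrow> anti c = anti d \<Longrightarrow> c = d"
  by (metis cell_at_coords)

text \<open>A horizontal neighbour differs by \<open>\<plusminus>(1, 1)\<close> and a vertical one by \<open>\<plusminus>(1, -1)\<close> in diagonal coordinates.\<close>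

lemma tile_coords:
  "monomer {c, d} \<or> dimer {c, d} \<longleftrightarrow> c = d \<or> \<bar>diag n d - diag n c\<bar> = 1 \<and> \<bar>anti d - anti c\<bar> = 1"
proof -
  obtain x y x' y' where c: "c = (x, y)" "d = (x', y')" by fastforce
  have m: "monomer {c, d} \<longleftrightarrow> c = d" by (auto simp: monomer_def)
  have h: "horizontal_dimer {c, d} \<longleftrightarrow> y' = y \<and> (x' = x + 1 \<or> x = x' + 1)"
    unfolding horizontal_dimer_def c doubleton_eq_iff by auto
  have v: "vertical_dimer {c, d} \<longleftrightarrow> x' = x \<and> (y' = y + 1 \<or> y = y' + 1)"
    unfolding vertical_dimer_def c doubleton_eq_iff by auto
  have "(y' = y \<and> (x' = x + 1 \<or> x = x' + 1)) \<or> (x' = x \<and> (y' = y + 1 \<or> y = y' + 1)) \<longleftrightarrow>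
    \<bar>int x' + int y' - (int n - 1) - (int x + int y - (int n - 1))\<bar> = 1 \<and> \<bar>int x' - int y' - (int x - int y)\<bar> = 1"
    by linarith
  then show ?thesis unfolding m dimer_def h v by (auto simp: c diag_def anti_def)
qed

definition mate :: "nat \<Rightarrow> (int \<Rightarrow> int \<Rightarrow> int) \<times> (int \<Rightarrow> int \<Rightarrow> int) \<Rightarrow> cell \<Rightarrow> cell" where
  "mate n = (\<lambda>(p, r) c. cell_at n (diag n c + p (diag n c) (anti c)) (anti c + r (diag n c) (anti c)))"

lemma block_coords:
  assumes "diag n (i, j) = u" "anti (i, j) = v"
  shows "c \<in> block i j \<longleftrightarrow> diag n c = u \<and> anti c = v \<or> diag n c = u + 2 \<and> anti c = v \<or>
     diag n c = u + 1 \<and> anti c = v + 1 \<or> diag n c = u + 1 \<and> anti c = v - 1"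
proof -
  obtain x y where c: "c = (x, y)" by fastforce
  show ?thesis unfolding assms[symmetric] c by (auto simp: block_def diag_def anti_def)
qed

lemma field_mate:
  assumes f: "(p, r) \<in> tatami_fields (int n - 1)" and c: "c \<in> grid n"
  defines "g \<equiv> mate n (p, r)" and "u \<equiv> diag n c" and "v \<equiv> anti c"
  shows "g c \<in> grid n" "diag n (g c) = u + p u v" "anti (g c) = v + r u v"
proof -
  have tf: "tatami_field (int n - 1) p r" using f by (simp add: tatami_fields_def)
  have D: "diamond (int n - 1) u v" using c diamond_coords by (simp add: u_def v_def)
  have "diamond (int n - 1) (u + p u v) (v + r u v)" using tatami_field.move[OF tf D] D by auto
  from coords_cell_at[OF this] show "g c \<in> grid n" "diag n (g c) = u + p u v" "anti (g c) = v + r u v"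
    by (simp_all add: g_def mate_def u_def v_def)
qed

lemma mate_mating:
  assumes f: "(p, r) \<in> tatami_fields (int n - 1)"
  shows "mating n (mate n (p, r))" "tatami (tiles n (mate n (p, r)))"
proof -
  let ?g = "mate n (p, r)"
  have tf: "tatami_field (int n - 1) p r" using f by (simp add: tatami_fields_def)
  show m: "mating n ?g" unfolding mating_def
  proof (intro ballI conjI)
    fix c assume c: "c \<in> grid n"
    define u v where "u = diag n c" and "v = anti c"
    note gc = field_mate[OF f c, folded u_def v_def]
    show "?g c \<in> grid n" by (rule gc)
    note ggc = field_mate[OF f gc(1), unfolded gc(2,3)]
    have D: "diamond (int n - 1) u v" using c diamond_coords by (simp add: u_def v_def)
    have mv: "p u v = 0 \<and> r u v = 0 \<or> (p u v = 1 \<or> p u v = - 1) \<and> (r u v = 1 \<or> r u v = - 1)"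
      using tatami_field.move[OF tf D] by blast
    have "p (u + p u v) (v + r u v) = - p u v \<and> r (u + p u v) (v + r u v) = - r u v"
      using tatami_field.move[OF tf D] by auto
    then show "?g (?g c) = c" using ggc(2,3) by (intro coords_eq[of n]) (simp_all add: u_def v_def)
    show "monomer {c, ?g c} \<or> dimer {c, ?g c}" unfolding tile_coords[of c "?g c" n]
      using mv gc coords_eq[of n "?g c" c] by (auto simp: u_def v_def)
  qed
  show "tatami (tiles n ?g)" unfolding tatami_tiles[OF m]
  proof (intro allI impI)
    fix i j assume ij: "i + 1 < n" "j + 1 < n"
    have g: "(i, j) \<in> grid n" "(i + 1, j + 1) \<in> grid n" using ij by (auto simp: grid_def)
    define u v where "u = diag n (i, j)" and "v = anti (i, j)"
    have c2: "diag n (i + 1, j + 1) = u + 2" "anti (i + 1, j + 1) = v" by (simp_all add: u_def v_def diag_def anti_def)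
    have D: "diamond (int n - 1) u v" "diamond (int n - 1) (u + 2) v"
      using g diamond_coords[of n "(i, j)"] diamond_coords[of n "(i + 1, j + 1)"] c2 by (auto simp: u_def v_def)
    note bc = block_coords[OF u_def[symmetric] v_def[symmetric]]
    have bl: "(i, j) \<in> block i j" "(i + 1, j + 1) \<in> block i j" by (simp_all add: block_def)
    have "p u v = 1 \<or> p (u + 2) v = -1" using tatami_field.row[OF tf D] .
    then show "\<exists>c\<in>block i j. ?g c \<in> block i j \<and> ?g c \<noteq> c"
    proof
      assume p: "p u v = 1"
      then have r: "r u v = 1 \<or> r u v = -1" using tatami_field.move[OF tf D(1)] by auto
      note m = field_mate[OF f g(1), folded u_def v_def]
      have "?g (i, j) \<in> block i j" unfolding bc m(2,3) using p r by auto
      moreover have "?g (i, j) \<noteq> (i, j)" using m(2) p u_def by auto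
      ultimately show ?thesis using bl by blast
    next
      assume p: "p (u + 2) v = -1"
      then have r: "r (u + 2) v = 1 \<or> r (u + 2) v = -1" using tatami_field.move[OF tf D(2)] by auto
      note m = field_mate[OF f g(2), unfolded c2]
      have "?g (i + 1, j + 1) \<in> block i j" unfolding bc m(2,3) using p r by auto
      moreover have "?g (i + 1, j + 1) \<noteq> (i + 1, j + 1)" using m(2) p c2 by auto
      ultimately show ?thesis using bl by blast
    qed
  qed
qed

text \<open>The two cells of a dimer in a block lie on different diagonals of the block, so the dimer gives the tatami
  condition of the field on the row through one diagonal and on the column through the other.\<close>

lemma mating_field:
  assumes m: "mating n g" and t: "tatami (tiles n g)"
  shows "\<exists>f\<in>tatami_fields (int n - 1). tiles n (mate n f) = tiles n g"
proof -
  let ?N = "int n - 1"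
  define p where "p u v = (if diamond ?N u v then diag n (g (cell_at n u v)) - u else 0)" for u v
  define r where "r u v = (if diamond ?N u v then anti (g (cell_at n u v)) - v else 0)" for u v
  have gD: "g (cell_at n u v) \<in> grid n" "g (g (cell_at n u v)) = cell_at n u v"
    "cell_at n (u + p u v) (v + r u v) = g (cell_at n u v)" "diamond ?N (u + p u v) (v + r u v)"
    "p u v = 0 \<and> r u v = 0 \<or> (p u v = 1 \<or> p u v = - 1) \<and> (r u v = 1 \<or> r u v = - 1)" if D: "diamond ?N u v" for u v
  proof -
    note co = coords_cell_at[OF D]
    show g: "g (cell_at n u v) \<in> grid n" "g (g (cell_at n u v)) = cell_at n u v" using m co(3) by (auto simp: mating_def)
    show "cell_at n (u + p u v) (v + r u v) = g (cell_at n u v)" using D by (simp add: p_def r_def cell_at_coords)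
    show "diamond ?N (u + p u v) (v + r u v)" using D g diamond_coords by (simp add: p_def r_def)
    have "monomer {cell_at n u v, g (cell_at n u v)} \<or> dimer {cell_at n u v, g (cell_at n u v)}"
      using m co(3) by (auto simp: mating_def)
    then show "p u v = 0 \<and> r u v = 0 \<or> (p u v = 1 \<or> p u v = - 1) \<and> (r u v = 1 \<or> r u v = - 1)"
      unfolding tile_coords[of _ _ n] using co D by (auto simp: p_def r_def abs_if split: if_splits)
  qed
  have blk: "\<exists>c\<in>block i j. g c \<in> block i j \<and> g c \<noteq> c" if "i + 1 < n" "j + 1 < n" for i j
    using t that unfolding tatami_tiles[OF m] by blast
  have pr: "p (diag n c) (anti c) = diag n (g c) - diag n c" "r (diag n c) (anti c) = anti (g c) - anti c"
    if "c \<in> grid n" for c using that diamond_coords[of n c] cell_at_coords[of n c] by (simp_all add: p_def r_def)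
  have block_row: "(p u v = 1 \<or> p (u + 2) v = -1) \<and> (r (u + 1) (v - 1) = 1 \<or> r (u + 1) (v + 1) = -1)"
    if D: "diamond ?N u v" "diamond ?N (u + 2) v" for u v
  proof -
    obtain i j where ij: "cell_at n u v = (i, j)" by fastforce
    have uv: "diag n (i, j) = u" "anti (i, j) = v" "(i, j) \<in> grid n" using coords_cell_at[OF D(1)] ij by auto
    have "diag n (i + 1, j + 1) = u + 2" "anti (i + 1, j + 1) = v" using uv by (simp_all add: diag_def anti_def)
    then have "(i + 1, j + 1) \<in> grid n" using D(2) diamond_coords[of n "(i + 1, j + 1)"] by simp
    then have "i + 1 < n" "j + 1 < n" by (auto simp: grid_def)
    then obtain c where c: "c \<in> block i j" "g c \<in> block i j" "g c \<noteq> c" using blk by blast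
    have sub: "block i j \<subseteq> grid n" using \<open>i + 1 < n\<close> \<open>j + 1 < n\<close> by (auto simp: block_def grid_def)
    have cg: "c \<in> grid n" "g c \<in> grid n" "g (g c) = c" using c sub m by (auto simp: mating_def)
    note bc = block_coords[OF uv(1,2)]
    have tile: "\<bar>diag n (g c) - diag n c\<bar> = 1 \<and> \<bar>anti (g c) - anti c\<bar> = 1"
      using m cg(1) c(3) tile_coords[of c "g c" n] by (auto simp: mating_def)
    have pc: "p (diag n c) (anti c) = diag n (g c) - diag n c" "r (diag n c) (anti c) = anti (g c) - anti c"
      "p (diag n (g c)) (anti (g c)) = diag n c - diag n (g c)" "r (diag n (g c)) (anti (g c)) = anti c - anti (g c)"
      using pr[OF cg(1)] pr[OF cg(2)] cg(3) by simp_all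
    have cases: "(diag n c = u \<or> diag n c = u + 2) \<and> anti c = v \<and> diag n (g c) = u + 1 \<and> (anti (g c) = v + 1 \<or> anti (g c) = v - 1) \<or>
      (diag n (g c) = u \<or> diag n (g c) = u + 2) \<and> anti (g c) = v \<and> diag n c = u + 1 \<and> (anti c = v + 1 \<or> anti c = v - 1)"
      using c(1,2)[unfolded bc] tile by (elim disjE conjE) simp_all
    then show ?thesis using pc by (elim disjE conjE) simp_all
  qed
  have tf: "tatami_field ?N p r"
  proof unfold_locales
    fix u v
    show "\<not> diamond ?N u v \<Longrightarrow> p u v = 0 \<and> r u v = 0" by (simp add: p_def r_def)
    show "diamond ?N u v \<Longrightarrow> diamond ?N (u + 2) v \<Longrightarrow> p u v = 1 \<or> p (u + 2) v = - 1" using block_row by blast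
    show "diamond ?N u v \<Longrightarrow> diamond ?N u (v + 2) \<Longrightarrow> r u v = 1 \<or> r u (v + 2) = - 1"
    proof -
      assume D: "diamond ?N u v" "diamond ?N u (v + 2)"
      have "diamond ?N (u - 1) (v + 1)" "diamond ?N (u - 1 + 2) (v + 1)" using D by (auto simp: diamond_def)
      from block_row[OF this] show ?thesis by (simp add: algebra_simps)
    qed
    assume D: "diamond ?N u v"
    have D': "diamond ?N (u + p u v) (v + r u v)" using gD(4)[OF D] .
    have "p (u + p u v) (v + r u v) = diag n (g (g (cell_at n u v))) - (u + p u v)"
      "r (u + p u v) (v + r u v) = anti (g (g (cell_at n u v))) - (v + r u v)"
      using D' gD(3)[OF D] by (simp_all add: p_def[of "u + p u v"] r_def[of "u + p u v"])
    then have "p (u + p u v) (v + r u v) = - p u v" "r (u + p u v) (v + r u v) = - r u v"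
      using gD(2)[OF D] coords_cell_at[OF D] by simp_all
    then show "p u v = 0 \<and> r u v = 0 \<or>
       (p u v = 1 \<or> p u v = - 1) \<and> (r u v = 1 \<or> r u v = - 1) \<and> diamond ?N (u + p u v) (v + r u v) \<and>
       p (u + p u v) (v + r u v) = - p u v \<and> r (u + p u v) (v + r u v) = - r u v"
      using gD(5)[OF D] D' by blast
  qed
  then have f: "(p, r) \<in> tatami_fields ?N" by (simp add: tatami_fields_def)
  have "mate n (p, r) c = g c" if "c \<in> grid n" for c
    by (rule coords_eq[of n]) (simp_all add: field_mate(2,3)[OF f that] pr[OF that])
  then have "tiles n (mate n (p, r)) = tiles n g" by (auto simp: tiles_def)
  then show ?thesis using f by blast
qed

lemma mate_inj:
  assumes f: "(p, r) \<in> tatami_fields (int n - 1)" "(p', r') \<in> tatami_fields (int n - 1)"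
    and eq: "tiles n (mate n (p, r)) = tiles n (mate n (p', r'))"
  shows "(p, r) = (p', r')"
proof -
  have "p u v = p' u v \<and> r u v = r' u v" for u v
  proof (cases "diamond (int n - 1) u v")
    case True
    note co = coords_cell_at[OF True]
    have "mate n (p, r) (cell_at n u v) = mate n (p', r') (cell_at n u v)"
      by (rule tiles_inj[OF mate_mating(1)[OF f(1)] mate_mating(1)[OF f(2)] eq co(3)])
    then show ?thesis using field_mate(2,3)[OF f(1) co(3)] field_mate(2,3)[OF f(2) co(3)] co by simp
  next
    case False
    have "tatami_field (int n - 1) p r" "tatami_field (int n - 1) p' r'" using f by (simp_all add: tatami_fields_def)
    from this[THEN tatami_field.outside, OF False] show ?thesis by simp
  qed
  then show ?thesis by (simp add: fun_eq_iff)
qed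

theorem card_tatami_tilings: "card (tatami_tilings n) = card (tatami_fields (int n - 1))"
proof -
  have "bij_betw (\<lambda>f. tiles n (mate n f)) (tatami_fields (int n - 1)) (tatami_tilings n)"
    unfolding bij_betw_def
  proof
    show "inj_on (\<lambda>f. tiles n (mate n f)) (tatami_fields (int n - 1))"
      by (rule inj_onI) (metis mate_inj prod.exhaust)
    show "(\<lambda>f. tiles n (mate n f)) ` tatami_fields (int n - 1) = tatami_tilings n"
    proof
      show "(\<lambda>f. tiles n (mate n f)) ` tatami_fields (int n - 1) \<subseteq> tatami_tilings n"
        using mate_mating tiles_tiling by (auto simp: tatami_tilings_def)
      show "tatami_tilings n \<subseteq> (\<lambda>f. tiles n (mate n f)) ` tatami_fields (int n - 1)"
      proof
        fix T assume T: "T \<in> tatami_tilings n"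
        then obtain g where g: "mating n g" "T = tiles n g" using tiling_mating by (auto simp: tatami_tilings_def)
        then have "tatami (tiles n g)" using T by (simp add: tatami_tilings_def)
        then show "T \<in> (\<lambda>f. tiles n (mate n f)) ` tatami_fields (int n - 1)" using mating_field[OF g(1)] g(2) by (metis image_eqI)
      qed
    qed
  qed
  then show ?thesis by (simp add: bij_betw_same_card)
qed

theorem proposition1:
  fixes n :: nat
  assumes "n \<ge> 1"
  shows "card (tatami_tilings n) = (\<Sum>as\<in>compositions n. \<Sum>a\<leftarrow>as. a\<^sup>2)"
proof -
  obtain m where m: "n = m + 1" using assms by (metis add.commute le_Suc_ex)
  have "2 * int (card (tatami_tilings n)) = 2 ^ n * (3 * int n - 4) + 4"
    using card_tatami_fields[of m] card_tatami_tilings[of n] by (simp add: m add.commute)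
  also have "\<dots> = 2 * int (\<Sum>as\<in>compositions n. \<Sum>a\<leftarrow>as. a\<^sup>2)"
    using sum_squares_compositions[OF assms] by simp
  finally show ?thesis by linarith
qed

end
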